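(* Let $P_i=N_iD_i^{-1}$, $i=0,1$, be two different $m\times m$ plants with $N_i,D_i\in\mathbb{H}^{m\times m}$ right coprime, and set $$M(s)=\begin{bmatrix}N_0(s)&N_1(s)\\ D_0(s)&D_1(s)\end{bmatrix}.$$ Assume that $\det M(\infty)\neq0$ and that the zeros $s_1,\dots,s_t$ of $\det M(s)$ in $\mathbb{C}_+$ are all simple. For $\lambda\in[0,1]$ let $$N_\lambda=\lambda N_1+(1-\lambda)N_0,\qquad D_\lambda=\lambda D_1+(1-\lambda)D_0,\qquad P_\lambda=N_\lambda D_\lambda^{-1}.$$ Restrict attention to pairs $(\Delta_0,\Delta_1)$ such that $\Delta_0(s)^{-1}\Delta_1(s)$ is diagonalizable at every $s\in\mathbb{C}_+$; that is, consider only compensators $K=D_c^{-1}N_c$ for which the pair $\Delta_i=N_cN_i+D_cD_i$ ($i=0,1$) has this property. Then the set of plants $P_\lambda$, $\lambda\in[0,1]$, can be simultaneously stabilized by a (single) proper compensator if and only if there exist $\Delta_0,\Delta_1\in\mathbb{H}^{m\times m}$ with $\det\Delta_0,\det\Delta_1\in\mathbb{J}$ (and $\Delta_0^{-1}\Delta_1$ diagonalizable at every point of $\mathbb{C}_+$) such that (a) $\begin{bmatrix}\Delta_0(s)&\Delta_1(s)\end{bmatrix}\operatorname{Adj}(M(s))=\mathbf{0}$ at $s=s_1,\dots,s_t$; and (b) the eigenvalues of $\Delta_0(s)^{-1}\Delta_1(s)$ do not intersect the nonpositive real axis, including infinity, at any point $s\in\mathbb{C}_+$, i.e. no eigenvalue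 of $\Delta_0(s)^{-1}\Delta_1(s)$ lies in $(-\infty,0]\cup\{\infty\}$ for any $s\in\mathbb{C}_+$.
   Context: $\mathbb{C}_-$ is the open left half of the complex plane and $\mathbb{C}_+=(\mathbb{C}\setminus\mathbb{C}_-)\cup\{\infty\}$. $\mathbb{H}$ is the ring of proper rational functions in $s$ with real coefficients all of whose poles lie in $\mathbb{C}_-$, $\mathbb{H}^{m\times m}$ is the set of $m\times m$ matrices with entries in $\mathbb{H}$, and $\mathbb{J}$ is the set of multiplicative units of $\mathbb{H}$. $\operatorname{Adj}$ denotes the adjugate (classical adjoint) matrix. Diagonalizable means diagonalizable over $\mathbb{C}$. Coprimeness is over $\mathbb{H}$. A compensator is an $m\times m$ rational matrix $K=D_c^{-1}N_c$ with $N_c,D_c\in\mathbb{H}^{m\times m}$ (left) coprime; it is proper if its entries are proper rational functions. $K$ stabilizes $P_\lambda=N_\lambda D_\lambda^{-1}$ if and only if $N_cN_\lambda+D_cD_\lambda=\Delta_\lambda$ for some $\Delta_\lambda\in\mathbb{H}^{m\times m}$ with $\det\Delta_\lambda\in\mathbb{J}$ (this is taken as the definition of stabilization). $K$ simultaneously stabilizes the family if it stabilizes $P_\lambda$ for every $\lambda\in[0,1]$. *)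

theory Defs
  imports
    "HOL-Computational_Algebra.Computational_Algebra"
    "HOL-Computational_Algebra.Field_as_Ring"
    "Jordan_Normal_Form.Matrix"
    "Jordan_Normal_Form.Determinant"
    "Jordan_Normal_Form.Gauss_Jordan_Elimination"
    "Jordan_Normal_Form.Char_Poly"
begin

type_synonym ratfun = "real poly fract"

datatype ext_complex = Fin complex | Infty

definition C_minus :: "ext_complex set" where
  "C_minus = {Fin z | z. Re z < 0}"

definition C_plus :: "ext_complex set" where
  "C_plus = - C_minus"

text \<open>Numerator and (monic) denominator in lowest terms, read as complex polynomials.\<close>

definition numer :: "ratfun \<Rightarrow> complex poly" where
  "numer r = map_poly complex_of_real (fst (quot_of_fract r))"

definition denom :: "ratfun \<Rightarrow> complex poly" where
  "denom r = map_poly complex_of_real (snd (quot_of_fract r))"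

fun pole_at :: "ratfun \<Rightarrow> ext_complex \<Rightarrow> bool" where
  "pole_at r (Fin z) \<longleftrightarrow> poly (denom r) z = 0"
| "pole_at r Infty \<longleftrightarrow> degree (denom r) < degree (numer r)"

text \<open>The value at infinity is the limit of \<open>r\<close> there.  Values are only meaningful away
  from poles.\<close>

fun value_at :: "ratfun \<Rightarrow> ext_complex \<Rightarrow> complex" where
  "value_at r (Fin z) = poly (numer r) z / poly (denom r) z"
| "value_at r Infty = coeff (numer r) (degree (denom r)) / coeff (denom r) (degree (denom r))"

text \<open>Order of vanishing of a nonzero \<open>r\<close> at a point that is not a pole.\<close>

fun zero_order :: "ratfun \<Rightarrow> ext_complex \<Rightarrow> nat" where
  "zero_order r (Fin z) = Polynomial.order z (numer r)"
| "zero_order r Infty = degree (denom r) - degree (numer r)"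

definition zero_at :: "ratfun \<Rightarrow> ext_complex \<Rightarrow> bool" where
  "zero_at r s \<longleftrightarrow> \<not> pole_at r s \<and> value_at r s = 0"

definition proper :: "ratfun \<Rightarrow> bool" where
  "proper r \<longleftrightarrow> degree (numer r) \<le> degree (denom r)"

definition H_ring :: "ratfun set" where
  "H_ring = {r. proper r \<and> (\<forall>s. pole_at r s \<longrightarrow> s \<in> C_minus)}"

definition J_units :: "ratfun set" where
  "J_units = {u \<in> H_ring. \<exists>v \<in> H_ring. u * v = 1}"

definition H_mat :: "nat \<Rightarrow> ratfun mat set" where
  "H_mat m = {A \<in> carrier_mat m m. elements_mat A \<subseteq> H_ring}"

definition value_mat :: "ratfun mat \<Rightarrow> ext_complex \<Rightarrow> complex mat" where
  "value_mat A s = map_mat (\<lambda>r. value_at r s) A"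

definition proper_mat :: "ratfun mat \<Rightarrow> bool" where
  "proper_mat A \<longleftrightarrow> (\<forall>r \<in> elements_mat A. proper r)"

text \<open>Only used for matrices with nonzero determinant.\<close>

definition mat_inv :: "'a :: field mat \<Rightarrow> 'a mat" where
  "mat_inv A = the (mat_inverse A)"

abbreviation rdet :: "ratfun mat \<Rightarrow> ratfun" where
  "rdet \<equiv> Determinant.det"

text \<open>Coprimeness over the ring of proper stable functions, in the form of Bezout identities.\<close>

definition right_coprime :: "nat \<Rightarrow> ratfun mat \<Rightarrow> ratfun mat \<Rightarrow> bool" where
  "right_coprime m N D \<longleftrightarrow> (\<exists>X \<in> H_mat m. \<exists>Y \<in> H_mat m. X * N + Y * D = 1\<^sub>m m)"

definition left_coprime :: "nat \<Rightarrow> ratfun mat \<Rightarrow> ratfun mat \<Rightarrow> bool" where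
  "left_coprime m N D \<longleftrightarrow> (\<exists>X \<in> H_mat m. \<exists>Y \<in> H_mat m. N * X + D * Y = 1\<^sub>m m)"

definition right_fraction :: "nat \<Rightarrow> ratfun mat \<Rightarrow> ratfun mat \<Rightarrow> ratfun mat \<Rightarrow> bool" where
  "right_fraction m P N D \<longleftrightarrow> N \<in> H_mat m \<and> D \<in> H_mat m \<and> right_coprime m N D \<and>
     rdet D \<noteq> 0 \<and> P = N * mat_inv D"

definition left_fraction :: "nat \<Rightarrow> ratfun mat \<Rightarrow> ratfun mat \<Rightarrow> ratfun mat \<Rightarrow> bool" where
  "left_fraction m K Nc Dc \<longleftrightarrow> Nc \<in> H_mat m \<and> Dc \<in> H_mat m \<and> left_coprime m Nc Dc \<and>
     rdet Dc \<noteq> 0 \<and> K = mat_inv Dc * Nc"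

definition interp :: "real \<Rightarrow> ratfun mat \<Rightarrow> ratfun mat \<Rightarrow> ratfun mat" where
  "interp lam A0 A1 = to_fract [:lam:] \<cdot>\<^sub>m A1 + to_fract [:1 - lam:] \<cdot>\<^sub>m A0"

text \<open>Stabilization is a condition on the fractions: the compensator is given by
  \<open>(Nc, Dc)\<close> and the plant by \<open>(N, D)\<close>.  It is not required that \<open>D\<close> be invertible,
  because for the members of a segment of plants \<open>det D\<close> may vanish identically for
  isolated parameter values.\<close>

definition stabilizes :: "nat \<Rightarrow> ratfun mat \<Rightarrow> ratfun mat \<Rightarrow> ratfun mat \<Rightarrow> ratfun mat \<Rightarrow> bool" where
  "stabilizes m Nc Dc N D \<longleftrightarrow>
     (\<exists>\<Delta> \<in> H_mat m. rdet \<Delta> \<in> J_units \<and> Nc * N + Dc * D = \<Delta>)"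

definition diagonalizable :: "complex mat \<Rightarrow> bool" where
  "diagonalizable A \<longleftrightarrow> (\<exists>B. diagonal_mat B \<and> similar_mat A B)"

definition diagonalizable_on_C_plus :: "ratfun mat \<Rightarrow> bool" where
  "diagonalizable_on_C_plus W \<longleftrightarrow> (\<forall>s \<in> C_plus. diagonalizable (value_mat W s))"

text \<open>Eigenvalues of \<open>W(s)\<close> in the extended plane: infinity is counted when \<open>W\<close> has a pole
  at \<open>s\<close>.\<close>

definition ext_eigenvalues :: "ratfun mat \<Rightarrow> ext_complex \<Rightarrow> ext_complex set" where
  "ext_eigenvalues W s = {Fin e | e. eigenvalue (value_mat W s) e} \<union>
     {Infty | r. r \<in> elements_mat W \<and> pole_at r s}"

definition ext_nonpos :: "ext_complex set" where
  "ext_nonpos = {Fin (complex_of_real x) | x. x \<le> 0} \<union> {Infty}"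

text \<open>The \<open>m \<times> 2m\<close> matrix with blocks \<open>A\<close> and \<open>B\<close> side by side.\<close>

definition hblock :: "'a :: zero mat \<Rightarrow> 'a mat \<Rightarrow> 'a mat" where
  "hblock A B = four_block_mat A B (0\<^sub>m 0 (dim_col A)) (0\<^sub>m 0 (dim_col B))"

end

(*
The forward direction is the determinant identity det ((1 - l) Delta_0 + l Delta_1) =
det Delta_0 * det ((1 - l) + l W) for W = Delta_0^-1 Delta_1.

Backwards, [Nc Dc] = [1 W] Adj M / det M is stable by (a), the zeros of det M being simple, but Dc may be
singular at infinity and K then fails to be proper or to exist.  So W is first perturbed, keeping its
values at the zeros of det M.  Put z = 1/(s + 1), which maps C_plus onto a closed disc and infinity to 0,
and write W = A(z)/a(z) with polynomial A and a.  The perturbed matrix is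

  T(z) (W + t k q Y/a)(z + t b(z)) T(z)^-1,   T = 1 + t b(z) X,

where b is a multiple of the numerator of det M with b(0) = 1, Y is a polynomial matrix commuting with A,
and q = b * disc Y.  It stays diagonalizable on the disc for small t: where q does not vanish, W commutes with
a matrix with distinct eigenvalues; where q vanishes, W is not changed.  The shift z + t b(z) replaces
the value of W at infinity by its value at a generic point: a nonconstant W that happens to be scalar at
infinity may admit no other perturbation that is nonscalar there.  The determinant of Dc at infinity is,
up to nonzero factors, a polynomial in t.  At a suitable non-small t, the choice of X and Y
gives the perturbed matrix any prescribed generic diagonalizable value, so this polynomial is not zero.
*)

theory Submission
  imports Defs "HOL-Analysis.Topology_Euclidean_Space" "HOL-Library.Function_Algebras"
    "Subresultants.Subresultant_Gcd" "Jordan_Normal_Form.Jordan_Normal_Form_Existence"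
begin

hide_const (open) Coset.order Module.smult Finite_Cartesian_Product.mat Finite_Cartesian_Product.vec

subsection \<open>Stable proper rational functions as a ring\<close>

text \<open>The eigenvalue condition is open: it says that (1 - l) + l W is nonsingular for l in
  [0, 1], and both the disc and [0, 1] are compact. Diagonalizability is not open, and an arbitrary
  small perturbation may destroy it where eigenvalues meet. Hence W is only changed by operations
  that respect it: conjugation, a commuting summand and a change of the point. Where W has distinct
  eigenvalues the commuting summand moves these but not the eigenvectors, so the conjugation by T is
  needed as well. Invertibility of M at infinity enters through the right-hand blocks B and D of its
  inverse there. \<open>Dc\<close> at infinity is B + W D, and the identity D0 B + D1 D = 1 at
  infinity provides some Z with B + Z D nonsingular. At z = 0 the shifted point is t itself. The
  non-small value of t is therefore sought in (0, 1], which lies in the disc, so that W is known to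
  be diagonalizable there. All perturbing data must be real while eigenvectors are complex; as
  failure means the vanishing of a polynomial, a good complex choice yields a good real one.\<close>

abbreviation cpoly :: "real poly \<Rightarrow> complex poly" where
  "cpoly \<equiv> map_poly complex_of_real"

definition ev :: "complex \<Rightarrow> real poly \<Rightarrow> complex" where
  "ev z p = poly (cpoly p) z"

lemma cpoly_inj_hom: "inj_idom_hom cpoly"
proof -
  interpret h: inj_idom_hom complex_of_real by unfold_locales auto
  interpret m: map_poly_inj_idom_hom complex_of_real ..
  show ?thesis ..
qed

interpretation cpoly: inj_idom_hom cpoly by (rule cpoly_inj_hom)

interpretation ev: comm_ring_hom "ev z" for z
  by unfold_locales (simp_all add: ev_def cpoly.hom_add cpoly.hom_mult)

lemma degree_cpoly [simp]: "degree (cpoly p) = degree p"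
  by (rule degree_map_poly) auto

lemma coeff_cpoly [simp]: "coeff (cpoly p) n = complex_of_real (coeff p n)"
  by (rule coeff_map_poly) auto

lemma ev_pCons: "ev z (pCons c p) = complex_of_real c + z * ev z p"
  by (cases "c = 0 \<and> p = 0") (auto simp: ev_def map_poly_pCons)

lemma ev_const [simp]: "ev z [:c:] = complex_of_real c"
  by (simp add: ev_pCons)

lemma ev_of_real: "ev (complex_of_real x) p = complex_of_real (poly p x)"
proof -
  interpret h: inj_idom_hom complex_of_real by unfold_locales auto
  interpret m: map_poly_inj_idom_hom complex_of_real ..
  show ?thesis by (simp add: ev_def)
qed

lemma ev_smult [simp]: "ev z (smult c p) = complex_of_real c * ev z p"
  by (simp add: ev_def hom_distribs)

lemma ev_pcompose: "ev z (pcompose p q) = ev (ev z q) p"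
  by (induction p) (simp_all add: pcompose_pCons ev_pCons hom_distribs)

lemma coprime_ev_nonzero:
  assumes "coprime P Q" "ev z Q = 0"
  shows "ev z P \<noteq> 0"
proof -
  from assms(1) obtain u v where "u * P + v * Q = 1"
    using bezout_coefficients_fst_snd[of P Q] by auto
  from arg_cong[OF this, of "ev z"] assms(2) show ?thesis
    by (auto simp: hom_distribs)
qed

text \<open>Any fraction with denominator nonzero at z may be used, not only the reduced one P' / Q'
  of the definitions: by P' Q = P Q', a zero of Q' at z would also be a zero of P', against
  coprimality.\<close>

lemma pole_value_Fin:
  assumes "ev z Q \<noteq> 0"
  shows "\<not> pole_at (Fract P Q) (Fin z)" "value_at (Fract P Q) (Fin z) = ev z P / ev z Q"
proof -
  define r where "r = Fract P Q"
  define P' Q' where "P' = fst (quot_of_fract r)" "Q' = snd (quot_of_fract r)"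
  have Q0: "Q \<noteq> 0" using assms by auto
  have "Fract P' Q' = Fract P Q" "Q' \<noteq> 0" by (simp_all add: P'_Q'_def r_def)
  hence eq: "P' * Q = P * Q'" using Q0 by (simp add: eq_fract)
  have eq': "ev z P' * ev z Q = ev z P * ev z Q'" using arg_cong[OF eq, of "ev z"] by (simp add: hom_distribs)
  have "coprime P' Q'" unfolding P'_Q'_def by (rule coprime_quot_of_fract)
  hence nz: "ev z Q' \<noteq> 0" using coprime_ev_nonzero[of P' Q' z] eq' assms by auto
  show "\<not> pole_at (Fract P Q) (Fin z)" using nz by (simp add: denom_def ev_def P'_Q'_def r_def)
  have "ev z P' / ev z Q' = ev z P / ev z Q" using eq' nz assms by (simp add: field_simps)
  thus "value_at (Fract P Q) (Fin z) = ev z P / ev z Q" 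
    by (simp add: denom_def numer_def ev_def P'_Q'_def r_def)
qed

text \<open>The bounds may exceed the degrees, and then both sides are 0. This form suits the point
  at infinity, where the value of a proper fraction is read off at the degree of its denominator and
  the numerator may have coefficient 0 there.\<close>

lemma coeff_mult_top:
  fixes p q :: "'a :: idom poly"
  assumes "degree p \<le> m" "degree q \<le> n"
  shows "coeff (p * q) (m + n) = coeff p m * coeff q n"
proof (cases "degree p = m \<and> degree q = n")
  case True
  thus ?thesis using coeff_mult_degree_sum[of p q] by auto
next
  case False
  hence "degree p + degree q < m + n" using assms by auto
  hence "coeff (p * q) (m + n) = 0" using degree_mult_le[of p q] by (intro coeff_eq_0) simp
  moreover have "coeff p m = 0 \<or> coeff q n = 0" using False assms by (metis coeff_eq_0 le_neq_implies_less)
  ultimately show ?thesis by auto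
qed

lemma pole_value_Infty:
  assumes "Q \<noteq> 0" "degree P \<le> degree Q"
  shows "\<not> pole_at (Fract P Q) Infty" 
    "value_at (Fract P Q) Infty = complex_of_real (coeff P (degree Q) / coeff Q (degree Q))"
proof -
  define r where "r = Fract P Q"
  define P' Q' where "P' = fst (quot_of_fract r)" "Q' = snd (quot_of_fract r)"
  have Q': "Fract P' Q' = Fract P Q" "Q' \<noteq> 0" by (simp_all add: P'_Q'_def r_def)
  hence eq: "P' * Q = P * Q'" using assms by (simp add: eq_fract)
  have deg: "degree P' \<le> degree Q'"
  proof (cases "P' = 0")
    case False
    with eq Q' assms have "P \<noteq> 0" by auto
    with eq False Q' assms have "degree P' + degree Q = degree P + degree Q'" by (metis degree_mult_eq)
    thus ?thesis using assms by simp
  qed simp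
  show "\<not> pole_at (Fract P Q) Infty" using deg by (simp add: numer_def denom_def P'_Q'_def r_def)
  have "coeff (P' * Q) (degree Q' + degree Q) = coeff P' (degree Q') * coeff Q (degree Q)"
    using deg by (intro coeff_mult_top) auto
  moreover have "coeff (P * Q') (degree Q' + degree Q) = coeff P (degree Q) * coeff Q' (degree Q')"
    using assms coeff_mult_top[of P "degree Q" Q' "degree Q'"] by (simp add: add.commute)
  ultimately have "coeff P' (degree Q') * coeff Q (degree Q) = coeff P (degree Q) * coeff Q' (degree Q')"
    using eq by simp
  hence "coeff P' (degree Q') / coeff Q' (degree Q') = coeff P (degree Q) / coeff Q (degree Q)"
    using Q' assms by (simp add: field_simps)
  thus "value_at (Fract P Q) Infty = complex_of_real (coeff P (degree Q) / coeff Q (degree Q))"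
    by (simp add: numer_def denom_def P'_Q'_def r_def flip: of_real_divide)
qed

declare pole_at.simps [simp del] value_at.simps [simp del]

text \<open>Properness is regularity at \<open>Infty\<close>, which is a point of
  \<open>C_plus\<close>; so the two clauses of the definition merge into one.\<close>

lemma H_ring_eq: "H_ring = {r. \<forall>s \<in> C_plus. \<not> pole_at r s}"
  proof -
  have "pole_at r Infty \<longleftrightarrow> \<not> proper r" for r by (auto simp: proper_def pole_at.simps)
  moreover have "Infty \<in> C_plus" by (simp add: C_plus_def C_minus_def)
  ultimately show ?thesis unfolding H_ring_def C_plus_def by blast
qed

lemma Infty_C_plus [simp]: "Infty \<in> C_plus"
  by (simp add: C_plus_def C_minus_def)

lemma Fin_C_plus [simp]: "Fin z \<in> C_plus \<longleftrightarrow> Re z \<ge> 0"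
  by (auto simp: C_plus_def C_minus_def)

lemma not_pole_FinE:
  assumes "\<not> pole_at r (Fin z)"
  obtains P Q where "r = Fract P Q" "ev z Q \<noteq> 0" "coprime P Q" "Q \<noteq> 0"
proof
  show "r = Fract (fst (quot_of_fract r)) (snd (quot_of_fract r))" by simp
  show "ev z (snd (quot_of_fract r)) \<noteq> 0" using assms by (simp add: pole_at.simps denom_def ev_def)
  show "coprime (fst (quot_of_fract r)) (snd (quot_of_fract r))" by (rule coprime_quot_of_fract)
qed simp

lemma not_pole_InftyE:
  assumes "\<not> pole_at r Infty"
  obtains P Q where "r = Fract P Q" "Q \<noteq> 0" "degree P \<le> degree Q"
proof
  show "r = Fract (fst (quot_of_fract r)) (snd (quot_of_fract r))" by simp
  show "degree (fst (quot_of_fract r)) \<le> degree (snd (quot_of_fract r))" 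
    using assms by (simp add: pole_at.simps denom_def numer_def)
qed simp

lemma regular_add_mult:
  assumes "\<not> pole_at a s" "\<not> pole_at b s"
  shows "\<not> pole_at (a + b) s \<and> value_at (a + b) s = value_at a s + value_at b s \<and>
         \<not> pole_at (a * b) s \<and> value_at (a * b) s = value_at a s * value_at b s"
proof (cases s)
  case (Fin z)
  from assms(1)[unfolded Fin] obtain P Q where a: "a = Fract P Q" "ev z Q \<noteq> 0" by (rule not_pole_FinE)
  from assms(2)[unfolded Fin] obtain P' Q' where b: "b = Fract P' Q'" "ev z Q' \<noteq> 0" by (rule not_pole_FinE)
  have nz: "ev z (Q * Q') \<noteq> 0" "Q \<noteq> 0" "Q' \<noteq> 0" using a b by (auto simp: hom_distribs)
  have s: "a + b = Fract (P * Q' + P' * Q) (Q * Q')" "a * b = Fract (P * P') (Q * Q')"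
    using nz by (simp_all add: a b add_fract)
  note va = pole_value_Fin[OF a(2), of P, folded a(1)] and vb = pole_value_Fin[OF b(2), of P', folded b(1)]
    and vm = pole_value_Fin[OF nz(1), of "P * P'", folded s] 
    and vp = pole_value_Fin[OF nz(1), of "P * Q' + P' * Q", folded s]
  show ?thesis unfolding Fin va(2) vb(2) vm(2) vp(2) using vm(1) vp(1) a(2) b(2)
    by (simp add: hom_distribs add_frac_eq mult.commute)
next
  case Infty
  from assms(1)[unfolded Infty] obtain P Q where a: "a = Fract P Q" "Q \<noteq> 0" "degree P \<le> degree Q" by (rule not_pole_InftyE)
  from assms(2)[unfolded Infty] obtain P' Q' where b: "b = Fract P' Q'" "Q' \<noteq> 0" "degree P' \<le> degree Q'" by (rule not_pole_InftyE)
  have nz: "Q * Q' \<noteq> 0" using a b by auto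
  have dQ: "degree (Q * Q') = degree Q + degree Q'" using a b by (simp add: degree_mult_eq)
  have s: "a + b = Fract (P * Q' + P' * Q) (Q * Q')" "a * b = Fract (P * P') (Q * Q')"
    using nz by (simp_all add: a b add_fract)
  have d1: "degree (P * Q' + P' * Q) \<le> degree (Q * Q')" unfolding dQ using a b
    by (intro degree_add_le order.trans[OF degree_mult_le]) auto
  have d2: "degree (P * P') \<le> degree (Q * Q')" unfolding dQ using a b
    by (intro order.trans[OF degree_mult_le]) auto
  have c: "coeff (P * Q') (degree Q + degree Q') = coeff P (degree Q) * coeff Q' (degree Q')"
     "coeff (P' * Q) (degree Q + degree Q') = coeff P' (degree Q') * coeff Q (degree Q)"
     "coeff (P * P') (degree Q + degree Q') = coeff P (degree Q) * coeff P' (degree Q')"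
     "coeff (Q * Q') (degree Q + degree Q') = coeff Q (degree Q) * coeff Q' (degree Q')"
    using a b coeff_mult_top[of P' "degree Q'" Q "degree Q"] coeff_mult_top[of P "degree Q" Q' "degree Q'"]
      coeff_mult_top[of P "degree Q" P' "degree Q'"] coeff_mult_top[of Q "degree Q" Q' "degree Q'"]
    by (simp_all add: add.commute)
  note va = pole_value_Infty[OF a(2,3), folded a(1)] and vb = pole_value_Infty[OF b(2,3), folded b(1)]
    and vm = pole_value_Infty[OF nz d2, folded s] and vp = pole_value_Infty[OF nz d1, folded s]
  show ?thesis unfolding Infty va(2) vb(2) vm(2) vp(2) dQ coeff_add c using vm(1) vp(1) a(2) b(2)
    by (simp add: add_frac_eq)
qed

lemma cpoly_const: "cpoly [:c:] = [:complex_of_real c:]"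
  by (rule poly_eqI) (simp add: coeff_pCons split: nat.split)

lemma const_regular:
  "\<not> pole_at (to_fract [:c:]) s" "value_at (to_fract [:c:]) s = complex_of_real c"
proof -
  have "numer (to_fract [:c:]) = [:complex_of_real c:]" "denom (to_fract [:c:]) = 1"
    unfolding numer_def denom_def quot_of_fract_to_fract by (simp_all only: fst_conv snd_conv cpoly_const cpoly.hom_one)
  thus "\<not> pole_at (to_fract [:c:]) s" "value_at (to_fract [:c:]) s = complex_of_real c"
    by (cases s; simp add: pole_at.simps value_at.simps)+
qed

lemma to_fract_1_poly: "to_fract [:1:] = 1"
  by (simp add: one_pCons[symmetric])

text \<open>As a type of class \<open>idom\<close> the ring has its own matrices, determinants and
  adjugates, and evaluation becomes a homomorphism that commutes with all of them.\<close>

typedef hfun = H_ring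
proof
  show "0 \<in> H_ring" using const_regular[of 0] by (simp add: H_ring_eq)
qed

setup_lifting type_definition_hfun

lemma H_ring_const [simp]: "to_fract [:c:] \<in> H_ring"
  by (simp add: H_ring_eq const_regular)

lemma H_ring_add [simp]: "a \<in> H_ring \<Longrightarrow> b \<in> H_ring \<Longrightarrow> a + b \<in> H_ring"
  and H_ring_mult [simp]: "a \<in> H_ring \<Longrightarrow> b \<in> H_ring \<Longrightarrow> a * b \<in> H_ring"
  using regular_add_mult by (auto simp: H_ring_eq)

lemma H_ring_01 [simp]: "0 \<in> H_ring" "1 \<in> H_ring"
  using H_ring_const[of 0] H_ring_const[of 1] by (simp_all add: to_fract_1_poly)

lemma H_ring_uminus [simp]: "a \<in> H_ring \<Longrightarrow> - a \<in> H_ring"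
proof -
  assume "a \<in> H_ring"
  hence "to_fract [:-1:] * a \<in> H_ring" by simp
  also have "to_fract [:-1:] = (- 1 :: ratfun)" 
    by (metis minus_pCons minus_zero one_pCons to_fract_1 to_fract_uminus)
  finally show ?thesis by simp
qed

lemma H_ring_minus [simp]: "a \<in> H_ring \<Longrightarrow> b \<in> H_ring \<Longrightarrow> a - b \<in> H_ring"
  using H_ring_add[of a "- b"] by simp

instantiation hfun :: idom
begin
lift_definition zero_hfun :: hfun is 0 by simp
lift_definition one_hfun :: hfun is 1 by simp
lift_definition plus_hfun :: "hfun \<Rightarrow> hfun \<Rightarrow> hfun" is "(+)" by simp
lift_definition minus_hfun :: "hfun \<Rightarrow> hfun \<Rightarrow> hfun" is "(-)" by simp
lift_definition uminus_hfun :: "hfun \<Rightarrow> hfun" is "uminus" by simp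
lift_definition times_hfun :: "hfun \<Rightarrow> hfun \<Rightarrow> hfun" is "(*)" by simp
instance by standard (transfer; simp add: algebra_simps)+
end

interpretation Rep: inj_idom_hom Rep_hfun
  by unfold_locales (transfer; simp)+

definition val :: "ext_complex \<Rightarrow> hfun \<Rightarrow> complex" where
  "val s h = value_at (Rep_hfun h) s"

lift_definition hconst :: "real \<Rightarrow> hfun" is "\<lambda>c. to_fract [:c:]" by simp

lemma val_hconst [simp]: "val s (hconst c) = complex_of_real c"
  unfolding val_def by transfer (simp add: const_regular)

lemma hconst_hom: "comm_ring_hom hconst"
  by unfold_locales (transfer; simp add: to_fract_1_poly flip: to_fract_add to_fract_mult)+

lemma Rep_regular: "s \<in> C_plus \<Longrightarrow> \<not> pole_at (Rep_hfun h) s"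
  using Rep_hfun[of h] by (simp add: H_ring_eq)

lemma val_hom:
  assumes s: "s \<in> C_plus"
  shows "comm_ring_hom (val s)"
proof
  have "hconst 0 = 0" by transfer simp
  thus "val s 0 = 0" using val_hconst[of s 0] by simp
  show "val s 1 = 1" using const_regular(2)[of 1 s]
    by (simp add: val_def one_hfun.rep_eq to_fract_1_poly)
  fix x y show "val s (x + y) = val s x + val s y" "val s (x * y) = val s x * val s y"
    using regular_add_mult[OF Rep_regular Rep_regular, OF s s] by (simp_all add: val_def plus_hfun.rep_eq times_hfun.rep_eq)
qed

section \<open>Divisibility and units in terms of values\<close>

lemma order_pos_iff: "p \<noteq> 0 \<Longrightarrow> Polynomial.order a p > 0 \<longleftrightarrow> poly p a = 0"
  using order_root[of p a] by auto

lemma Rep_FractE: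
  obtains P Q where "Rep_hfun h = Fract P Q" "Q \<noteq> 0" "coprime P Q" "degree P \<le> degree Q"
    "\<And>z. Re z \<ge> 0 \<Longrightarrow> ev z Q \<noteq> 0" "numer (Rep_hfun h) = cpoly P" "denom (Rep_hfun h) = cpoly Q"
proof
  let ?r = "Rep_hfun h" and ?P = "fst (quot_of_fract (Rep_hfun h))" and ?Q = "snd (quot_of_fract (Rep_hfun h))"
  show "?r = Fract ?P ?Q" "?Q \<noteq> 0" by simp_all
  show "coprime ?P ?Q" by (rule coprime_quot_of_fract)
  show "degree ?P \<le> degree ?Q" using Rep_regular[of Infty h] 
    by (simp add: pole_at.simps numer_def denom_def)
  show "ev z ?Q \<noteq> 0" if "Re z \<ge> 0" for z using Rep_regular[of "Fin z" h] that
    by (simp add: pole_at.simps denom_def ev_def)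
  show "numer ?r = cpoly ?P" "denom ?r = cpoly ?Q" by (simp_all add: numer_def denom_def)
qed

lemma degree_eq_if_val_Infty:
  assumes "val Infty d \<noteq> 0" "Rep_hfun d = Fract P Q" "Q \<noteq> 0" "degree P \<le> degree Q"
  shows "degree P = degree Q" "P \<noteq> 0"
proof -
  have "coeff P (degree Q) \<noteq> 0" using assms pole_value_Infty(2)[of Q P]
    by (simp add: val_def)
  thus "degree P = degree Q" "P \<noteq> 0" using assms(4) le_degree[of P "degree Q"] by auto
qed

lemma proper_iff: "proper r \<longleftrightarrow> \<not> pole_at r Infty"
  by (auto simp: proper_def pole_at.simps)

lemma proper_divide:
  assumes "val Infty d \<noteq> 0"
  shows "proper (Rep_hfun f / Rep_hfun d)"
proof -
  obtain Pf Qf where f: "Rep_hfun f = Fract Pf Qf" "Qf \<noteq> 0" "degree Pf \<le> degree Qf" using Rep_FractE[of f] by metis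
  obtain Pd Qd where d: "Rep_hfun d = Fract Pd Qd" "Qd \<noteq> 0" "degree Pd \<le> degree Qd" using Rep_FractE[of d] by metis
  note dd = degree_eq_if_val_Infty[OF assms d]
  have eq: "Rep_hfun f / Rep_hfun d = Fract (Pf * Qd) (Qf * Pd)" by (simp add: f d)
  have "degree (Pf * Qd) \<le> degree (Qf * Pd)"
    using dd f d degree_mult_le[of Pf Qd] by (simp add: degree_mult_eq)
  thus ?thesis unfolding proper_iff eq using f dd by (intro pole_value_Infty) auto
qed

text \<open>The quotient f / d can have poles in \<open>C_plus\<close> only at zeros of d. These are
  finite points and simple, and each is absorbed by a zero of f. At infinity d does not vanish, so
  the quotient is proper.\<close>

lemma hfun_dvd:
  assumes inf: "val Infty d \<noteq> 0"
    and zero: "\<And>s. s \<in> C_plus \<Longrightarrow> val s d = 0 \<Longrightarrow> val s f = 0 \<and> zero_order (Rep_hfun d) s = 1"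
  shows "d dvd f"
proof -
  obtain Pf Qf where f: "Rep_hfun f = Fract Pf Qf" "Qf \<noteq> 0" "degree Pf \<le> degree Qf"
    "\<And>z. Re z \<ge> 0 \<Longrightarrow> ev z Qf \<noteq> 0" using Rep_FractE[of f] by metis
  obtain Pd Qd where d: "Rep_hfun d = Fract Pd Qd" "Qd \<noteq> 0" "degree Pd \<le> degree Qd"
    "\<And>z. Re z \<ge> 0 \<Longrightarrow> ev z Qd \<noteq> 0" and nd: "numer (Rep_hfun d) = cpoly Pd" using Rep_FractE[of d] by metis
  note dd = degree_eq_if_val_Infty[OF inf d(1-3)]
  define r where "r = Rep_hfun f / Rep_hfun d"
  have r: "r = Fract (Pf * Qd) (Qf * Pd)" by (simp add: f d r_def)
  have "\<not> pole_at r s" if s: "s \<in> C_plus" for s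
  proof (cases s)
    case Infty
    thus ?thesis using proper_divide[OF inf, of f] by (simp add: r_def proper_iff)
  next
    case (Fin z)
    with s have z: "Re z \<ge> 0" by simp
    define P Q where "P = fst (quot_of_fract r)" and "Q = snd (quot_of_fract r)"
    have Q: "Q \<noteq> 0" "r = Fract P Q" "coprime P Q" unfolding P_def Q_def by (simp_all add: coprime_quot_of_fract)
    have eq: "P * (Qf * Pd) = Pf * Qd * Q" using r Q f dd by (simp add: eq_fract)
    show ?thesis
    proof
      assume "pole_at r s"
      hence Q0: "ev z Q = 0" by (simp add: Fin pole_at.simps denom_def ev_def Q_def)
      hence P0: "ev z P \<noteq> 0" using Q coprime_ev_nonzero by blast
      hence Pne: "P \<noteq> 0" by auto
      hence Pf: "Pf \<noteq> 0" using eq f dd by auto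
      have nz: "cpoly P \<noteq> 0" "cpoly Qf \<noteq> 0" "cpoly Pd \<noteq> 0" "cpoly Pf \<noteq> 0" "cpoly Qd \<noteq> 0" "cpoly Q \<noteq> 0"
        using Pne f dd Pf d Q by auto
      let ?o = "\<lambda>p. Polynomial.order z (cpoly p)"
      have "cpoly P * (cpoly Qf * cpoly Pd) = cpoly Pf * cpoly Qd * cpoly Q"
        using arg_cong[OF eq, of cpoly] by (simp add: cpoly.hom_mult)
      \<comment> \<open>At z none of P, Qf, Qd vanishes, so the order of Pd is the sum of the orders
        of Pf and Q. Both summands are positive, which a simple zero of Pd excludes.\<close>
      hence "?o P + (?o Qf + ?o Pd) = ?o Pf + ?o Qd + ?o Q"
        using nz by (metis order_mult mult_eq_0_iff)
      moreover have "?o P = 0" "?o Qf = 0" "?o Qd = 0" 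
        using P0 f(4)[OF z] d(4)[OF z] by (auto simp: ev_def order_0I)
      moreover have "?o Q > 0" using Q0 nz by (simp add: order_pos_iff ev_def)
      ultimately have *: "?o Pd = ?o Pf + ?o Q" "?o Q > 0" by auto
      hence "ev z Pd = 0" using nz order_pos_iff[of "cpoly Pd" z] by (simp add: ev_def)
      hence "val s d = 0" using d(1) pole_value_Fin(2)[of z Qd Pd] d(4)[OF z] by (simp add: val_def Fin)
      from zero[OF s this] have "val s f = 0" and o1: "?o Pd = 1" by (simp_all add: Fin nd)
      hence "ev z Pf = 0" using f(1) pole_value_Fin(2)[of z Qf Pf] f(4)[OF z] by (simp add: val_def Fin)
      hence "?o Pf > 0" using nz by (simp add: order_pos_iff ev_def)
      thus False using * o1 by simp
    qed
  qed
  hence "r \<in> H_ring" by (simp add: H_ring_eq)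
  then obtain h where h: "r = Rep_hfun h" by (metis Rep_hfun_cases)
  have "Rep_hfun d \<noteq> 0" using d dd by (simp add: eq_fract Zero_fract_def)
  hence "Rep_hfun f = Rep_hfun d * Rep_hfun h" unfolding h[symmetric] r_def by simp
  hence "f = d * h" by (metis Rep.hom_mult Rep_hfun_inject)
  thus ?thesis by simp
qed

text \<open>If h has no zero in \<open>C_plus\<close>, the hypothesis of \<open>hfun_dvd\<close> on
  zeros is vacuous, and it applies with f = 1.\<close>

lemma hfun_unit_iff: "h dvd 1 \<longleftrightarrow> (\<forall>s \<in> C_plus. val s h \<noteq> 0)"
proof
  assume "h dvd 1"
  then obtain g where g: "h * g = 1" by (auto elim: dvdE)
  show "\<forall>s \<in> C_plus. val s h \<noteq> 0"
  proof
    fix s assume s: "s \<in> C_plus"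
    interpret v: comm_ring_hom "val s" by (rule val_hom[OF s])
    from arg_cong[OF g, of "val s"] show "val s h \<noteq> 0" by (auto simp: v.hom_mult)
  qed
qed (auto intro: hfun_dvd)

lemma J_units_iff: "Rep_hfun h \<in> J_units \<longleftrightarrow> h dvd 1"
proof
  assume "Rep_hfun h \<in> J_units"
  then obtain v where "v \<in> H_ring" "Rep_hfun h * v = 1" by (auto simp: J_units_def)
  then obtain g where "Rep_hfun h * Rep_hfun g = 1" by (metis Rep_hfun_cases)
  hence "h * g = 1" by (metis Rep.hom_mult Rep.hom_one Rep_hfun_inject)
  thus "h dvd 1" by (metis dvd_triv_left)
next
  assume "h dvd 1"
  then obtain g where "h * g = 1" by (auto elim: dvdE)
  hence "Rep_hfun h * Rep_hfun g = 1" by (metis Rep.hom_mult Rep.hom_one)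
  thus "Rep_hfun h \<in> J_units" using Rep_hfun by (auto simp: J_units_def)
qed

section \<open>The coordinate z = 1/(s + 1)\<close>

lemma Re_nonneg_add_1: "Re z \<ge> 0 \<Longrightarrow> z + 1 \<noteq> 0" "Re z \<ge> 0 \<Longrightarrow> 1 + z \<noteq> 0"
  by (auto simp: complex_eq_iff)

lemma H_ring_FractI:
  assumes "Q \<noteq> 0" "degree P \<le> degree Q" "\<And>z. Re z \<ge> 0 \<Longrightarrow> ev z Q \<noteq> 0"
  shows "Fract P Q \<in> H_ring"
proof -
  have "\<not> pole_at (Fract P Q) s" if "s \<in> C_plus" for s
    using that assms by (cases s) (auto simp: pole_value_Infty(1) pole_value_Fin(1))
  thus ?thesis by (simp add: H_ring_eq)
qed

lift_definition hvar :: hfun is "Fract 1 [:1, 1:]"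
  by (rule H_ring_FractI) (auto simp: ev_pCons Re_nonneg_add_1)

fun zof :: "ext_complex \<Rightarrow> complex" where
  "zof (Fin z) = 1 / (z + 1)" 
| "zof Infty = 0"

lemma val_hvar: "s \<in> C_plus \<Longrightarrow> val s hvar = zof s"
  unfolding val_def hvar.rep_eq 
  by (cases s) (simp_all add: pole_value_Fin pole_value_Infty ev_pCons Re_nonneg_add_1 add.commute)

text \<open>Substitution of the coordinate \<open>hvar\<close> into a polynomial. Such elements are
  evaluated at \<open>zof s\<close> by one formula for all points of \<open>C_plus\<close>, so that
  infinity, which is z = 0, needs no separate treatment.\<close>

definition hpoly :: "real poly \<Rightarrow> hfun" where
  "hpoly p = poly (map_poly hconst p) hvar"

interpretation hpoly: comm_ring_hom hpoly
proof -
  interpret c: comm_ring_hom hconst by (rule hconst_hom)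
  interpret m: map_poly_comm_ring_hom hconst ..
  show "comm_ring_hom hpoly" 
    by unfold_locales (simp_all add: hpoly_def hom_distribs m.hom_add m.hom_mult)
qed

lemma hconst_0 [simp]: "hconst 0 = 0"
  by transfer simp

lemma hpoly_pCons: "hpoly (pCons c p) = hconst c + hvar * hpoly p"
  by (cases "c = 0 \<and> p = 0") (auto simp: hpoly_def map_poly_pCons)

lemma val_hpoly:
  assumes s: "s \<in> C_plus"
  shows "val s (hpoly p) = ev (zof s) p"
proof -
  interpret v: comm_ring_hom "val s" by (rule val_hom[OF s])
  show ?thesis
    by (induction p) (simp_all add: hpoly_pCons ev_pCons v.hom_add v.hom_mult val_hvar[OF s])
qed

text \<open>With y = 1/(s + 1) one has s y = 1 - y. Each factor s of a monomial uses up one factor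
  y, and the bound on the degree guarantees that enough of them are available.\<close>

lemma hpoly_numerator:
  assumes "degree P \<le> n"
  shows "\<exists>p. to_fract P * Rep_hfun hvar ^ n = Rep_hfun (hpoly p)"
  using assms
proof (induction P arbitrary: n)
  case 0
  thus ?case by (intro exI[of _ 0]) simp
next
  case (pCons c P)
  let ?y = "Rep_hfun hvar"
  have c: "to_fract [:c:] * ?y ^ n = Rep_hfun (hpoly ([:c:] * [:0, 1:] ^ n))"
  proof -
    have "hpoly [:0, 1:] = hvar" "hpoly [:c:] = hconst c"
      by (simp_all add: hpoly_pCons)
    thus ?thesis by (simp only: hpoly.hom_mult hpoly.hom_power Rep.hom_mult Rep.hom_power hconst.rep_eq)
  qed
  show ?case
  proof (cases "P = 0")
    case True
    thus ?thesis using c by auto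
  next
    case False
    with pCons.prems obtain k where n: "n = Suc k" "degree P \<le> k" by (cases n) auto
    from pCons.IH[OF n(2)] obtain p where p: "to_fract P * ?y ^ k = Rep_hfun (hpoly p)" by auto
    have "to_fract [:0, 1:] * ?y = 1 - ?y"
      by (simp add: hvar.rep_eq to_fract_def One_fract_def diff_fract eq_fract)
    also have "\<dots> = Rep_hfun (hpoly [:1, -1:])"
    proof -
      have "hpoly [:1, -1:] = 1 - hvar"
      proof -
        have "hconst 1 = 1" "hconst (-1) = - 1" using hconst_hom
          by (transfer; simp add: to_fract_1_poly; metis minus_pCons minus_zero one_pCons to_fract_1 to_fract_uminus)+
        thus ?thesis by (simp add: hpoly_pCons)
      qed
      thus ?thesis by (simp add: Rep.hom_minus)
    qed
    finally have X: "to_fract [:0, 1:] * ?y = Rep_hfun (hpoly [:1, -1:])" .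
    have "to_fract (pCons c P) = to_fract [:c:] + to_fract [:0, 1:] * to_fract P"
      by (simp flip: to_fract_add to_fract_mult)
    hence "to_fract (pCons c P) * ?y ^ n = to_fract [:c:] * ?y ^ n + (to_fract [:0, 1:] * ?y) * (to_fract P * ?y ^ k)"
      by (simp add: n algebra_simps)
    also have "\<dots> = Rep_hfun (hpoly ([:c:] * [:0, 1:] ^ n + [:1, -1:] * p))"
      unfolding c X p by (simp only: hpoly.hom_add hpoly.hom_mult Rep.hom_add Rep.hom_mult)
    finally show ?thesis by blast
  qed
qed

text \<open>Numerator and denominator of h = P / Q are both multiplied by y^n, where n is the degree
  of Q. The new denominator is Q / (s + 1)^n: at finite points of \<open>C_plus\<close> it is
  nonzero because Q is, and at infinity its value is the leading coefficient of Q.\<close>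

lemma hfun_rep:
  obtains p a where "h * hpoly a = hpoly p" "\<And>s. s \<in> C_plus \<Longrightarrow> ev (zof s) a \<noteq> 0"
proof -
  obtain P Q where h: "Rep_hfun h = Fract P Q" "Q \<noteq> 0" "degree P \<le> degree Q"
    "\<And>z. Re z \<ge> 0 \<Longrightarrow> ev z Q \<noteq> 0" using Rep_FractE[of h] by metis
  let ?y = "Rep_hfun hvar" and ?n = "degree Q"
  obtain p where p: "to_fract P * ?y ^ ?n = Rep_hfun (hpoly p)" using hpoly_numerator[OF h(3)] by auto
  obtain a where a: "to_fract Q * ?y ^ ?n = Rep_hfun (hpoly a)" using hpoly_numerator[OF order_refl] by auto
  show ?thesis
  proof
    have "Rep_hfun h * to_fract Q = to_fract P" using h by (simp add: Fract_conv_to_fract)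
    hence "Rep_hfun (h * hpoly a) = Rep_hfun (hpoly p)" by (simp flip: p a add: Rep.hom_mult mult.assoc[symmetric])
    thus "h * hpoly a = hpoly p" by (simp add: Rep_hfun_inject)
    fix s assume s: "s \<in> C_plus"
    have y: "?y ^ k = Fract 1 ([:1, 1:] ^ k)" for k
      by (induction k) (simp_all add: hvar.rep_eq One_fract_def)
    have "Rep_hfun (hpoly a) = Fract Q ([:1, 1:] ^ ?n)"
      by (simp add: a[symmetric] y to_fract_def)
    moreover have "value_at (Fract Q ([:1, 1:] ^ ?n)) s \<noteq> 0"
    proof (cases s)
      case (Fin z)
      with s have z: "Re z \<ge> 0" by simp
      have "ev z ([:1, 1:] ^ ?n) \<noteq> 0" using Re_nonneg_add_1[OF z] by (simp add: ev.hom_power ev_pCons)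
      thus ?thesis using h(4)[OF z] by (simp add: Fin pole_value_Fin)
    next
      case Infty
      have "degree ([:1, 1 :: real:] ^ ?n) = ?n" by (simp add: degree_power_eq)
      moreover have "lead_coeff ([:1, 1 :: real:] ^ ?n) \<noteq> 0" by (subst leading_coeff_0_iff) simp
      ultimately show ?thesis using h(2) pole_value_Infty(2)[of "[:1,1:] ^ ?n" Q] by (simp add: Infty)
    qed
    ultimately show "ev (zof s) a \<noteq> 0" using val_hpoly[OF s, of a] by (simp add: val_def)
  qed
qed

text \<open>The disc is the set where |z|^2 \<le> Re z. For nonzero z this says Re (1/z) \<ge> 1,
  that is Re s \<ge> 0 for s = 1/z - 1; the boundary point z = 0 comes from infinity.\<close>

lemma zof_image: "zof ` C_plus = cball (1/2) (1/2)"
proof -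
  have *: "z \<in> cball (1/2) (1/2) \<longleftrightarrow> (Re z)\<^sup>2 + (Im z)\<^sup>2 \<le> Re z" for z :: complex
  proof -
    have "z \<in> cball (1/2) (1/2) \<longleftrightarrow> (cmod (1/2 - z))\<^sup>2 \<le> (1/2)\<^sup>2"
      by (simp add: dist_norm power2_le_iff_abs_le abs_le_iff flip: abs_le_square_iff)
    also have "\<dots> \<longleftrightarrow> (Re z)\<^sup>2 + (Im z)\<^sup>2 \<le> Re z"
    proof -
      have "(cmod (1/2 - z))\<^sup>2 = (Re z)\<^sup>2 + (Im z)\<^sup>2 - Re z + (1/2)\<^sup>2"
        unfolding cmod_power2 by (simp add: power2_eq_square algebra_simps)
      thus ?thesis by linarith
    qed
    finally show ?thesis .
  qed
  show ?thesis
  proof (intro equalityI subsetI)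
    fix w assume "w \<in> zof ` C_plus"
    then obtain s where s: "s \<in> C_plus" "w = zof s" by auto
    show "w \<in> cball (1/2) (1/2)"
    proof (cases s)
      case (Fin z)
      with s have z: "Re z \<ge> 0" by simp
      define d where "d = (Re z + 1)\<^sup>2 + (Im z)\<^sup>2"
      have d: "d > 0" unfolding d_def using z by (intro add_pos_nonneg) auto
      have w: "Re w = (Re z + 1) / d" "Im w = - Im z / d"
        using s(2) by (simp_all add: Fin Re_divide Im_divide d_def)
      have "(Re w)\<^sup>2 + (Im w)\<^sup>2 = 1 / d" using d
        unfolding w power_divide add_divide_distrib[symmetric] power2_minus
        by (subst d_def[symmetric]) (simp add: power2_eq_square)
      also have "\<dots> \<le> Re w" unfolding w using z d by (simp add: divide_right_mono)
      finally show ?thesis using * by simp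
    qed (use s in simp)
  next
    fix w :: complex assume "w \<in> cball (1/2) (1/2)"
    hence w: "(Re w)\<^sup>2 + (Im w)\<^sup>2 \<le> Re w" using * by simp
    show "w \<in> zof ` C_plus"
    proof (cases "w = 0")
      case True
      thus ?thesis by (metis Infty_C_plus imageI zof.simps(2))
    next
      case False
      hence pos: "(Re w)\<^sup>2 + (Im w)\<^sup>2 > 0" by (simp add: complex_eq_iff sum_power2_gt_zero_iff)
      have "Re (1 / w - 1) \<ge> 0" using pos w by (simp add: Re_divide field_simps)
      moreover have "w = zof (Fin (1 / w - 1))" using False by simp
      ultimately show ?thesis by (metis Fin_C_plus imageI)
    qed
  qed
qed

subsection \<open>Diagonalizability and the discriminant\<close>

lemma diagonalizableE:
  assumes "diagonalizable A" "A \<in> carrier_mat n n"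
  obtains G H L where "G \<in> carrier_mat n n" "H \<in> carrier_mat n n" "L \<in> carrier_mat n n"
    "diagonal_mat L" "G * H = 1\<^sub>m n" "H * G = 1\<^sub>m n" "A = G * L * H"
proof -
  obtain B where B: "diagonal_mat B" "similar_mat A B" using assms by (auto simp: diagonalizable_def)
  from B(2) obtain P Q where "similar_mat_wit A B P Q" by (auto simp: similar_mat_def)
  from similar_mat_witD2[OF assms(2) this] B(1) that show ?thesis by blast
qed

lemma diagonalizableI:
  assumes "G \<in> carrier_mat n n" "H \<in> carrier_mat n n" "L \<in> carrier_mat n n"
    "diagonal_mat L" "G * H = 1\<^sub>m n" "H * G = 1\<^sub>m n"
  shows "diagonalizable (G * L * H)"
  unfolding diagonalizable_def
  by (rule exI[of _ L], rule conjI, fact, rule similar_matI[of _ _ G H n]) (use assms in auto)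

lemma conj_mult:
  assumes [simp]: "G \<in> carrier_mat n n" "H \<in> carrier_mat n n" "A \<in> carrier_mat n n" "B \<in> carrier_mat n n"
    and HG: "H * G = (1\<^sub>m n :: 'a :: comm_ring_1 mat)"
  shows "(G * A * H) * (G * B * H) = G * (A * B) * H"
proof -
  have "(G * A * H) * (G * B * H) = G * A * (H * G) * B * H"
    by (simp add: assoc_mult_mat[of _ n n _ n _ n] mult_carrier_mat[of _ n n _ n])
  also have "\<dots> = G * (A * B) * H" unfolding HG
    by (simp add: left_mult_one_mat[of _ n n] assoc_mult_mat[of _ n n _ n _ n] mult_carrier_mat[of _ n n _ n])
  finally show ?thesis .
qed

lemma conj_add:
  assumes [simp]: "G \<in> carrier_mat n n" "H \<in> carrier_mat n n" "A \<in> carrier_mat n n" "B \<in> carrier_mat n n"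
  shows "G * (A + B) * H = G * A * H + G * (B :: 'a :: comm_ring_1 mat) * H"
  by (simp add: mult_add_distrib_mat[of _ n n _ n] add_mult_distrib_mat[of _ n n _ _ n] mult_carrier_mat[of _ n n _ n])

lemma conj_smult:
  assumes [simp]: "G \<in> carrier_mat n n" "H \<in> carrier_mat n n" "A \<in> carrier_mat n n"
  shows "G * (c \<cdot>\<^sub>m A) * H = c \<cdot>\<^sub>m (G * A * (H :: 'a :: comm_ring_1 mat))"
  by (simp add: mult_smult_distrib[of _ n n _ n] mult_smult_assoc_mat[of _ n n _ n] mult_carrier_mat[of _ n n _ n])

lemma conj_inv:
  assumes [simp]: "G \<in> carrier_mat n n" "H \<in> carrier_mat n n" "A \<in> carrier_mat n n"
    and GH: "G * H = (1\<^sub>m n :: 'a :: comm_ring_1 mat)"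
  shows "G * (H * A * G) * H = A"
proof -
  have "G * (H * A * G) * H = (G * H) * A * (G * H)"
    by (simp add: assoc_mult_mat[of _ n n _ n _ n] mult_carrier_mat[of _ n n _ n])
  thus ?thesis by (simp add: GH left_mult_one_mat[of _ n n] right_mult_one_mat[of _ n n])
qed

text \<open>The (i, j) entry of B L = L B is B_ij (L_jj - L_ii) = 0.\<close>

lemma diagonal_mat_if_commutes:
  fixes B L :: "'a :: idom mat"
  assumes B: "B \<in> carrier_mat n n" and L: "L \<in> carrier_mat n n" "diagonal_mat L"
    and dist: "\<And>i j. i < n \<Longrightarrow> j < n \<Longrightarrow> i \<noteq> j \<Longrightarrow> L $$ (i, i) \<noteq> L $$ (j, j)"
    and comm: "B * L = L * B"
  shows "diagonal_mat B"
  unfolding diagonal_mat_def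
proof (intro allI impI)
  fix i j assume ij: "i < dim_row B" "j < dim_col B" "i \<noteq> j"
  with B have ij': "i < n" "j < n" by auto
  have "(B * L) $$ (i, j) = (\<Sum>k = 0..<n. B $$ (i, k) * L $$ (k, j))"
    using B L ij' by (simp add: scalar_prod_def)
  also have "\<dots> = (\<Sum>k = 0..<n. if k = j then B $$ (i, j) * L $$ (j, j) else 0)"
    using L ij' by (intro sum.cong) (auto simp: diagonal_mat_def)
  finally have 1: "(B * L) $$ (i, j) = B $$ (i, j) * L $$ (j, j)" using ij' by simp
  have "(L * B) $$ (i, j) = (\<Sum>k = 0..<n. L $$ (i, k) * B $$ (k, j))"
    using B L ij' by (simp add: scalar_prod_def)
  also have "\<dots> = (\<Sum>k = 0..<n. if k = i then L $$ (i, i) * B $$ (i, j) else 0)"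
    using L ij' by (intro sum.cong) (auto simp: diagonal_mat_def)
  finally have "(L * B) $$ (i, j) = L $$ (i, i) * B $$ (i, j)" using ij' by simp
  with 1 comm have "B $$ (i, j) * (L $$ (i, i) - L $$ (j, j)) = 0" by (simp add: algebra_simps)
  thus "B $$ (i, j) = 0" using dist[OF ij' ij(3)] by simp
qed

text \<open>In characteristic 0 and positive dimension this is, up to sign, the discriminant of the
  characteristic polynomial. Over the complex numbers it is nonzero exactly when the eigenvalues are
  distinct, and it is polynomial in the entries.\<close>

definition disc :: "'a :: idom mat \<Rightarrow> 'a" where
  "disc A = resultant (char_poly A) (pderiv (char_poly A))"

lemma degree_pderiv_monic:
  fixes p :: "'a :: idom poly"
  assumes "coeff p n = 1" "degree p = n" "n > 0" "of_nat n \<noteq> (0::'a)"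
  shows "degree (pderiv p) = n - 1"
proof (rule antisym)
  show "degree (pderiv p) \<le> n - 1" using assms degree_pderiv_le[of p] by simp
  have "coeff (pderiv p) (n - 1) = of_nat n" using assms by (simp add: coeff_pderiv del: of_nat_Suc)
  thus "n - 1 \<le> degree (pderiv p)" using assms by (intro le_degree) simp
qed

text \<open>A resultant commutes with a homomorphism as long as no degree drops. The characteristic
  polynomial is monic, and its derivative has leading coefficient n, which is nonzero in both
  rings.\<close>

lemma disc_hom:
  fixes h :: "'a :: {idom, ring_char_0} \<Rightarrow> 'b :: {idom, ring_char_0}"
  assumes h: "comm_ring_hom h" and A: "A \<in> carrier_mat n n" and n: "n > 0"
  shows "disc (map_mat h A) = h (disc A)"
proof -
  interpret comm_ring_hom h by (rule h)
  interpret idom_hom h ..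
  let ?p = "char_poly A" and ?q = "char_poly (map_mat h A)"
  have q: "?q = map_poly h ?p" by (rule char_poly_hom[OF A])
  have A': "map_mat h A \<in> carrier_mat n n" using A by simp
  note dp = degree_monic_char_poly[OF A] and dq = degree_monic_char_poly[OF A']
  have d: "pderiv ?q = map_poly h (pderiv ?p)" unfolding q by (rule poly_eqI) (simp add: coeff_pderiv hom_distribs)
  show ?thesis unfolding disc_def d unfolding q
  proof (rule resultant_map_poly)
    show "degree (map_poly h ?p) = degree ?p" using dp dq q by simp
    show "degree (map_poly h (pderiv ?p)) = degree (pderiv ?p)" unfolding d[symmetric]
      using dp dq n by (simp add: degree_pderiv_monic[of _ n])
  qed
qed

lemma disc_similar: "similar_mat A B \<Longrightarrow> disc A = disc B"
  unfolding disc_def using char_poly_similar by metis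

lemma resultant_0_iff_common_root:
  fixes p q :: "complex poly"
  assumes "p \<noteq> 0"
  shows "resultant p q = 0 \<longleftrightarrow> (\<exists>x. poly p x = 0 \<and> poly q x = 0)"
proof -
  have g: "gcd p q \<noteq> 0" using assms by simp
  have "resultant p q = 0 \<longleftrightarrow> degree (gcd p q) \<noteq> 0" by (rule resultant_0_gcd)
  also have "\<dots> \<longleftrightarrow> (\<exists>x. poly (gcd p q) x = 0)"
  proof
    assume "degree (gcd p q) \<noteq> 0"
    hence "\<not> constant (poly (gcd p q))" by (simp add: constant_degree)
    thus "\<exists>x. poly (gcd p q) x = 0" by (rule fundamental_theorem_of_algebra)
  next
    assume "\<exists>x. poly (gcd p q) x = 0"
    then obtain x where x: "poly (gcd p q) x = 0" by auto
    show "degree (gcd p q) \<noteq> 0"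
    proof
      assume "degree (gcd p q) = 0"
      then obtain c where "gcd p q = [:c:]" by (rule degree_eq_zeroE)
      with x g show False by simp
    qed
  qed
  also have "\<dots> \<longleftrightarrow> (\<exists>x. poly p x = 0 \<and> poly q x = 0)"
    by (simp add: poly_eq_0_iff_dvd)
  finally show ?thesis .
qed

lemma char_poly_diagonal:
  fixes L :: "'a :: idom mat"
  assumes L: "L \<in> carrier_mat n n" "diagonal_mat L"
  shows "char_poly L = (\<Prod>i<n. [:- (L $$ (i, i)), 1:])"
proof -
  have "upper_triangular L" using L by (auto simp: diagonal_mat_def)
  from char_poly_upper_triangular[OF L(1) this]
  have "char_poly L = (\<Prod>a\<leftarrow>diag_mat L. [:- a, 1:])" .
  also have "\<dots> = prod_list (map (\<lambda>i. [:- (L $$ (i, i)), 1:]) [0..<n])"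
    using L(1) by (simp add: diag_mat_def comp_def)
  also have "\<dots> = (\<Prod>i\<in>set [0..<n]. [:- (L $$ (i, i)), 1:])"
    by (rule prod.distinct_set_conv_list[symmetric]) simp
  finally show ?thesis by (simp add: atLeast0LessThan)
qed

text \<open>Write the characteristic polynomial as (x - L_ii) r; at L_ii its derivative takes the
  value of r.\<close>

lemma pderiv_char_poly_diagonal:
  fixes L :: "'a :: idom mat"
  assumes L: "L \<in> carrier_mat n n" "diagonal_mat L" and i: "i < n"
  shows "poly (pderiv (char_poly L)) (L $$ (i, i)) = (\<Prod>j\<in>{..<n}-{i}. L $$ (i, i) - L $$ (j, j))"
proof -
  define x where "x = L $$ (i, i)"
  define r where "r = (\<Prod>j\<in>{..<n}-{i}. [:- (L $$ (j, j)), 1:])"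
  have "char_poly L = [:- x, 1:] * r" unfolding char_poly_diagonal[OF L] r_def x_def using i by (subst prod.remove[of _ i]) auto
  hence "poly (pderiv (char_poly L)) x = poly r x" by (simp add: pderiv_mult pderiv_pCons del: mult_pCons_left)
  also have "\<dots> = (\<Prod>j\<in>{..<n}-{i}. x - L $$ (j, j))" by (simp add: r_def poly_prod)
  finally show ?thesis by (simp add: x_def)
qed

lemma disc_0_iff:
  fixes A :: "complex mat"
  assumes A: "A \<in> carrier_mat n n"
  shows "disc A = 0 \<longleftrightarrow> (\<exists>x. poly (char_poly A) x = 0 \<and> poly (pderiv (char_poly A)) x = 0)"
  unfolding disc_def using degree_monic_char_poly[OF A] by (intro resultant_0_iff_common_root) auto

lemma disc_diagonal:
  fixes L :: "complex mat"
  assumes L: "L \<in> carrier_mat n n" "diagonal_mat L"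
  shows "disc L \<noteq> 0 \<longleftrightarrow> (\<forall>i<n. \<forall>j<n. i \<noteq> j \<longrightarrow> L $$ (i, i) \<noteq> L $$ (j, j))"
proof -
  have "disc L = 0 \<longleftrightarrow> (\<exists>i<n. poly (pderiv (char_poly L)) (L $$ (i, i)) = 0)"
    unfolding disc_0_iff[OF L(1)] by (subst (1) char_poly_diagonal[OF L]) (auto simp: poly_prod)
  also have "\<dots> \<longleftrightarrow> (\<exists>i<n. \<exists>j<n. i \<noteq> j \<and> L $$ (i, i) = L $$ (j, j))"
    by (intro ex_cong1 conj_cong refl) (auto simp: pderiv_char_poly_diagonal[OF L])
  finally show ?thesis by auto
qed

lemma diagonal_jordan_matrix:
  assumes "\<And>k a. (k, a) \<in> set n_as \<Longrightarrow> k = 1"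
  shows "diagonal_mat (jordan_matrix n_as)"
  using assms
proof (induction n_as)
  case Nil
  thus ?case by (simp add: jordan_matrix_def diagonal_mat_def)
next
  case (Cons na n_as)
  obtain a where na: "na = (1, a)" using Cons.prems by (cases na) auto
  have IH: "diagonal_mat (jordan_matrix n_as)" using Cons by (meson list.set_intros(2))
  let ?k = "sum_list (map fst n_as)"
  have "jordan_matrix (na # n_as) = four_block_mat (jordan_block 1 a) (0\<^sub>m 1 ?k) (0\<^sub>m ?k 1) (jordan_matrix n_as)"
    unfolding na by (simp add: jordan_matrix_def Let_def jordan_matrix_dim[unfolded jordan_matrix_def])
  thus ?case using IH by (auto simp: diagonal_mat_def four_block_mat_def Let_def)
qed

text \<open>A Jordan block of size at least 2 for a would make (x - a)^2 divide the characteristic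
  polynomial, giving it a common root with its derivative. So the Jordan form is diagonal, and as
  similarity preserves \<open>disc\<close>, its diagonal entries are distinct.\<close>

lemma disc_nonzero_diagonalizable:
  fixes A :: "complex mat"
  assumes A: "A \<in> carrier_mat n n" and disc: "disc A \<noteq> 0"
  obtains G H L where "G \<in> carrier_mat n n" "H \<in> carrier_mat n n" "L \<in> carrier_mat n n"
    "diagonal_mat L" "G * H = 1\<^sub>m n" "H * G = 1\<^sub>m n" "A = G * L * H"
    "\<And>i j. i < n \<Longrightarrow> j < n \<Longrightarrow> i \<noteq> j \<Longrightarrow> L $$ (i, i) \<noteq> L $$ (j, j)"
proof -
  let ?p = "char_poly A"
  from char_poly_factorized[OF A] obtain as where as: "?p = (\<Prod>a\<leftarrow>as. [:- a, 1:])" by auto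
  from jordan_nf_exists[OF A as] obtain n_as where jnf: "jordan_nf A n_as" ..
  have "k = 1" if ka: "(k, a) \<in> set n_as" for k a
  proof (rule ccontr)
    assume "k \<noteq> 1"
    moreover have "k \<noteq> 0" using jnf ka by (force simp: jordan_nf_def)
    ultimately have "2 \<le> Polynomial.order a ?p" using jordan_nf_block_size_order_bound[OF jnf ka] by simp
    hence "[:-a, 1:] ^ 2 dvd ?p" by (rule le_imp_power_dvd[THEN dvd_trans, OF _ order_1])
    then obtain r where "?p = [:-a, 1:] * ([:-a, 1:] * r)" unfolding dvd_def power2_eq_square mult.assoc by blast
    hence "poly ?p a = 0" "poly (pderiv ?p) a = 0" by (simp_all add: pderiv_mult del: mult_pCons_left)
    thus False using disc disc_0_iff[OF A] by blast
  qed
  hence diag: "diagonal_mat (jordan_matrix n_as)" by (rule diagonal_jordan_matrix) auto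
  have sim: "similar_mat A (jordan_matrix n_as)" using jnf by (simp add: jordan_nf_def)
  then obtain P Q where "similar_mat_wit A (jordan_matrix n_as) P Q" by (auto simp: similar_mat_def)
  note w = similar_mat_witD2[OF A this]
  have "disc (jordan_matrix n_as) \<noteq> 0" using disc disc_similar[OF sim] by simp
  with disc_diagonal[OF w(5) diag] show ?thesis by (intro that[OF w(6,7,5) diag w(1,2,3)]) auto
qed

subsection \<open>A rational parametrisation of the commutant\<close>

text \<open>A linear map on n by n matrices given by structure constants: \<open>g p q i j\<close>
  is the (i, j) entry of the image of the matrix unit at (p, q). An array of coefficients, unlike a
  function on matrices, can be scaled and mapped along ring homomorphisms.\<close>

definition lift_entries :: "nat \<Rightarrow> (nat \<Rightarrow> nat \<Rightarrow> nat \<Rightarrow> nat \<Rightarrow> 'a) \<Rightarrow> 'a mat \<Rightarrow> 'a :: comm_ring_1 mat" where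
  "lift_entries n g U = mat n n (\<lambda>(i, j). \<Sum>p<n. \<Sum>q<n. U $$ (p, q) * g p q i j)"

lemma lift_entries_carrier [simp]: "lift_entries n g U \<in> carrier_mat n n"
  by (simp add: lift_entries_def)

lemma sum_fun_apply: "sum f S x = (\<Sum>i\<in>S. f i x)"
  by (induction S rule: infinite_finite_induct) auto

text \<open>Every linear map f over a field has a linear g with f g f = f. Here f is V \<mapsto> A V
  - V A, and g is recorded by its values on the matrix units. Matrices are encoded as functions on
  index pairs so as to form a vector space on a whole type.\<close>

lemma commutator_generalized_inverse:
  fixes A :: "'a :: field mat"
  assumes A: "A \<in> carrier_mat n n"
  shows "\<exists>g. \<forall>V \<in> carrier_mat n n.
    A * lift_entries n g (A * V - V * A) - lift_entries n g (A * V - V * A) * A = A * V - V * A"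
proof -
  define sc where "sc = (\<lambda>(c::'a) (v :: nat \<times> nat \<Rightarrow> 'a) x. c * v x)"
  interpret V: vector_space sc
    by unfold_locales (auto simp: sc_def fun_eq_iff algebra_simps)
  interpret VV: vector_space_pair sc sc ..
  define M where "M = (\<lambda>v :: nat \<times> nat \<Rightarrow> 'a. mat n n v)"
  \<comment> \<open>Setting f v to 0 outside the square makes it a finite combination of the unit
    functions \<open>e p q\<close>, so that g is determined on it by finitely many values.\<close>
  define f where "f = (\<lambda>v (i, j). if i < n \<and> j < n then (\<Sum>k<n. A $$ (i, k) * v (k, j)) - (\<Sum>k<n. v (i, k) * A $$ (k, j)) else 0)"
  have Mf: "M (f v) = A * M v - M v * A" for v
    using A by (intro eq_matI) (auto simp: M_def f_def scalar_prod_def atLeast0LessThan)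
  have lin: "Vector_Spaces.linear sc sc f"
    by unfold_locales (auto simp: f_def sc_def fun_eq_iff algebra_simps sum.distrib sum_distrib_left)
  obtain g where g: "Vector_Spaces.linear sc sc g" "\<And>v. f (g (f v)) = f v"
    using VV.linear_exists_right_inverse_on[OF lin V.subspace_UNIV] by auto
  interpret g: Vector_Spaces.linear sc sc g by (rule g(1))
  define e where "e = (\<lambda>p q. \<lambda>x :: nat \<times> nat. if x = (p, q) then 1 else (0::'a))"
  define g' where "g' = (\<lambda>p q i j. g (e p q) (i, j))"
  have gsum: "M (g v) = lift_entries n g' (M v)" if v: "\<And>i j. \<not> (i < n \<and> j < n) \<Longrightarrow> v (i, j) = 0" for v
  proof -
    have "v = (\<Sum>p<n. \<Sum>q<n. sc (v (p, q)) (e p q))"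
    proof
      fix x :: "nat \<times> nat" obtain i j where x: "x = (i, j)" by force
      have "(\<Sum>p<n. \<Sum>q<n. sc (v (p, q)) (e p q)) x = (\<Sum>p<n. \<Sum>q<n. if p = i then if q = j then v (i, j) else 0 else 0)"
        by (simp add: sum_fun_apply x sc_def e_def if_distrib cong: if_cong) (intro sum.cong refl; auto)
      also have "\<dots> = (\<Sum>p<n. if p = i then if j < n then v (i, j) else 0 else 0)"
        by (intro sum.cong refl) simp
      also have "\<dots> = v x" using v[of i j] x by simp
      finally show "v x = (\<Sum>p<n. \<Sum>q<n. sc (v (p, q)) (e p q)) x" by simp
    qed
    from arg_cong[OF this, of g] have "g v = g (\<Sum>p<n. \<Sum>q<n. sc (v (p, q)) (e p q))" .
    also have "\<dots> = (\<Sum>p<n. \<Sum>q<n. sc (v (p, q)) (g (e p q)))"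
      unfolding g.sum g.scale ..
    finally have gv: "g v = (\<Sum>p<n. \<Sum>q<n. sc (v (p, q)) (g (e p q)))" .
    show ?thesis unfolding gv unfolding lift_entries_def M_def g'_def
      by (intro eq_matI) (auto simp: sum_fun_apply sc_def)
  qed
  show ?thesis
  proof (intro exI[of _ g'] ballI)
    fix V :: "'a mat" assume V: "V \<in> carrier_mat n n"
    define v where "v = (\<lambda>x. V $$ x)"
    have Mv: "M v = V" using V by (auto simp: M_def v_def)
    have "M (g (f v)) = lift_entries n g' (M (f v))" by (rule gsum) (auto simp: f_def)
    hence *: "lift_entries n g' (A * V - V * A) = M (g (f v))" using Mf[of v] Mv by simp
    show "A * lift_entries n g' (A * V - V * A) - lift_entries n g' (A * V - V * A) * A = A * V - V * A"
      unfolding * Mf[symmetric] g(2) by (simp add: Mf Mv)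
  qed
qed

lemma clear_denominators:
  fixes S :: "'a :: idom fract set"
  assumes "finite S"
  shows "\<exists>c. c \<noteq> 0 \<and> (\<forall>x\<in>S. \<exists>p. to_fract c * x = to_fract p)"
  using assms
proof (induction S)
  case empty
  show ?case by (intro exI[of _ 1]) simp
next
  case (insert x S)
  then obtain c where c: "c \<noteq> 0" "\<forall>x\<in>S. \<exists>p. to_fract c * x = to_fract p" by auto
  obtain a b where x: "x = Fract a b" "b \<noteq> 0" by (cases x) auto
  have "to_fract (c * b) * x = to_fract (c * a)" using x by (simp add: Fract_conv_to_fract)
  hence "\<exists>p. to_fract (c * b) * x = to_fract p" by blast
  moreover have "\<exists>p. to_fract (c * b) * y = to_fract p" if "y \<in> S" for y
  proof -
    from c(2) that obtain p where "to_fract c * y = to_fract p" by auto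
    hence "to_fract (c * b) * y = to_fract (b * p)" by (simp add: algebra_simps)
    thus ?thesis by blast
  qed
  moreover have "c * b \<noteq> 0" using c x by simp
  ultimately show ?case by blast
qed

text \<open>If \<open>g\<close> is \<open>c\<close> times a generalized inverse of \<open>V \<mapsto> A * V - V * A\<close>, this is \<open>c\<close> times a projection
  onto the commutant of \<open>A\<close>; the factor \<open>c\<close> keeps the entries polynomial.\<close>

definition commutant_proj :: "nat \<Rightarrow> 'a \<Rightarrow> (nat \<Rightarrow> nat \<Rightarrow> nat \<Rightarrow> nat \<Rightarrow> 'a) \<Rightarrow> 'a mat \<Rightarrow> 'a mat \<Rightarrow> 'a :: comm_ring_1 mat" where
  "commutant_proj n c g A V = c \<cdot>\<^sub>m V - lift_entries n g (A * V - V * A)"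

lemma commutant_proj_carrier [simp]: "commutant_proj n c g A V \<in> carrier_mat n n"
  unfolding commutant_proj_def by (rule minus_carrier_mat) simp

text \<open>For a commuting V the correction term vanishes. Hence every matrix E commuting with A is
  attained, from E / c, whenever c is invertible.\<close>

lemma commutant_proj_commuting:
  assumes "A \<in> carrier_mat n n" "V \<in> carrier_mat n n" "A * V = V * A"
  shows "commutant_proj n c g A V = c \<cdot>\<^sub>m V"
  using assms by (intro eq_matI) (auto simp: commutant_proj_def lift_entries_def)

lemma commutant_proj_hom:
  assumes h: "comm_ring_hom h" and A: "A \<in> carrier_mat n n" and V: "V \<in> carrier_mat n n"
  shows "map_mat h (commutant_proj n c g A V) =
    commutant_proj n (h c) (\<lambda>p q i j. h (g p q i j)) (map_mat h A) (map_mat h V)"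
proof -
  interpret comm_ring_hom h by (rule h)
  have "map_mat h A * map_mat h V - map_mat h V * map_mat h A = map_mat h (A * V - V * A)"
    using A V by (simp add: mat_hom_mult[OF A V, symmetric] mat_hom_mult[OF V A, symmetric])
      (intro eq_matI; simp add: hom_distribs)
  thus ?thesis using A V unfolding commutant_proj_def
    by (intro eq_matI) (auto simp: lift_entries_def hom_distribs)
qed

lemma minus_mat_swap:
  fixes W X Y Z :: "'a :: ab_group_add mat"
  assumes "W \<in> carrier_mat n n" "X \<in> carrier_mat n n" "Y \<in> carrier_mat n n" "Z \<in> carrier_mat n n"
    and eq: "W - X = Y - Z"
  shows "Y - W = Z - X"
proof (rule eq_matI)
  fix i j assume "i < dim_row (Z - X)" "j < dim_col (Z - X)"
  hence "i < n" "j < n" using assms by auto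
  with arg_cong[OF eq, of "\<lambda>M. M $$ (i, j)"] assms(1-4) show "(Y - W) $$ (i, j) = (Z - X) $$ (i, j)"
    by (simp add: algebra_simps)
qed (use assms in auto)

text \<open>Over the fraction field the generalized inverse gives W with A W - W A = A V - V A, so V
  - W commutes with A. Multiplication by a common denominator c of the structure constants brings it
  back into the ring.\<close>

lemma commutant_proj_exists:
  fixes A :: "'a :: idom mat"
  assumes A: "A \<in> carrier_mat n n"
  obtains c g where "c \<noteq> 0"
    "\<And>V :: 'a mat. V \<in> carrier_mat n n \<Longrightarrow> A * commutant_proj n c g A V = commutant_proj n c g A V * A"
proof -
  let ?h = "to_fract :: 'a \<Rightarrow> 'a fract"
  interpret h: inj_comm_ring_hom ?h by unfold_locales auto
  have hom: "comm_ring_hom ?h" by unfold_locales auto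
  let ?A = "map_mat ?h A"
  have A': "?A \<in> carrier_mat n n" using A by simp
  from commutator_generalized_inverse[OF A'] obtain g where g: "\<And>V. V \<in> carrier_mat n n \<Longrightarrow>
    ?A * lift_entries n g (?A * V - V * ?A) - lift_entries n g (?A * V - V * ?A) * ?A = ?A * V - V * ?A"
    by auto
  let ?S = "(\<lambda>(p, q, i, j). g p q i j) ` ({..<n} \<times> {..<n} \<times> {..<n} \<times> {..<n})"
  obtain c where c: "c \<noteq> 0" "\<forall>x\<in>?S. \<exists>p. ?h c * x = ?h p" using clear_denominators[of ?S] by auto
  have "\<exists>r. \<forall>p<n. \<forall>q<n. \<forall>i<n. \<forall>j<n. ?h c * g p q i j = ?h (r p q i j)"
  proof -
    have "\<exists>r. p < n \<and> q < n \<and> i < n \<and> j < n \<longrightarrow> ?h c * g p q i j = ?h r" for p q i j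
      using c(2) by force
    thus ?thesis by metis
  qed
  then obtain r where r: "\<And>p q i j. p < n \<Longrightarrow> q < n \<Longrightarrow> i < n \<Longrightarrow> j < n \<Longrightarrow> ?h c * g p q i j = ?h (r p q i j)"
    by metis
  show ?thesis
  proof
    show "c \<noteq> 0" by fact
    fix V :: "'a mat" assume V: "V \<in> carrier_mat n n"
    let ?V = "map_mat ?h V"
    let ?Y = "commutant_proj n c r A V"
    have V': "?V \<in> carrier_mat n n" using V by simp
    define U where "U = ?A * ?V - ?V * ?A"
    have U: "U \<in> carrier_mat n n" unfolding U_def by (rule minus_carrier_mat, rule mult_carrier_mat[OF V' A'])
    define W where "W = lift_entries n g U"
    have W: "W \<in> carrier_mat n n" by (simp add: W_def)
    have gW: "?A * W - W * ?A = U" using g[OF V'] by (simp add: W_def U_def)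
    have Y: "map_mat ?h ?Y = ?h c \<cdot>\<^sub>m (?V - W)"
      unfolding commutant_proj_hom[OF hom A V]
      unfolding commutant_proj_def U_def[symmetric] W_def lift_entries_def
      using U V' by (intro eq_matI) (auto simp: r[symmetric] sum_distrib_left algebra_simps)
    have "?A * map_mat ?h ?Y = ?h c \<cdot>\<^sub>m (?A * ?V - ?A * W)"
      unfolding Y using A' V' W minus_carrier_mat[OF W, of ?V] by (simp add: mult_smult_distrib[of _ n n _ n] mult_minus_distrib_mat[of _ n n _ n])
    moreover have "map_mat ?h ?Y * ?A = ?h c \<cdot>\<^sub>m (?V * ?A - W * ?A)"
      unfolding Y using A' V' W minus_carrier_mat[OF W, of ?V] by (simp add: mult_smult_assoc_mat[of _ n n _ n] minus_mult_distrib_mat[of _ n n _ _ n])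
    moreover have "?A * ?V - ?A * W = ?V * ?A - W * ?A"
      by (rule minus_mat_swap[OF _ _ _ _ gW[unfolded U_def]]) (use A' V' W in \<open>auto intro: mult_carrier_mat\<close>)
    ultimately have "?A * map_mat ?h ?Y = map_mat ?h ?Y * ?A" by simp
    hence "map_mat ?h (A * ?Y) = map_mat ?h (?Y * A)"
      using A by (simp add: to_fract_hom.mat_hom_mult[of _ n n _ n])
    thus "A * ?Y = ?Y * A" by (rule to_fract_hom.mat_hom_inj)
  qed
qed

subsection \<open>Regular matrix pencils\<close>

lemma adj_mat_hom:
  assumes h: "comm_ring_hom h" and A: "A \<in> carrier_mat n n"
  shows "map_mat h (adj_mat A) = adj_mat (map_mat h A)"
proof -
  interpret comm_ring_hom h by (rule h)
  have "map_mat h (mat_delete A i j) = mat_delete (map_mat h A) i j" if "i < n" "j < n" for i j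
    using A that by (intro eq_matI) (auto simp: mat_delete_def)
  hence "cofactor (map_mat h A) i j = h (cofactor A i j)" if "i < n" "j < n" for i j
    using that by (simp add: cofactor_def hom_distribs flip: hom_det)
  thus ?thesis using A by (intro eq_matI) (auto simp: adj_mat_def)
qed

lemma comm_ring_hom_poly: "comm_ring_hom (\<lambda>p :: 'a :: comm_ring_1 poly. poly p t)"
  by unfold_locales auto

text \<open>For invertible a and T this is (a det T)^n times the determinant of B + T (E / a) T^-1
  D, where n is the dimension. The form without inverses is polynomial in all arguments, which makes
  it a polynomial in the deformation parameter.\<close>

definition pencil_det :: "'a \<Rightarrow> 'a mat \<Rightarrow> 'a mat \<Rightarrow> 'a mat \<Rightarrow> 'a mat \<Rightarrow> 'a :: comm_ring_1" where
  "pencil_det a B D T E = det ((a * det T) \<cdot>\<^sub>m B + T * E * adj_mat T * D)"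

lemma pencil_det_hom:
  assumes h: "comm_ring_hom h" and [simp]: "B \<in> carrier_mat n n" "D \<in> carrier_mat n n" "T \<in> carrier_mat n n" "E \<in> carrier_mat n n"
  shows "pencil_det (h a) (map_mat h B) (map_mat h D) (map_mat h T) (map_mat h E) = h (pencil_det a B D T E)"
proof -
  interpret comm_ring_hom h by (rule h)
  have c: "adj_mat T \<in> carrier_mat n n" by (rule adj_mat) simp
  have "map_mat h ((a * det T) \<cdot>\<^sub>m B + T * E * adj_mat T * D) =
     (h a * det (map_mat h T)) \<cdot>\<^sub>m map_mat h B + map_mat h (T * E * adj_mat T * D)"
    using c carrier_matD[OF assms(2)] carrier_matD[OF assms(3)] carrier_matD[OF assms(4)] 
    by (intro eq_matI) (simp_all add: hom_distribs)
  also have "map_mat h (T * E * adj_mat T * D) = map_mat h T * map_mat h E * adj_mat (map_mat h T) * map_mat h D"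
    using c by (simp add: mat_hom_mult[of _ n n _ n] adj_mat_hom[OF h, of _ n] mult_carrier_mat[of _ n n _ n])
  finally show ?thesis unfolding pencil_det_def by (metis hom_det)
qed

lemma hom_poly_pencil:
  fixes X Y :: "'a :: comm_ring_1 mat"
  assumes "X \<in> carrier_mat n n" "Y \<in> carrier_mat n n"
  shows "map_mat (\<lambda>p. poly p t) (map_mat (\<lambda>x. [:x:]) X + [:0, 1:] \<cdot>\<^sub>m map_mat (\<lambda>x. [:x:]) Y) = X + t \<cdot>\<^sub>m Y"
  using assms by (intro eq_matI) auto

text \<open>The determinant is a polynomial in t, and t0 shows that it is not zero. Genericity
  arguments combine several such finite exceptional sets, each with its own witness.\<close>

lemma finite_singular_pencil:
  fixes X Y :: "'a :: idom mat"
  assumes XY: "X \<in> carrier_mat n n" "Y \<in> carrier_mat n n" and t0: "det (X + t0 \<cdot>\<^sub>m Y) \<noteq> 0"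
  shows "finite {t. det (X + t \<cdot>\<^sub>m Y) = 0}"
proof -
  define p where "p = det (map_mat (\<lambda>x. [:x:]) X + [:0, 1:] \<cdot>\<^sub>m map_mat (\<lambda>x. [:x:]) Y)"
  have p: "poly p t = det (X + t \<cdot>\<^sub>m Y)" for t
    unfolding p_def comm_ring_hom.hom_det[OF comm_ring_hom_poly, symmetric] hom_poly_pencil[OF XY] ..
  hence "p \<noteq> 0" using t0 by auto
  thus ?thesis using poly_roots_finite[of p] by (simp add: p)
qed

lemma finite_disc_pencil:
  fixes X Y :: "complex mat"
  assumes XY: "X \<in> carrier_mat n n" "Y \<in> carrier_mat n n" and n: "n > 0" and t0: "disc (X + t0 \<cdot>\<^sub>m Y) \<noteq> 0"
  shows "finite {t. disc (X + t \<cdot>\<^sub>m Y) = 0}"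
proof -
  let ?M = "map_mat (\<lambda>x. [:x:]) X + [:0, 1:] \<cdot>\<^sub>m map_mat (\<lambda>x. [:x:]) Y"
  have M: "?M \<in> carrier_mat n n" using XY by simp
  have p: "poly (disc ?M) t = disc (X + t \<cdot>\<^sub>m Y)" for t
    using disc_hom[OF comm_ring_hom_poly M n, of t] hom_poly_pencil[OF XY] by simp
  hence "disc ?M \<noteq> 0" using t0 by auto
  thus ?thesis unfolding p[symmetric] using poly_roots_finite by blast
qed

lemma add_mat_right_commute:
  fixes X Y Z :: "'a :: comm_monoid_add mat"
  assumes "X \<in> carrier_mat m n" "Y \<in> carrier_mat m n" "Z \<in> carrier_mat m n"
  shows "X + Y + Z = X + Z + Y"
  using assms by (intro eq_matI) (auto simp: ac_simps)

lemma add_zero_smult_mat: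
  fixes X Y :: "'a :: comm_ring_1 mat"
  assumes "X \<in> carrier_mat m n" "Y \<in> carrier_mat m n"
  shows "X + 0 \<cdot>\<^sub>m Y = X"
  using assms by (intro eq_matI) auto

lemma mat_inverse_exists:
  fixes A :: "'a :: field mat"
  assumes A: "A \<in> carrier_mat n n" and d: "det A \<noteq> 0"
  obtains R where "R \<in> carrier_mat n n" "A * R = 1\<^sub>m n" "R * A = 1\<^sub>m n"
proof
  note a = adj_mat[OF A]
  show "(1 / det A) \<cdot>\<^sub>m adj_mat A \<in> carrier_mat n n" using a by simp
  show "A * ((1 / det A) \<cdot>\<^sub>m adj_mat A) = 1\<^sub>m n" using a A d
    by (simp add: mult_smult_distrib[of _ n n _ n]) (intro eq_matI; auto)
  show "((1 / det A) \<cdot>\<^sub>m adj_mat A) * A = 1\<^sub>m n" using a A d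
    by (simp add: mult_smult_assoc_mat[of _ n n _ n]) (intro eq_matI; auto)
qed

text \<open>For a generic scalar s put S = P + s and Z = S^-1 Q. Then S (B + Z D) = P B + s B + Q D
  = 1 + s B, which is nonsingular for generic s as well.\<close>

lemma left_invertible_pencil_regular:
  fixes B D P Q :: "complex mat"
  assumes [simp]: "B \<in> carrier_mat n n" "D \<in> carrier_mat n n" "P \<in> carrier_mat n n" "Q \<in> carrier_mat n n"
    and eq: "P * B + Q * D = 1\<^sub>m n"
  obtains Z where "Z \<in> carrier_mat n n" "det (B + Z * D) \<noteq> 0"
proof -
  have f1: "finite {t. det (1\<^sub>m n + t \<cdot>\<^sub>m B) = 0}" and f2: "finite {t. det (1\<^sub>m n + t \<cdot>\<^sub>m P) = 0}"
  proof -
    have "1\<^sub>m n + 0 \<cdot>\<^sub>m X = 1\<^sub>m n" if "X \<in> carrier_mat n n" for X :: "complex mat"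
      using that by (intro eq_matI) auto
    thus "finite {t. det (1\<^sub>m n + t \<cdot>\<^sub>m B) = 0}" "finite {t. det (1\<^sub>m n + t \<cdot>\<^sub>m P) = 0}"
      by (intro finite_singular_pencil[of _ n _ 0]; simp)+
  qed
  \<comment> \<open>P + s is s times 1 + s^-1 P, so the exceptional values of the second pencil are
    avoided by the inverse of s.\<close>
  have "finite ({0} \<union> {t. det (1\<^sub>m n + t \<cdot>\<^sub>m B) = 0} \<union> inverse ` {t. det (1\<^sub>m n + t \<cdot>\<^sub>m P) = 0})"
    using f1 f2 by simp
  from ex_new_if_finite[OF infinite_UNIV_char_0 this]
  obtain s where s: "s \<notin> {0} \<union> {t. det (1\<^sub>m n + t \<cdot>\<^sub>m B) = 0} \<union> inverse ` {t. det (1\<^sub>m n + t \<cdot>\<^sub>m P) = 0}" ..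
  hence s0: "s \<noteq> 0" and s1: "det (1\<^sub>m n + s \<cdot>\<^sub>m B) \<noteq> 0" by auto
  have s2: "det (1\<^sub>m n + inverse s \<cdot>\<^sub>m P) \<noteq> 0"
  proof
    assume "det (1\<^sub>m n + inverse s \<cdot>\<^sub>m P) = 0"
    hence "inverse (inverse s) \<in> inverse ` {t. det (1\<^sub>m n + t \<cdot>\<^sub>m P) = 0}" by (intro imageI) simp
    thus False using s by simp
  qed
  define S where "S = P + s \<cdot>\<^sub>m 1\<^sub>m n"
  have S[simp]: "S \<in> carrier_mat n n" by (simp add: S_def)
  have "S = s \<cdot>\<^sub>m (1\<^sub>m n + inverse s \<cdot>\<^sub>m P)"
  proof (rule eq_matI)
    fix i j assume "i < dim_row (s \<cdot>\<^sub>m (1\<^sub>m n + inverse s \<cdot>\<^sub>m P))" "j < dim_col (s \<cdot>\<^sub>m (1\<^sub>m n + inverse s \<cdot>\<^sub>m P))"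
    thus "S $$ (i, j) = (s \<cdot>\<^sub>m (1\<^sub>m n + inverse s \<cdot>\<^sub>m P)) $$ (i, j)"
      using s0 carrier_matD[OF assms(3)] unfolding S_def by (simp add: distrib_left)
  qed (use carrier_matD[OF assms(3)] in \<open>simp_all add: S_def\<close>)
  hence "det S \<noteq> 0" using s0 s2 by (simp add: det_smult)
  then obtain R where R: "R \<in> carrier_mat n n" "S * R = 1\<^sub>m n" "R * S = 1\<^sub>m n" by (rule mat_inverse_exists[OF S])
  note [simp] = R(1) mult_carrier_mat[of _ n n _ n]
  have "S * (B + R * Q * D) = S * B + (S * R) * Q * D"
    by (simp add: mult_add_distrib_mat[of _ n n _ n] assoc_mult_mat[of _ n n _ n _ n])
  also have "\<dots> = P * B + s \<cdot>\<^sub>m B + Q * D" unfolding R(2) unfolding S_def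
    by (simp add: add_mult_distrib_mat[of _ n n _ _ n] mult_smult_assoc_mat[of _ n n _ n] left_mult_one_mat[of _ n n])
  also have "\<dots> = (P * B + Q * D) + s \<cdot>\<^sub>m B" 
    by (rule add_mat_right_commute[of _ n n]) auto
  finally have "S * (B + R * Q * D) = 1\<^sub>m n + s \<cdot>\<^sub>m B" unfolding eq .
  hence "det S * det (B + R * Q * D) = det (1\<^sub>m n + s \<cdot>\<^sub>m B)" 
    by (metis (no_types, lifting) R(1) S add_carrier_mat assms(2,4) det_mult mult_carrier_mat)
  hence "det (B + (R * Q) * D) \<noteq> 0" using s1 by auto
  thus ?thesis by (intro that[of "R * Q"]) auto
qed

text \<open>A fixed matrix with distinct eigenvalues; a segment that ends in it meets
  \<open>disc\<close> = 0 only finitely often.\<close>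

definition nat_diag :: "nat \<Rightarrow> complex mat" where
  "nat_diag n = mat n n (\<lambda>(i, j). if i = j then of_nat i else 0)"

lemma nat_diag [simp]: "nat_diag n \<in> carrier_mat n n" "diagonal_mat (nat_diag n)" "disc (nat_diag n) \<noteq> 0"
proof -
  show c: "nat_diag n \<in> carrier_mat n n" and d: "diagonal_mat (nat_diag n)"
    by (auto simp: nat_diag_def diagonal_mat_def)
  show "disc (nat_diag n) \<noteq> 0" unfolding disc_diagonal[OF c d] by (auto simp: nat_diag_def)
qed

lemma segment_mat:
  assumes "X \<in> carrier_mat n n" "Y \<in> carrier_mat n n"
  shows "X + 1 \<cdot>\<^sub>m (Y - X) = (Y :: 'a :: comm_ring_1 mat)" "X + 0 \<cdot>\<^sub>m (Y - X) = X"
  using assms by (intro eq_matI; auto)+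

text \<open>On the segment from a Z with B + Z D nonsingular to \<open>nat_diag\<close>, the
  determinant is nonzero at one end and the discriminant at the other. Hence both are nonzero at
  some point, where the matrix is diagonalizable.\<close>

lemma diagonalizable_pencil_regular:
  fixes B D P Q :: "complex mat"
  assumes [simp]: "B \<in> carrier_mat n n" "D \<in> carrier_mat n n" "P \<in> carrier_mat n n" "Q \<in> carrier_mat n n"
    and eq: "P * B + Q * D = 1\<^sub>m n" and n: "n > 0"
  obtains V W L where "V \<in> carrier_mat n n" "W \<in> carrier_mat n n" "L \<in> carrier_mat n n"
    "V * W = 1\<^sub>m n" "W * V = 1\<^sub>m n" "diagonal_mat L" "det (B + V * L * W * D) \<noteq> 0"
proof -
  from left_invertible_pencil_regular[OF assms(1-5)] obtain Z where 
    Z[simp]: "Z \<in> carrier_mat n n" and dZ: "det (B + Z * D) \<noteq> 0" .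
  let ?N = "nat_diag n"
  note [simp] = mult_carrier_mat[of _ n n _ n] minus_carrier_mat[of Z n n]
  have "disc (Z + 1 \<cdot>\<^sub>m (?N - Z)) \<noteq> 0" by (simp add: segment_mat[of _ n])
  hence f1: "finite {t. disc (Z + t \<cdot>\<^sub>m (?N - Z)) = 0}" by (intro finite_disc_pencil[OF _ _ n]) auto
  have e: "B + (Z + t \<cdot>\<^sub>m (?N - Z)) * D = (B + Z * D) + t \<cdot>\<^sub>m ((?N - Z) * D)" for t
    by (simp add: add_mult_distrib_mat[of _ n n _ _ n] mult_smult_assoc_mat[of _ n n _ n] assoc_add_mat[of _ n n])
  have "det ((B + Z * D) + 0 \<cdot>\<^sub>m ((?N - Z) * D)) \<noteq> 0" 
    unfolding e[symmetric] using dZ by (simp add: segment_mat[of _ n])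
  hence f2: "finite {t. det ((B + Z * D) + t \<cdot>\<^sub>m ((?N - Z) * D)) = 0}"
    by (intro finite_singular_pencil[of _ n]) auto
  from ex_new_if_finite[OF infinite_UNIV_char_0 finite_UnI[OF f1 f2]]
  obtain t where t: "t \<notin> {t. disc (Z + t \<cdot>\<^sub>m (?N - Z)) = 0} \<union> {t. det ((B + Z * D) + t \<cdot>\<^sub>m ((?N - Z) * D)) = 0}" ..
  define Z' where "Z' = Z + t \<cdot>\<^sub>m (?N - Z)"
  have Z': "Z' \<in> carrier_mat n n" "disc Z' \<noteq> 0" "det (B + Z' * D) \<noteq> 0"
    using t unfolding Z'_def e by auto
  from disc_nonzero_diagonalizable[OF Z'(1,2)] obtain V W L where 
    "V \<in> carrier_mat n n" "W \<in> carrier_mat n n" "L \<in> carrier_mat n n"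
    "diagonal_mat L" "V * W = 1\<^sub>m n" "W * V = 1\<^sub>m n" "Z' = V * L * W" by metis
  thus ?thesis using Z'(3) by (intro that[of V W L]) auto
qed

lemma diagonal_mat_pencil:
  fixes X Y :: "'a :: comm_ring_1 mat"
  assumes "X \<in> carrier_mat n n" "Y \<in> carrier_mat n n" "diagonal_mat X" "diagonal_mat Y"
  shows "diagonal_mat (X + t \<cdot>\<^sub>m Y)" "diagonal_mat (t \<cdot>\<^sub>m X)" "diagonal_mat (X - Y)"
  using assms by (auto simp: diagonal_mat_def)

lemma diagonal_mat_commute:
  fixes X Y :: "'a :: comm_ring_1 mat"
  assumes "X \<in> carrier_mat n n" "Y \<in> carrier_mat n n" "diagonal_mat X" "diagonal_mat Y"
  shows "X * Y = Y * X"
proof (rule eq_matI)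
  fix i j assume "i < dim_row (Y * X)" "j < dim_col (Y * X)"
  hence ij: "i < n" "j < n" using assms by auto
  have *: "(X * Y) $$ (i, j) = (if i = j then X $$ (i, i) * Y $$ (i, i) else 0)" 
    if "X \<in> carrier_mat n n" "Y \<in> carrier_mat n n" "diagonal_mat X" "diagonal_mat Y" for X Y :: "'a mat"
  proof -
    have "(X * Y) $$ (i, j) = (\<Sum>k = 0..<n. X $$ (i, k) * Y $$ (k, j))"
      using that ij by (simp add: scalar_prod_def)
    also have "\<dots> = (\<Sum>k = 0..<n. if k = i then X $$ (i, i) * Y $$ (i, j) else 0)"
      using that ij by (intro sum.cong) (auto simp: diagonal_mat_def)
    finally show ?thesis using that ij by (auto simp: diagonal_mat_def)
  qed
  show "(X * Y) $$ (i, j) = (Y * X) $$ (i, j)" using *[of X Y] *[of Y X] assms by (simp add: mult.commute)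
qed (use assms in auto)

text \<open>T = V H carries the eigenvectors G to V, since H G = 1. So T G (a L) H T^-1 = a V L W,
  and the pencil is a scalar multiple of B + V L W D.\<close>

lemma pencil_det_conj:
  fixes B D :: "complex mat"
  assumes [simp]: "B \<in> carrier_mat n n" "D \<in> carrier_mat n n" "V \<in> carrier_mat n n" "W \<in> carrier_mat n n"
     "G \<in> carrier_mat n n" "H \<in> carrier_mat n n" "L \<in> carrier_mat n n"
    and inv: "V * W = 1\<^sub>m n" "W * V = 1\<^sub>m n" "G * H = 1\<^sub>m n" "H * G = 1\<^sub>m n"
    and a: "a \<noteq> 0" and det: "det (B + V * L * W * D) \<noteq> 0"
  shows "pencil_det a B D (V * H) (G * (a \<cdot>\<^sub>m L) * H) \<noteq> 0"
proof -
  note [simp] = mult_carrier_mat[of _ n n _ n] 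
  let ?T = "V * H" and ?d = "det (V * H)"
  have T: "?T \<in> carrier_mat n n" by simp
  note adj = adj_mat[OF T]
  note [simp] = adj(1)
  have dd: "det V * det W = 1" "det G * det H = 1" 
    using arg_cong[OF inv(1), of det] arg_cong[OF inv(3), of det] by (simp_all add: det_mult[of _ n])
  hence d: "?d \<noteq> 0" by (auto simp: det_mult[of _ n])
  note assoc = assoc_mult_mat[of _ n n _ n _ n]
  have "adj_mat ?T = (G * (W * V) * H) * adj_mat ?T" unfolding inv 
    by (simp add: inv left_mult_one_mat[of _ n n] right_mult_one_mat[of _ n n])
  also have "\<dots> = G * W * (?T * adj_mat ?T)" by (simp add: assoc)
  also have "\<dots> = ?d \<cdot>\<^sub>m (G * W)" unfolding adj
    by (simp add: mult_smult_distrib[of _ n n _ n] right_mult_one_mat[of _ n n])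
  finally have adjT: "adj_mat ?T = ?d \<cdot>\<^sub>m (G * W)" .
  have "?T * (G * (a \<cdot>\<^sub>m L) * H) * adj_mat ?T = (a * ?d) \<cdot>\<^sub>m (V * (H * G) * L * (H * G) * W)"
    unfolding adjT by (simp add: assoc mult_smult_distrib[of _ n n _ n] mult_smult_assoc_mat[of _ n n _ n])
      (intro eq_matI; simp)
  also have "\<dots> = (a * ?d) \<cdot>\<^sub>m (V * L * W)" unfolding inv by (simp add: right_mult_one_mat[of _ n n])
  finally have "(a * ?d) \<cdot>\<^sub>m B + ?T * (G * (a \<cdot>\<^sub>m L) * H) * adj_mat ?T * D = (a * ?d) \<cdot>\<^sub>m (B + V * L * W * D)"
    by (simp add: mult_smult_assoc_mat[of _ n n _ n] add_smult_distrib_left_mat[of _ n n])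
  thus ?thesis using det d a unfolding pencil_det_def by (simp add: det_smult)
qed

text \<open>With A = G L H and a diagonal M for which B + V M W D is nonsingular, the candidate E =
  G (a M - L) H commutes with A and gives A + E = G (a M) H. It may have repeated eigenvalues, so
  its diagonal factor is moved along the segment to \<open>nat_diag\<close>.\<close>

lemma pencil_det_choice:
  fixes A B D P Q :: "complex mat"
  assumes [simp]: "B \<in> carrier_mat n n" "D \<in> carrier_mat n n" "P \<in> carrier_mat n n" "Q \<in> carrier_mat n n"
      "A \<in> carrier_mat n n"
    and eq: "P * B + Q * D = 1\<^sub>m n" and n: "n > 0" and diag: "diagonalizable A" and a: "a \<noteq> 0"
  obtains T E where "T \<in> carrier_mat n n" "E \<in> carrier_mat n n" "A * E = E * A" "disc E \<noteq> 0"
    "pencil_det a B D T (A + E) \<noteq> 0"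
proof -
  from diagonalizableE[OF diag assms(5)] obtain G H L where
    GHL[simp]: "G \<in> carrier_mat n n" "H \<in> carrier_mat n n" "L \<in> carrier_mat n n"
    and L: "diagonal_mat L" and GH: "G * H = 1\<^sub>m n" "H * G = 1\<^sub>m n" and A: "A = G * L * H" .
  from diagonalizable_pencil_regular[OF assms(1-4) eq n] obtain V W M where
    VWM[simp]: "V \<in> carrier_mat n n" "W \<in> carrier_mat n n" "M \<in> carrier_mat n n"
    and VW: "V * W = 1\<^sub>m n" "W * V = 1\<^sub>m n" and M: "diagonal_mat M" and det: "det (B + V * M * W * D) \<noteq> 0" .
  note [simp] = mult_carrier_mat[of _ n n _ n] 
  let ?N = "nat_diag n"
  \<comment> \<open>Chosen so that L + (F + t F') = a (M + t M'): M must follow when F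
    moves.\<close>
  define M' where "M' = (1 / a) \<cdot>\<^sub>m (L + ?N) - M"
  have M'[simp]: "M' \<in> carrier_mat n n" unfolding M'_def by (rule minus_carrier_mat) simp
  define F where "F = a \<cdot>\<^sub>m M - L"
  define F' where "F' = ?N - F"
  have F[simp]: "F \<in> carrier_mat n n" "F' \<in> carrier_mat n n" unfolding F_def F'_def
    by (simp_all add: minus_carrier_mat[of _ n n])
  have dF: "diagonal_mat F" unfolding F_def using L M
    by (intro diagonal_mat_pencil(3)[of _ n] diagonal_mat_pencil(2)[of _ n]) auto
  have dF': "diagonal_mat F'" unfolding F'_def using dF
    by (intro diagonal_mat_pencil(3)[of _ n]) auto
  have FM: "L + (F + t \<cdot>\<^sub>m F') = a \<cdot>\<^sub>m (M + t \<cdot>\<^sub>m M')" for t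
    unfolding F'_def F_def M'_def using a carrier_matD[OF GHL(3)] carrier_matD[OF VWM(3)] carrier_matD[OF nat_diag(1)[of n]]
    by (intro eq_matI) (simp_all add: field_simps)
  have "disc (F + 1 \<cdot>\<^sub>m F') \<noteq> 0" unfolding F'_def by (simp add: segment_mat[of _ n])
  hence f1: "finite {t. disc (F + t \<cdot>\<^sub>m F') = 0}" by (intro finite_disc_pencil[OF _ _ n]) auto
  have e: "B + V * (M + t \<cdot>\<^sub>m M') * W * D = (B + V * M * W * D) + t \<cdot>\<^sub>m (V * M' * W * D)" for t
    by (simp add: conj_add[of _ n] conj_smult[of _ n] add_mult_distrib_mat[of _ n n _ _ n] 
        mult_smult_assoc_mat[of _ n n _ n] assoc_add_mat[of _ n n])
  have "(B + V * M * W * D) + 0 \<cdot>\<^sub>m (V * M' * W * D) = B + V * M * W * D"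
    by (rule add_zero_smult_mat[of _ n n]) auto
  hence f2: "finite {t. det ((B + V * M * W * D) + t \<cdot>\<^sub>m (V * M' * W * D)) = 0}"
    using det by (intro finite_singular_pencil[of _ n _ 0]) auto
  from ex_new_if_finite[OF infinite_UNIV_char_0 finite_UnI[OF f1 f2]]
  obtain t where t: "t \<notin> {t. disc (F + t \<cdot>\<^sub>m F') = 0} \<union> {t. det ((B + V * M * W * D) + t \<cdot>\<^sub>m (V * M' * W * D)) = 0}" ..
  let ?F = "F + t \<cdot>\<^sub>m F'"
  have dFt: "diagonal_mat ?F" using dF dF' by (intro diagonal_mat_pencil(1)[of _ n]) auto
  define E where "E = G * ?F * H"
  have sum: "A + E = G * (a \<cdot>\<^sub>m (M + t \<cdot>\<^sub>m M')) * H"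
    unfolding A E_def FM[symmetric] by (rule conj_add[of _ n, symmetric]) auto
  show ?thesis
  proof
    show "V * H \<in> carrier_mat n n" "E \<in> carrier_mat n n" by (auto simp: E_def)
    show "A * E = E * A" unfolding A E_def 
      by (simp add: conj_mult[OF GHL(1,2) _ _ GH(2)] diagonal_mat_commute[OF GHL(3) _ L dFt])
    have "similar_mat E ?F" by (rule similar_matI[of _ _ G H n]) (auto simp: GH E_def)
    thus "disc E \<noteq> 0" using t disc_similar by force
    show "pencil_det a B D (V * H) (A + E) \<noteq> 0" unfolding sum
      using t e by (intro pencil_det_conj[OF _ _ _ _ _ _ _ VW GH a]) auto
  qed
qed

section \<open>Passage to real parameters\<close>

lemma comm_ring_hom_ev: "comm_ring_hom (ev z)"
  by (rule ev.comm_ring_hom_axioms)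

lemma map_mat_add_hom:
  assumes "comm_ring_hom h" "X \<in> carrier_mat m n" "Y \<in> carrier_mat m n"
  shows "map_mat h (X + Y) = map_mat h X + map_mat h Y"
proof -
  interpret comm_ring_hom h by fact
  show ?thesis using assms(2,3) by (intro eq_matI) (auto simp: hom_add)
qed

lemma map_mat_smult_hom:
  assumes "comm_ring_hom h"
  shows "map_mat h (c \<cdot>\<^sub>m X) = h c \<cdot>\<^sub>m map_mat h X"
proof -
  interpret comm_ring_hom h by fact
  show ?thesis by (intro eq_matI) (auto simp: hom_mult)
qed

text \<open>The parameters T and C become constant matrices over the real polynomials, so they must
  be real. A complex choice X is the value at t = i of Re X + t Im X. The product of the two
  quantities that have to be nonzero is a polynomial in t; it does not vanish at i, hence not at
  some real t.\<close>

lemma real_pencil_det_choice: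
  fixes A B D P Q :: "complex mat" and g :: "nat \<Rightarrow> nat \<Rightarrow> nat \<Rightarrow> nat \<Rightarrow> complex"
  assumes BD[simp]: "B \<in> carrier_mat n n" "D \<in> carrier_mat n n" "P \<in> carrier_mat n n" "Q \<in> carrier_mat n n"
      "A \<in> carrier_mat n n"
    and eq: "P * B + Q * D = 1\<^sub>m n" and n: "n > 0" and diag: "diagonalizable A" and a: "a \<noteq> 0" and c: "c \<noteq> 0"
  obtains T C :: "real mat" where "T \<in> carrier_mat n n" "C \<in> carrier_mat n n" 
    "disc (commutant_proj n c g A (map_mat of_real C)) \<noteq> 0"
    "pencil_det a B D (map_mat of_real T) (A + commutant_proj n c g A (map_mat of_real C)) \<noteq> 0"
proof -
  from pencil_det_choice[OF BD eq n diag a] obtain T E where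
    T[simp]: "T \<in> carrier_mat n n" and E[simp]: "E \<in> carrier_mat n n" and comm: "A * E = E * A" 
    and dE: "disc E \<noteq> 0" and pE: "pencil_det a B D T (A + E) \<noteq> 0" .
  define C where "C = (1 / c) \<cdot>\<^sub>m E"
  have C[simp]: "C \<in> carrier_mat n n" by (simp add: C_def)
  have "A * C = C * A" unfolding C_def using comm
    by (simp add: mult_smult_distrib[of _ n n _ n] mult_smult_assoc_mat[of _ n n _ n])
  hence YC: "commutant_proj n c g A C = E" unfolding commutant_proj_commuting[OF BD(5) C \<open>A * C = C * A\<close>]
    using c by (simp add: C_def) (intro eq_matI; simp)
  define k where "k = map_mat (\<lambda>x :: complex. [:x:])"
  define re where "re = (\<lambda>X :: complex mat. map_mat complex_of_real (map_mat Re X))"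
  define im where "im = (\<lambda>X :: complex mat. map_mat complex_of_real (map_mat Im X))"
  define path where "path = (\<lambda>X t. re X + t \<cdot>\<^sub>m im X)"
  define lin where "lin = (\<lambda>X. k (re X) + [:0, 1:] \<cdot>\<^sub>m k (im X))"
  have [simp]: "lin X \<in> carrier_mat n n" "path X t \<in> carrier_mat n n" if "X \<in> carrier_mat n n" for X t
    using that by (simp_all add: lin_def path_def k_def re_def im_def)
  have evlin: "map_mat (\<lambda>p. poly p t) (lin X) = path X t" if "X \<in> carrier_mat n n" for X t
    unfolding lin_def path_def k_def using that by (intro hom_poly_pencil[of _ n]) (auto simp: re_def im_def)
  have path_i: "path X \<i> = X" for X
    unfolding path_def re_def im_def using complex_eq by (intro eq_matI) auto
  have evk: "map_mat (\<lambda>p. poly p t) (k X) = X" for X t unfolding k_def by (intro eq_matI) auto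
  have [simp]: "k X \<in> carrier_mat n n" if "X \<in> carrier_mat n n" for X using that by (simp add: k_def)
  define Y where "Y = commutant_proj n [:c:] (\<lambda>p q i j. [:g p q i j:]) (k A) (lin C)"
  have Y[simp]: "Y \<in> carrier_mat n n" by (simp add: Y_def)
  have evY: "map_mat (\<lambda>p. poly p t) Y = commutant_proj n c g A (path C t)" for t
    unfolding Y_def by (subst commutant_proj_hom[OF comm_ring_hom_poly, of _ n]) (simp_all add: evk evlin)
  define F where "F = pencil_det [:a:] (k B) (k D) (lin T) (k A + Y) * disc Y"
  have F: "poly F t = pencil_det a B D (path T t) (A + commutant_proj n c g A (path C t)) * disc (commutant_proj n c g A (path C t))" for t
  proof -
    have "map_mat (\<lambda>p. poly p t) (k A + Y) = A + commutant_proj n c g A (path C t)"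
      by (subst map_mat_add_hom[OF comm_ring_hom_poly, of _ n n]) (simp_all add: evY evk)
    thus ?thesis unfolding F_def poly_mult
      using pencil_det_hom[OF comm_ring_hom_poly[of t], of "k B" n "k D" "lin T" "k A + Y" "[:a:]"]
        disc_hom[OF comm_ring_hom_poly[of t] Y n]
      by (simp add: evk evlin evY)
  qed
  have "poly F \<i> \<noteq> 0" unfolding F path_i YC using dE pE by simp
  hence "F \<noteq> 0" by auto
  hence fin: "finite {t. poly F t = 0}" by (rule poly_roots_finite)
  have "finite {x. poly F (complex_of_real x) = 0}"
    using finite_vimageI[OF fin, of complex_of_real] by (simp add: inj_def vimage_def)
  from ex_new_if_finite[OF infinite_UNIV_char_0 this] obtain x where x: "poly F (complex_of_real x) \<noteq> 0" by auto
  have real: "path X (complex_of_real x) = map_mat complex_of_real (map_mat Re X + x \<cdot>\<^sub>m map_mat Im X)" for X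
    unfolding path_def re_def im_def by (intro eq_matI) auto
  show ?thesis
    by (rule that[of "map_mat Re T + x \<cdot>\<^sub>m map_mat Im T" "map_mat Re C + x \<cdot>\<^sub>m map_mat Im C"])
       (use x in \<open>simp_all add: F real\<close>)
qed

section \<open>Compactness and continuity\<close>

lemma compact_nonzero_nhds:
  fixes G :: "real \<times> 'a :: metric_space \<Rightarrow> complex"
  assumes S: "compact S" and cont: "continuous_on (UNIV \<times> S) G" and nz: "\<And>x. x \<in> S \<Longrightarrow> G (0, x) \<noteq> 0"
  obtains \<delta> where "\<delta> > 0" "\<And>t x. \<bar>t\<bar> < \<delta> \<Longrightarrow> x \<in> S \<Longrightarrow> G (t, x) \<noteq> 0"
proof -
  define Z where "Z = {p \<in> {-1..1} \<times> S. G p \<in> {0}}"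
  have c: "continuous_on ({-1..1} \<times> S) G" by (rule continuous_on_subset[OF cont]) auto
  have cp: "compact ({-1..1::real} \<times> S)" using S by (intro compact_Times) auto
  have "closedin (top_of_set ({-1..1} \<times> S)) (({-1..1} \<times> S) \<inter> G -` {0})"
    using c by (rule continuous_closedin_preimage) simp
  moreover have "({-1..1} \<times> S) \<inter> G -` {0} = Z" by (auto simp: Z_def)
  ultimately have "compact Z" using cp closedin_compact by metis
  hence "compact (fst ` Z)" by (rule compact_continuous_image[rotated]) (intro continuous_intros)
  hence "closed (fst ` Z)" by (rule compact_imp_closed)
  moreover have "0 \<notin> fst ` Z" using nz by (auto simp: Z_def)
  ultimately obtain d where d: "d > 0" "\<And>t. dist t 0 < d \<Longrightarrow> t \<notin> fst ` Z"
    by (metis Compl_iff open_Compl open_dist)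
  show ?thesis
  proof (rule that[of "min d 1"])
    fix t x assume t: "\<bar>t\<bar> < min d 1" and x: "x \<in> S"
    show "G (t, x) \<noteq> 0"
    proof
      assume "G (t, x) = 0"
      hence "(t, x) \<in> Z" using t x by (auto simp: Z_def)
      thus False using d(2)[of t] t by force
    qed
  qed (use d in simp)
qed

text \<open>Continuity is required entrywise; the Leibniz formula expresses the determinant through
  the entries by sums and products.\<close>

lemma continuous_on_det:
  fixes F :: "'b :: topological_space \<Rightarrow> complex mat"
  assumes c: "\<And>x. F x \<in> carrier_mat n n"
    and cont: "\<And>i j. i < n \<Longrightarrow> j < n \<Longrightarrow> continuous_on S (\<lambda>x. F x $$ (i, j))"
  shows "continuous_on S (\<lambda>x. det (F x))"
proof -
  have "det (F x) = (\<Sum>p \<in> {p. p permutes {0..<n}}. signof p * (\<Prod>i = 0..<n. F x $$ (i, p i)))" for x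
    by (rule det_def'[OF c])
  thus ?thesis
    by (simp only:) (intro continuous_intros cont; auto dest: permutes_in_image)
qed

lemma continuous_on_ev [continuous_intros]:
  "continuous_on S f \<Longrightarrow> continuous_on S (\<lambda>x. ev (f x) p)"
  unfolding ev_def by (rule continuous_on_poly)

section \<open>Operations that preserve diagonalizability\<close>

lemma diagonalizable_conj:
  assumes [simp]: "T \<in> carrier_mat n n" "E \<in> carrier_mat n n" and d: "diagonalizable E" and det: "det T \<noteq> 0"
  shows "diagonalizable (T * E * adj_mat T)"
proof -
  note adj = adj_mat[OF assms(1)]
  from mat_inverse_exists[OF assms(1) det] obtain R where R[simp]: "R \<in> carrier_mat n n" 
    and TR: "T * R = 1\<^sub>m n" "R * T = 1\<^sub>m n" .
  note [simp] = adj(1) mult_carrier_mat[of _ n n _ n]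
  note assoc = assoc_mult_mat[of _ n n _ n _ n]
  have "adj_mat T = (R * T) * adj_mat T" by (simp add: TR left_mult_one_mat[of _ n n])
  also have "\<dots> = R * (T * adj_mat T)" by (simp add: assoc)
  also have "\<dots> = det T \<cdot>\<^sub>m R" unfolding adj(2) 
    by (simp add: mult_smult_distrib[of _ n n _ n] right_mult_one_mat[of _ n n])
  finally have aT: "adj_mat T = det T \<cdot>\<^sub>m R" .
  from diagonalizableE[OF d assms(2)] obtain G H L where GHL[simp]: "G \<in> carrier_mat n n" "H \<in> carrier_mat n n" "L \<in> carrier_mat n n"
    and L: "diagonal_mat L" and GH: "G * H = 1\<^sub>m n" "H * G = 1\<^sub>m n" and E: "E = G * L * H" .
  have "T * E * adj_mat T = (T * G) * (det T \<cdot>\<^sub>m L) * (H * R)"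
    unfolding aT E by (simp add: assoc mult_smult_distrib[of _ n n _ n] mult_smult_assoc_mat[of _ n n _ n])
  also have "diagonalizable \<dots>"
  proof (rule diagonalizableI[of _ n])
    have "(T * G) * (H * R) = T * (G * H) * R" by (simp add: assoc)
    thus "(T * G) * (H * R) = 1\<^sub>m n" by (simp add: GH TR right_mult_one_mat[of _ n n])
    have "(H * R) * (T * G) = H * (R * T) * G" by (simp add: assoc)
    thus "(H * R) * (T * G) = 1\<^sub>m n" by (simp add: GH TR right_mult_one_mat[of _ n n])
    show "diagonal_mat (det T \<cdot>\<^sub>m L)" by (rule diagonal_mat_pencil(2)[of _ n L]) (use L in auto)
  qed auto
  finally show ?thesis .
qed

text \<open>In an eigenbasis of Y the matrix A commutes with a diagonal matrix with distinct
  entries, so it is diagonal too.\<close>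

lemma diagonalizable_commuting_pencil:
  fixes A Y :: "complex mat"
  assumes [simp]: "A \<in> carrier_mat n n" "Y \<in> carrier_mat n n"
    and comm: "A * Y = Y * A" and disc: "disc Y \<noteq> 0"
  shows "diagonalizable (A + c \<cdot>\<^sub>m Y)"
proof -
  from disc_nonzero_diagonalizable[OF assms(2) disc] obtain G H L where
    GHL[simp]: "G \<in> carrier_mat n n" "H \<in> carrier_mat n n" "L \<in> carrier_mat n n"
    and L: "diagonal_mat L" and GH: "G * H = 1\<^sub>m n" "H * G = 1\<^sub>m n" and Y: "Y = G * L * H"
    and dist: "\<And>i j. i < n \<Longrightarrow> j < n \<Longrightarrow> i \<noteq> j \<Longrightarrow> L $$ (i, i) \<noteq> L $$ (j, j)" by metis
  note [simp] = mult_carrier_mat[of _ n n _ n]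
  define N where "N = H * A * G"
  have N[simp]: "N \<in> carrier_mat n n" by (simp add: N_def)
  have A: "A = G * N * H" unfolding N_def by (rule conj_inv[symmetric, OF _ _ _ GH(1)]) auto
  have L': "L = H * Y * G" unfolding Y by (rule conj_inv[symmetric, OF _ _ _ GH(2)]) auto
  have "N * L = H * (A * Y) * G" "L * N = H * (Y * A) * G"
    unfolding N_def L' by (simp_all add: conj_mult[OF GHL(2,1) _ _ GH(1)])
  hence "N * L = L * N" using comm by simp
  hence "diagonal_mat N" by (intro diagonal_mat_if_commutes[OF N GHL(3) L dist]) auto
  hence "diagonal_mat (N + c \<cdot>\<^sub>m L)" using L by (intro diagonal_mat_pencil(1)[of _ n]) auto
  moreover have "A + c \<cdot>\<^sub>m Y = G * (N + c \<cdot>\<^sub>m L) * H"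
    unfolding Y by (subst A) (simp add: conj_add[of _ n] conj_smult[of _ n])
  ultimately show ?thesis using GH by (auto intro: diagonalizableI[of _ n])
qed

lemma adj_mat_one: "adj_mat (1\<^sub>m n) = (1\<^sub>m n :: 'a :: comm_ring_1 mat)"
  using adj_mat[of "1\<^sub>m n :: 'a mat" n] left_mult_one_mat[of "adj_mat (1\<^sub>m n)" n n]
  by (auto intro!: eq_matI)

abbreviation ev_mat :: "complex \<Rightarrow> real poly mat \<Rightarrow> complex mat" where
  "ev_mat z \<equiv> map_mat (ev z)"

text \<open>The deformation on the disc, with W = A / a. The new numerator is T A adj(T) and the new
  denominator a det T, both taken at the shifted point as far as A and a are concerned; the extra
  factor det T of the adjugate thus cancels in the quotient. Vanishing of \<open>\<beta>\<close>
  marks the points where nothing may change.\<close>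

lemma pencil_deformation:
  fixes A :: "real poly mat" and a \<beta> :: "real poly" and B D P Q :: "complex mat" and K :: "complex set"
  assumes n: "n > 0" and A[simp]: "A \<in> carrier_mat n n"
    and BD[simp]: "B \<in> carrier_mat n n" "D \<in> carrier_mat n n" "P \<in> carrier_mat n n" "Q \<in> carrier_mat n n"
    and eq: "P * B + Q * D = 1\<^sub>m n"
    and K: "compact K" and K01: "\<And>x. 0 \<le> x \<Longrightarrow> x \<le> 1 \<Longrightarrow> complex_of_real x \<in> K"
    and diag: "\<And>z. z \<in> K \<Longrightarrow> diagonalizable (ev_mat z A)"
    and nz: "\<And>z l. z \<in> K \<Longrightarrow> 0 \<le> l \<Longrightarrow> l \<le> 1 \<Longrightarrow>
      det ((complex_of_real (1 - l) * ev z a) \<cdot>\<^sub>m 1\<^sub>m n + complex_of_real l \<cdot>\<^sub>m ev_mat z A) \<noteq> 0"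
    and \<beta>0: "poly \<beta> 0 \<noteq> 0"
  obtains A' a' where "A' \<in> carrier_mat n n"
    "\<And>z. z \<in> K \<Longrightarrow> diagonalizable (ev_mat z A')"
    "\<And>z l. z \<in> K \<Longrightarrow> 0 \<le> l \<Longrightarrow> l \<le> 1 \<Longrightarrow>
      det ((complex_of_real (1 - l) * ev z a') \<cdot>\<^sub>m 1\<^sub>m n + complex_of_real l \<cdot>\<^sub>m ev_mat z A') \<noteq> 0"
    "\<And>z. ev z \<beta> = 0 \<Longrightarrow> ev_mat z A' = ev_mat z A \<and> ev z a' = ev z a"
    "det (ev 0 a' \<cdot>\<^sub>m B + ev_mat 0 A' * D) \<noteq> 0"
proof -
  let ?r = "complex_of_real"
  have a_nz: "ev z a \<noteq> 0" if "z \<in> K" for z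
    using nz[OF that, of 0] n by (auto simp: add_zero_smult_mat[of _ n n] det_smult)
  obtain c g where c: "c \<noteq> 0" and comm: "\<And>V :: real poly mat. V \<in> carrier_mat n n \<Longrightarrow> 
      A * commutant_proj n c g A V = commutant_proj n c g A V * A"
    using commutant_proj_exists[OF A] by blast
  have "\<beta> \<noteq> 0" using \<beta>0 by auto
  hence fin: "finite {x. poly (c * \<beta>) x = 0}" using c by (intro poly_roots_finite) simp
  \<comment> \<open>At t0 the factor c must be nonzero for the whole commutant of A to be attained,
    and \<open>\<beta>\<close> must be nonzero so that q can be normalised there.\<close>
  have "\<not> {0<..1::real} \<subseteq> {x. poly (c * \<beta>) x = 0}"
  proof
    assume "{0<..1::real} \<subseteq> {x. poly (c * \<beta>) x = 0}"
    from finite_subset[OF this fin] show False using infinite_Ioc[of 0 "1::real"] by simp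
  qed
  then obtain t0 where "t0 \<in> {0<..1}" "poly (c * \<beta>) t0 \<noteq> 0" by blast
  hence t0: "0 < t0" "t0 \<le> 1" "poly c t0 \<noteq> 0" "poly \<beta> t0 \<noteq> 0" by auto
  have t0K: "?r t0 \<in> K" using t0 by (intro K01) auto
  obtain T C :: "real mat" where T[simp]: "T \<in> carrier_mat n n" and C[simp]: "C \<in> carrier_mat n n"
    and dY: "disc (commutant_proj n (ev (?r t0) c) (\<lambda>p q i j. ev (?r t0) (g p q i j)) (ev_mat (?r t0) A) (map_mat of_real C)) \<noteq> 0"
    and pT: "pencil_det (ev (?r t0) a) B D (map_mat of_real T) (ev_mat (?r t0) A +
      commutant_proj n (ev (?r t0) c) (\<lambda>p q i j. ev (?r t0) (g p q i j)) (ev_mat (?r t0) A) (map_mat of_real C)) \<noteq> 0"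
    by (rule real_pencil_det_choice[OF BD _ eq n diag[OF t0K] a_nz[OF t0K], of "ev (?r t0) c"])
       (use t0 in \<open>auto simp: ev_of_real\<close>)
  define Y where "Y = commutant_proj n c g A (map_mat (\<lambda>x. [:x:]) C)"
  have Y[simp]: "Y \<in> carrier_mat n n" by (simp add: Y_def)
  have AY: "A * Y = Y * A" unfolding Y_def by (rule comm) simp
  have constC: "ev_mat z (map_mat (\<lambda>x. [:x:]) C) = map_mat of_real C" for z by (intro eq_matI) auto
  have evY: "ev_mat (?r t0) Y = commutant_proj n (ev (?r t0) c) (\<lambda>p q i j. ev (?r t0) (g p q i j)) (ev_mat (?r t0) A) (map_mat of_real C)"
    unfolding Y_def by (subst commutant_proj_hom[OF comm_ring_hom_ev, of _ n]) (simp_all add: constC)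
  have discY: "ev z (disc Y) = disc (ev_mat z Y)" for z by (rule disc_hom[OF comm_ring_hom_ev Y n, symmetric])
  define q where "q = \<beta> * disc Y"
  have "ev (?r t0) q \<noteq> 0" using dY t0(4) by (simp add: q_def hom_distribs discY evY ev_of_real)
  hence q_t0: "poly q t0 \<noteq> 0" by (simp add: ev_of_real)
  hence "q \<noteq> 0" by auto
  \<comment> \<open>The normalisations make t = t0 reproduce the choice of T and C: t0
    \<open>\<kappa>\<close> q(t0) = 1, so the summand at the point t0 is exactly Y; 1 + t0 X = T;
    and \<open>\<beta>1\<close> is 1 at 0, so the shift carries 0 to t.\<close>
  define \<kappa> where "\<kappa> = 1 / (t0 * poly q t0)"
  define \<beta>1 where "\<beta>1 = smult (1 / poly \<beta> 0) \<beta>"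
  define X where "X = (1 / t0) \<cdot>\<^sub>m (T - 1\<^sub>m n)"
  have X[simp]: "X \<in> carrier_mat n n" by (simp add: X_def minus_carrier_mat)
  define Xc where "Xc = map_mat complex_of_real X"
  have Xc[simp]: "Xc \<in> carrier_mat n n" by (simp add: Xc_def)

  \<comment> \<open>\<open>w\<close>, \<open>TT\<close> and \<open>AA\<close> are complex values at
    a point, used for continuity. \<open>\<phi>\<close>, \<open>Tp\<close> and \<open>Ap\<close> are
    the same objects over the real polynomials, from which A' and a' are built.\<close>
  define w where "w = (\<lambda>t z. z + ?r t * ev z \<beta>1)"
  define TT where "TT = (\<lambda>t z. 1\<^sub>m n + (?r t * ev z \<beta>1) \<cdot>\<^sub>m Xc)"
  define AA where "AA = (\<lambda>t z. ev_mat z A + (?r t * ?r \<kappa> * ev z q) \<cdot>\<^sub>m ev_mat z Y)"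
  have [simp]: "TT t z \<in> carrier_mat n n" "AA t z \<in> carrier_mat n n" for t z by (simp_all add: TT_def AA_def)
  define \<phi> where "\<phi> = (\<lambda>t. [:0, 1:] + smult t \<beta>1)"
  define Tp where "Tp = (\<lambda>t. 1\<^sub>m n + smult t \<beta>1 \<cdot>\<^sub>m map_mat (\<lambda>x. [:x:]) X)"
  define Ap where "Ap = (\<lambda>t. map_mat (\<lambda>p. pcompose p (\<phi> t)) (A + smult (t * \<kappa>) q \<cdot>\<^sub>m Y))"
  have [simp]: "Tp t \<in> carrier_mat n n" "Ap t \<in> carrier_mat n n" "adj_mat (Tp t) \<in> carrier_mat n n" for t 
    using adj_mat(1)[of "Tp t" n] by (simp_all add: Tp_def Ap_def)
  define A' where "A' = (\<lambda>t. Tp t * Ap t * adj_mat (Tp t))"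
  define a' where "a' = (\<lambda>t. pcompose a (\<phi> t) * det (Tp t))"
  have ev\<phi>: "ev z (\<phi> t) = w t z" for z t by (simp add: \<phi>_def w_def ev.hom_add ev_pCons)
  have evT: "ev_mat z (Tp t) = TT t z" for z t
    unfolding Tp_def TT_def Xc_def using carrier_matD[OF X] by (intro eq_matI) (auto simp: hom_distribs)
  have evA: "ev_mat z (Ap t) = AA t (w t z)" for z t
    unfolding Ap_def AA_def using carrier_matD[OF A] carrier_matD[OF Y] 
    by (intro eq_matI) (auto simp: ev_pcompose ev\<phi> hom_distribs)
  have evA': "ev_mat z (A' t) = TT t z * AA t (w t z) * adj_mat (TT t z)" for z t
    unfolding A'_def evT[symmetric] evA[symmetric]
    by (simp add: ev.mat_hom_mult[of _ n n _ n] adj_mat_hom[OF comm_ring_hom_ev, of _ n] mult_carrier_mat[of _ n n _ n])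
  have eva': "ev z (a' t) = ev (w t z) a * det (TT t z)" for z t
    unfolding a'_def evT[symmetric] by (simp add: hom_distribs ev_pcompose ev\<phi>)

  \<comment> \<open>The shifted point may leave K. At a zero of q outside K the matrix would be A
    itself at a point where A is not known to be diagonalizable, so the finitely many such points
    have to be avoided.\<close>
  define R where "R = {z. ev z q = 0} - K"
  have finR: "finite R"
  proof -
    have "cpoly q \<noteq> 0" using \<open>q \<noteq> 0\<close> by simp
    hence "finite {z. ev z q = 0}" unfolding ev_def by (rule poly_roots_finite)
    thus ?thesis by (simp add: R_def)
  qed
  define N where "N = (\<lambda>t z l. (?r (1 - l) * ev (w t z) a) \<cdot>\<^sub>m 1\<^sub>m n + ?r l \<cdot>\<^sub>m AA t (w t z))"
  have N[simp]: "N t z l \<in> carrier_mat n n" for t z l by (simp add: N_def)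
  \<comment> \<open>One function collects the three conditions that persist for small t: nonsingular
    pencil, invertible T, and shifted point outside R.\<close>
  define G where "G = (\<lambda>(t, z, l). det (N t z l) * det (TT t z) * (\<Prod>\<rho>\<in>R. w t z - \<rho>))"
  have contw: "continuous_on S (\<lambda>x. w (fst x) (fst (snd x)))" for S :: "(real \<times> complex \<times> real) set"
    unfolding w_def by (intro continuous_intros)
  have contG: "continuous_on S G" for S
    unfolding G_def case_prod_unfold
  proof (intro continuous_on_mult continuous_on_prod continuous_on_diff contw continuous_on_const continuous_on_det[of _ n])
    fix i j assume ij: "i < n" "j < n"
    have "N t z l $$ (i, j) = ?r (1 - l) * ev (w t z) a * (if i = j then 1 else 0) + ?r l * (ev (w t z) (A $$ (i, j)) + ?r t * ?r \<kappa> * ev (w t z) q * ev (w t z) (Y $$ (i, j)))" for t z l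
      using ij carrier_matD[OF A] carrier_matD[OF Y] by (simp add: N_def AA_def)
    thus "continuous_on S (\<lambda>x. N (fst x) (fst (snd x)) (snd (snd x)) $$ (i, j))"
      by (simp only:) (intro continuous_intros contw)
    have "TT t z $$ (i, j) = (if i = j then 1 else 0) + ?r t * ev z \<beta>1 * Xc $$ (i, j)" for t z
      using ij carrier_matD[OF Xc] by (simp add: TT_def)
    thus "continuous_on S (\<lambda>x. TT (fst x) (fst (snd x)) $$ (i, j))"
      by (simp only:) (intro continuous_intros)
  qed auto
  have w0: "w 0 z = z" for z by (simp add: w_def)
  have T0: "TT 0 z = 1\<^sub>m n" for z by (simp add: TT_def add_zero_smult_mat[of _ n n])
  have A0: "AA 0 z = ev_mat z A" for z by (simp add: AA_def add_zero_smult_mat[of _ n n])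
  have G0: "G (0, x) \<noteq> 0" if x: "x \<in> K \<times> {0..1}" for x
  proof -
    obtain z l where zl: "x = (z, l)" "z \<in> K" "0 \<le> l" "l \<le> 1" using x by auto
    have "N 0 z l = (?r (1 - l) * ev z a) \<cdot>\<^sub>m 1\<^sub>m n + ?r l \<cdot>\<^sub>m ev_mat z A" by (simp add: N_def w0 A0)
    thus ?thesis using nz[OF zl(2-4)] finR zl(2) by (auto simp: G_def zl(1) w0 T0 R_def)
  qed
  obtain \<delta> where \<delta>: "\<delta> > 0" "\<And>t x. \<bar>t\<bar> < \<delta> \<Longrightarrow> x \<in> K \<times> {0..1} \<Longrightarrow> G (t, x) \<noteq> 0"
    using compact_nonzero_nhds[OF compact_Times[OF K compact_Icc] contG G0] by blast

  \<comment> \<open>As the shift carries 0 to t, the variable of the polynomial h is at once the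
    deformation parameter and the point at which a, A, q and Y are evaluated.\<close>
  define k where "k = map_mat (\<lambda>x :: complex. [:x:])"
  define h where "h = pencil_det (cpoly a) (k B) (k D) (k (1\<^sub>m n) + [:0, 1:] \<cdot>\<^sub>m k Xc)
    (map_mat cpoly A + ([:0, 1:] * [:?r \<kappa>:] * cpoly q) \<cdot>\<^sub>m map_mat cpoly Y)"
  have h: "poly h (?r t) = pencil_det (ev (?r t) a) B D (1\<^sub>m n + ?r t \<cdot>\<^sub>m Xc) (AA t (?r t))" for t
  proof -
    have k: "map_mat (\<lambda>p. poly p s) (k Z) = Z" for s Z unfolding k_def by (intro eq_matI) auto
    have cp: "map_mat (\<lambda>p. poly p s) (map_mat cpoly Z) = ev_mat s Z" for s Z 
      by (intro eq_matI) (auto simp: ev_def)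
    have "map_mat (\<lambda>p. poly p (?r t)) (k (1\<^sub>m n) + [:0, 1:] \<cdot>\<^sub>m k Xc) = 1\<^sub>m n + ?r t \<cdot>\<^sub>m Xc"
      unfolding k_def by (rule hom_poly_pencil[of _ n]) auto
    moreover have "map_mat (\<lambda>p. poly p (?r t)) (map_mat cpoly A + ([:0, 1:] * [:?r \<kappa>:] * cpoly q) \<cdot>\<^sub>m map_mat cpoly Y) = AA t (?r t)"
      by (subst map_mat_add_hom[OF comm_ring_hom_poly, of _ n n])
         (simp_all add: cp map_mat_smult_hom[OF comm_ring_hom_poly] AA_def ev_def mult_ac)
    ultimately show ?thesis unfolding h_def
      using pencil_det_hom[OF comm_ring_hom_poly[of "?r t"], of "k B" n "k D" "k (1\<^sub>m n) + [:0, 1:] \<cdot>\<^sub>m k Xc"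
        "map_mat cpoly A + ([:0, 1:] * [:?r \<kappa>:] * cpoly q) \<cdot>\<^sub>m map_mat cpoly Y" "cpoly a"]
      by (simp add: k ev_def[symmetric]) (simp add: k_def)
  qed
  \<comment> \<open>t0 need not be below \<open>\<delta>\<close>. It only shows that h is not the
    zero polynomial; the parameter actually used is taken from (0, \<open>\<delta>\<close>)
    afterwards.\<close>
  have "poly h (?r t0) \<noteq> 0"
  proof -
    have "1\<^sub>m n + ?r t0 \<cdot>\<^sub>m Xc = map_mat of_real T" unfolding Xc_def X_def
      using t0 carrier_matD[OF T] by (intro eq_matI) (auto simp: field_simps)
    moreover have "?r t0 * ?r \<kappa> * ev (?r t0) q = 1"
      using t0 q_t0 by (simp add: \<kappa>_def ev_of_real)
    hence "AA t0 (?r t0) = ev_mat (?r t0) A + ev_mat (?r t0) Y" by (simp add: AA_def) (intro eq_matI; simp)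
    ultimately show ?thesis unfolding h using pT evY by simp
  qed
  hence "h \<noteq> 0" by auto
  hence fin: "finite {z. poly h z = 0}" by (rule poly_roots_finite)
  have fin': "finite {x. poly h (?r x) = 0}"
    using finite_vimageI[OF fin, of complex_of_real] by (simp add: inj_def vimage_def)
  have "\<not> {0<..<\<delta>} \<subseteq> {x. poly h (?r x) = 0}"
  proof
    assume "{0<..<\<delta>} \<subseteq> {x. poly h (?r x) = 0}"
    from finite_subset[OF this fin'] show False using infinite_Ioo[OF \<delta>(1)] by simp
  qed
  then obtain t where "t \<in> {0<..<\<delta>}" "poly h (?r t) \<noteq> 0" by blast
  hence t: "0 < t" "t < \<delta>" "poly h (?r t) \<noteq> 0" by auto
  have G: "det (N t z l) \<noteq> 0" "det (TT t z) \<noteq> 0" "w t z \<notin> R" if "z \<in> K" "0 \<le> l" "l \<le> 1" for z l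
    using \<delta>(2)[of t "(z, l)"] t that finR by (auto simp: G_def)

  show ?thesis
  proof (rule that[of "A' t" "a' t"])
    show "A' t \<in> carrier_mat n n" by (simp add: A'_def mult_carrier_mat[of _ n n _ n])
  next
    fix z assume z: "z \<in> K"
    show "diagonalizable (ev_mat z (A' t))"
      unfolding evA'
    proof (rule diagonalizable_conj[of _ n])
      show "det (TT t z) \<noteq> 0" using G(2)[OF z, of 0] by simp
      show "diagonalizable (AA t (w t z))"
      proof (cases "ev (w t z) q = 0")
        case True
        hence "w t z \<in> K" using G(3)[OF z, of 0] by (auto simp: R_def)
        thus ?thesis using True diag by (simp add: AA_def add_zero_smult_mat[of _ n n])
      next
        case False
        hence "disc (ev_mat (w t z) Y) \<noteq> 0" by (auto simp: q_def hom_distribs discY)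
        moreover have "ev_mat (w t z) A * ev_mat (w t z) Y = ev_mat (w t z) Y * ev_mat (w t z) A"
          using AY by (simp add: ev.mat_hom_mult[of _ n n _ n, symmetric])
        ultimately show ?thesis unfolding AA_def by (intro diagonalizable_commuting_pencil[of _ n]) auto
      qed
    qed auto
  next
    fix z and l :: real assume z: "z \<in> K" "0 \<le> l" "l \<le> 1"
    let ?T = "TT t z"
    note adj = adj_mat[of ?T n, simplified]
    note [simp] = adj(1) mult_carrier_mat[of _ n n _ n]
    have "?T * N t z l * adj_mat ?T = (?r (1 - l) * ev (w t z) a) \<cdot>\<^sub>m (?T * 1\<^sub>m n * adj_mat ?T) + ?r l \<cdot>\<^sub>m (?T * AA t (w t z) * adj_mat ?T)"
      unfolding N_def by (subst conj_add[of _ n]) (simp_all add: conj_smult[of _ n])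
    also have "?T * 1\<^sub>m n * adj_mat ?T = det ?T \<cdot>\<^sub>m 1\<^sub>m n" by (simp add: right_mult_one_mat[of _ n n] adj(2))
    also have "(?r (1 - l) * ev (w t z) a) \<cdot>\<^sub>m (det ?T \<cdot>\<^sub>m 1\<^sub>m n) = (?r (1 - l) * ev z (a' t)) \<cdot>\<^sub>m 1\<^sub>m n"
      unfolding eva' by (intro eq_matI) auto
    finally have "?T * N t z l * adj_mat ?T = (?r (1 - l) * ev z (a' t)) \<cdot>\<^sub>m 1\<^sub>m n + ?r l \<cdot>\<^sub>m ev_mat z (A' t)"
      unfolding evA' .
    hence *: "det ((?r (1 - l) * ev z (a' t)) \<cdot>\<^sub>m 1\<^sub>m n + ?r l \<cdot>\<^sub>m ev_mat z (A' t)) = det ?T * det (N t z l) * det (adj_mat ?T)"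
      by (metis (no_types, lifting) N adj(1) \<open>\<And>z t. TT t z \<in> carrier_mat n n\<close> det_mult mult_carrier_mat)
    have "det ?T * det (adj_mat ?T) = det (det ?T \<cdot>\<^sub>m 1\<^sub>m n)" 
      using det_mult[of ?T n "adj_mat ?T"] adj(2) by simp
    hence "det (adj_mat ?T) \<noteq> 0" using G(2)[OF z] by (auto simp: det_smult)
    thus "det ((?r (1 - l) * ev z (a' t)) \<cdot>\<^sub>m 1\<^sub>m n + ?r l \<cdot>\<^sub>m ev_mat z (A' t)) \<noteq> 0"
      unfolding * using G[OF z] by simp
  next
    fix z assume z: "ev z \<beta> = 0"
    have "ev z \<beta>1 = 0" "ev z q = 0" using z by (simp_all add: \<beta>1_def q_def hom_distribs)
    hence 1: "w t z = z" "TT t z = 1\<^sub>m n" "AA t z = ev_mat z A"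
      by (simp_all add: w_def TT_def AA_def add_zero_smult_mat[of _ n n])
    show "ev_mat z (A' t) = ev_mat z A \<and> ev z (a' t) = ev z a"
      unfolding evA' eva' 1 adj_mat_one by (simp add: left_mult_one_mat[of _ n n] right_mult_one_mat[of _ n n])
  next
    have "ev 0 \<beta>1 = 1" using \<beta>0 ev_of_real[of 0 \<beta>] by (simp add: \<beta>1_def)
    hence 1: "w t 0 = ?r t" "TT t 0 = 1\<^sub>m n + ?r t \<cdot>\<^sub>m Xc" by (simp_all add: w_def TT_def)
    show "det (ev 0 (a' t) \<cdot>\<^sub>m B + ev_mat 0 (A' t) * D) \<noteq> 0"
      using t(3) unfolding h evA' eva' 1 pencil_det_def .
  qed
qed

subsection \<open>Matrices of stable proper functions\<close>

abbreviation ratfun_mat :: "hfun mat \<Rightarrow> ratfun mat" where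
  "ratfun_mat \<equiv> map_mat Rep_hfun"

abbreviation val_mat :: "ext_complex \<Rightarrow> hfun mat \<Rightarrow> complex mat" where
  "val_mat s \<equiv> map_mat (val s)"

lemma comm_ring_hom_Rep: "comm_ring_hom Rep_hfun"
  by (rule Rep.comm_ring_hom_axioms)

lemma H_mat_iff: "A \<in> H_mat m \<longleftrightarrow> (\<exists>a \<in> carrier_mat m m. A = ratfun_mat a)"
proof
  assume A: "A \<in> H_mat m"
  hence dim: "A \<in> carrier_mat m m" by (simp add: H_mat_def)
  have "A $$ (i, j) \<in> H_ring" if "i < m" "j < m" for i j
    using A that by (auto simp: H_mat_def)
  hence "A = ratfun_mat (map_mat Abs_hfun A)"
    using dim by (intro eq_matI) (auto simp: Abs_hfun_inverse)
  thus "\<exists>a \<in> carrier_mat m m. A = ratfun_mat a" using dim by (intro bexI[of _ "map_mat Abs_hfun A"]) auto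
next
  assume "\<exists>a \<in> carrier_mat m m. A = ratfun_mat a"
  thus "A \<in> H_mat m" using Rep_hfun by (auto simp: H_mat_def)
qed

lemma ratfun_mat_in_H_mat [simp]: "a \<in> carrier_mat m m \<Longrightarrow> ratfun_mat a \<in> H_mat m"
  by (auto simp: H_mat_iff)

lemma value_mat_Rep [simp]: "value_mat (ratfun_mat a) s = val_mat s a"
  unfolding value_mat_def by (intro eq_matI) (auto simp: val_def)

lemma rdet_Rep: "rdet (ratfun_mat a) = Rep_hfun (det a)"
  by (rule Rep.hom_det)

text \<open>By this cancellation a quotient is identified by exhibiting a solution of the linear
  system, without computing the inverse.\<close>

lemma mat_inv_mult_eq:
  fixes A :: "'a :: field mat"
  assumes A: "A \<in> carrier_mat n n" and X: "X \<in> carrier_mat n k" and det: "det A \<noteq> 0"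
  shows "mat_inv A * (A * X) = X"
proof -
  from mat_inverse_exists[OF A det] obtain R where R: "R \<in> carrier_mat n n" "A * R = 1\<^sub>m n" "R * A = 1\<^sub>m n" .
  hence "A \<in> Units (ring_mat TYPE('a) n ())" using A by (auto simp: Units_def ring_mat_def)
  then obtain B where B: "mat_inverse A = Some B" using mat_inverse(1)[OF A, where b = "()"] by (cases "mat_inverse A") auto
  from mat_inverse(2)[OF A B] have "B * A = 1\<^sub>m n" "B \<in> carrier_mat n n" by auto
  moreover from this have "B * (A * X) = X" using A X by (simp add: assoc_mult_mat[symmetric, of _ n n _ n _ k])
  ultimately show ?thesis by (simp add: mat_inv_def B)
qed

lemma mat_inv_eq:
  fixes A :: "'a :: field mat"
  assumes A: "A \<in> carrier_mat n n" and X: "X \<in> carrier_mat n k" and eq: "A * X = Y" and det: "det A \<noteq> 0"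
  shows "mat_inv A * Y = X"
  using mat_inv_mult_eq[OF A X det] eq by simp

text \<open>Cramer's rule: adj(A) Y divided by det A, which is possible because det A is a
  unit.\<close>

lemma unit_det_solve:
  fixes A :: "'a :: idom mat"
  assumes A: "A \<in> carrier_mat n n" and Y: "Y \<in> carrier_mat n n" and u: "det A dvd 1"
  obtains X where "X \<in> carrier_mat n n" "A * X = Y"
proof -
  obtain v where v: "det A * v = 1" using u by (auto elim: dvdE)
  note adj = adj_mat[OF A]
  show ?thesis
  proof
    show "v \<cdot>\<^sub>m (adj_mat A * Y) \<in> carrier_mat n n" using adj Y by auto
    have "A * (v \<cdot>\<^sub>m (adj_mat A * Y)) = v \<cdot>\<^sub>m (A * adj_mat A * Y)"
      using A adj(1) Y by (simp add: mult_smult_distrib[of _ n n _ n] assoc_mult_mat[of _ n n _ n _ n] mult_carrier_mat[of _ n n _ n])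
    also have "\<dots> = (v * det A) \<cdot>\<^sub>m Y" unfolding adj(2) using Y
      by (simp add: mult_smult_assoc_mat[of _ n n _ n] left_mult_one_mat[of _ n n]) (intro eq_matI; simp)
    also have "\<dots> = Y" using v by (intro eq_matI) (auto simp: mult.commute)
    finally show "A * (v \<cdot>\<^sub>m (adj_mat A * Y)) = Y" .
  qed
qed

text \<open>For l \<noteq> 0 the pencil is l (A - (1 - 1/l)), and l \<mapsto> 1 - 1/l maps (0, 1]
  onto the nonpositive reals. At l = 0 the pencil is the identity.\<close>

lemma eigenvalues_avoid_nonpos_iff:
  fixes A :: "complex mat"
  assumes A: "A \<in> carrier_mat n n"
  shows "(\<forall>x\<le>0. \<not> eigenvalue A (complex_of_real x)) \<longleftrightarrow>
    (\<forall>l\<in>{0..1}. det (complex_of_real (1 - l) \<cdot>\<^sub>m 1\<^sub>m n + complex_of_real l \<cdot>\<^sub>m A) \<noteq> 0)"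
proof -
  let ?r = complex_of_real
  have *: "det (?r (1 - l) \<cdot>\<^sub>m 1\<^sub>m n + ?r l \<cdot>\<^sub>m A) = 0 \<longleftrightarrow> eigenvalue A (?r (1 - 1 / l))" if "l \<noteq> 0" for l
  proof -
    have "?r (1 - l) \<cdot>\<^sub>m 1\<^sub>m n + ?r l \<cdot>\<^sub>m A = ?r l \<cdot>\<^sub>m char_matrix A (?r (1 - 1 / l))"
      unfolding char_matrix_def using A that by (intro eq_matI) (auto simp: field_simps)
    thus ?thesis unfolding eigenvalue_det[OF A] using that A char_matrix_closed[OF A] by (simp add: det_smult)
  qed
  show ?thesis
  proof (intro iffI ballI allI impI)
    fix l :: real assume neg: "\<forall>x\<le>0. \<not> eigenvalue A (?r x)" and l: "l \<in> {0..1}"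
    show "det (?r (1 - l) \<cdot>\<^sub>m 1\<^sub>m n + ?r l \<cdot>\<^sub>m A) \<noteq> 0"
    proof (cases "l = 0")
      case True
      thus ?thesis using A by (simp add: add_zero_smult_mat[of _ n n] det_smult)
    next
      case False
      hence "1 - 1 / l \<le> 0" using l by (simp add: field_simps)
      thus ?thesis using neg *[OF False] by blast
    qed
  next
    fix x :: real assume nz: "\<forall>l\<in>{0..1}. det (?r (1 - l) \<cdot>\<^sub>m 1\<^sub>m n + ?r l \<cdot>\<^sub>m A) \<noteq> 0" and x: "x \<le> 0"
    \<comment> \<open>This l solves 1 - 1/l = x.\<close>
    have "1 / (1 - x) \<in> {0..1}" "1 / (1 - x) \<noteq> 0" using x by auto
    from nz[rule_format, OF this(1)] *[OF this(2)] show "\<not> eigenvalue A (?r x)" by simp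
  qed
qed

text \<open>Infinity is no eigenvalue here, because entries from the ring have no poles in
  \<open>C_plus\<close>.\<close>

lemma ext_eigenvalues_avoid_iff:
  assumes w: "w \<in> carrier_mat n n" and s: "s \<in> C_plus"
  shows "ext_eigenvalues (ratfun_mat w) s \<inter> ext_nonpos = {} \<longleftrightarrow>
    (\<forall>l\<in>{0..1}. det (complex_of_real (1 - l) \<cdot>\<^sub>m 1\<^sub>m n + complex_of_real l \<cdot>\<^sub>m val_mat s w) \<noteq> 0)"
proof -
  have "ext_eigenvalues (ratfun_mat w) s = {Fin e | e. eigenvalue (val_mat s w) e}"
    using Rep_regular[OF s] by (auto simp: ext_eigenvalues_def)
  moreover have "val_mat s w \<in> carrier_mat n n" using w by simp
  ultimately show ?thesis unfolding eigenvalues_avoid_nonpos_iff[OF \<open>val_mat s w \<in> carrier_mat n n\<close>, symmetric]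
    by (auto simp: ext_nonpos_def)
qed

lemma diagonalizable_smult:
  assumes A: "A \<in> carrier_mat n n" "diagonalizable A"
  shows "diagonalizable (c \<cdot>\<^sub>m A)"
proof -
  from diagonalizableE[OF A(2,1)] obtain G H L where GHL: "G \<in> carrier_mat n n" "H \<in> carrier_mat n n" "L \<in> carrier_mat n n"
    "diagonal_mat L" "G * H = 1\<^sub>m n" "H * G = 1\<^sub>m n" "A = G * L * H" .
  have "c \<cdot>\<^sub>m A = G * (c \<cdot>\<^sub>m L) * H" unfolding GHL(7) using GHL by (simp add: conj_smult[of _ n])
  also have "diagonalizable \<dots>" using GHL diagonal_mat_pencil(2)[OF GHL(3,3,4,4)] by (intro diagonalizableI[of _ n]) auto
  finally show ?thesis .
qed

definition hinterp :: "real \<Rightarrow> hfun mat \<Rightarrow> hfun mat \<Rightarrow> hfun mat" where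
  "hinterp l a b = hconst l \<cdot>\<^sub>m b + hconst (1 - l) \<cdot>\<^sub>m a"

lemma hinterp_carrier [simp]: "a \<in> carrier_mat n k \<Longrightarrow> b \<in> carrier_mat n k \<Longrightarrow> hinterp l a b \<in> carrier_mat n k"
  by (simp add: hinterp_def)

lemma interp_Rep:
  assumes "a \<in> carrier_mat n k" "b \<in> carrier_mat n k"
  shows "interp l (ratfun_mat a) (ratfun_mat b) = ratfun_mat (hinterp l a b)"
  using assms unfolding interp_def hinterp_def
  by (intro eq_matI) (auto simp: Rep.hom_add Rep.hom_mult hconst.rep_eq)

lemma mult_hinterp:
  assumes [simp]: "c \<in> carrier_mat n n" "a \<in> carrier_mat n n" "b \<in> carrier_mat n n"
    "c' \<in> carrier_mat n n" "a' \<in> carrier_mat n n" "b' \<in> carrier_mat n n"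
  shows "c * hinterp l a b + c' * hinterp l a' b' = hinterp l (c * a + c' * a') (c * b + c' * b')"
proof -
  note [simp] = mult_carrier_mat[of _ n n _ n]
  have 1: "c * hinterp l a b = hconst l \<cdot>\<^sub>m (c * b) + hconst (1 - l) \<cdot>\<^sub>m (c * a)"
    "c' * hinterp l a' b' = hconst l \<cdot>\<^sub>m (c' * b') + hconst (1 - l) \<cdot>\<^sub>m (c' * a')"
    unfolding hinterp_def by (simp_all add: mult_add_distrib_mat[of _ n n _ n] mult_smult_distrib[of _ n n _ n])
  define x y x' y' where "x = c * b" "y = c * a" "x' = c' * b'" "y' = c' * a'"
  have [simp]: "x \<in> carrier_mat n n" "y \<in> carrier_mat n n" "x' \<in> carrier_mat n n" "y' \<in> carrier_mat n n"
    by (simp_all add: x_y_x'_y'_def)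
  show ?thesis unfolding 1 unfolding hinterp_def x_y_x'_y'_def[symmetric]
    using carrier_matD[of x n n] carrier_matD[of y n n] carrier_matD[of x' n n] carrier_matD[of y' n n]
    by (intro eq_matI) (simp_all add: algebra_simps)
qed

lemma val_det_hinterp:
  assumes s: "s \<in> C_plus" and [simp]: "a \<in> carrier_mat n n" "w \<in> carrier_mat n n"
  shows "val s (det (hinterp l a (a * w))) = val s (det a) * 
    det (complex_of_real (1 - l) \<cdot>\<^sub>m 1\<^sub>m n + complex_of_real l \<cdot>\<^sub>m val_mat s w)"
proof -
  interpret v: comm_ring_hom "val s" by (rule val_hom[OF s])
  let ?h = "hinterp l (1\<^sub>m n) w"
  have "hinterp l a (a * w) = a * ?h"
    unfolding hinterp_def by (simp add: mult_add_distrib_mat[of _ n n _ n] mult_smult_distrib[of _ n n _ n] right_mult_one_mat[of _ n n])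
  hence "val s (det (hinterp l a (a * w))) = val s (det a) * val s (det ?h)"
    by (simp add: det_mult[of _ n] v.hom_mult)
  also have "val s (det ?h) = det (val_mat s ?h)" by simp
  also have "val_mat s ?h = complex_of_real (1 - l) \<cdot>\<^sub>m 1\<^sub>m n + complex_of_real l \<cdot>\<^sub>m val_mat s w"
    unfolding hinterp_def using carrier_matD[OF assms(3)] 
    by (intro eq_matI) (auto simp: v.hom_add v.hom_mult)
  finally show ?thesis .
qed

section \<open>Block rows\<close>

lemma hblock_carrier [simp]:
  "A \<in> carrier_mat n k \<Longrightarrow> B \<in> carrier_mat n l \<Longrightarrow> hblock A B \<in> carrier_mat n (k + l)"
  unfolding hblock_def by auto

lemma hblock_index:
  assumes "A \<in> carrier_mat n k" "B \<in> carrier_mat n l" "i < n" "j < k + l"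
  shows "hblock A B $$ (i, j) = (if j < k then A $$ (i, j) else B $$ (i, j - k))"
  using assms by (auto simp: hblock_def)

lemma hblock_map:
  assumes "A \<in> carrier_mat n k" "B \<in> carrier_mat n l"
  shows "map_mat f (hblock A B) = hblock (map_mat f A) (map_mat f B)"
  using assms by (intro eq_matI) (auto simp: hblock_def)

lemma hblock_inject:
  assumes [simp]: "A \<in> carrier_mat n k" "B \<in> carrier_mat n l" "A' \<in> carrier_mat n k" "B' \<in> carrier_mat n l"
    and eq: "hblock A B = hblock A' B'"
  shows "A = A'" "B = B'"
proof -
  have 1: "hblock A B $$ (i, j) = hblock A' B' $$ (i, j)" for i j by (simp add: eq)
  show "A = A'"
  proof (rule eq_matI)
    fix i j assume "i < dim_row A'" "j < dim_col A'"
    hence "i < n" "j < k" using carrier_matD[OF assms(3)] by auto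
    thus "A $$ (i, j) = A' $$ (i, j)" using 1[of i j] by (simp add: hblock_index[of _ n k _ l])
  qed (use carrier_matD[OF assms(1)] carrier_matD[OF assms(3)] in auto)
  show "B = B'"
  proof (rule eq_matI)
    fix i j assume "i < dim_row B'" "j < dim_col B'"
    hence "i < n" "j < l" using carrier_matD[OF assms(4)] by auto
    thus "B $$ (i, j) = B' $$ (i, j)" using 1[of i "j + k"] by (simp add: hblock_index[of _ n k _ l])
  qed (use carrier_matD[OF assms(2)] carrier_matD[OF assms(4)] in auto)
qed

lemma hblock_split:
  assumes "X \<in> carrier_mat n (k + l)"
  obtains A B where "A \<in> carrier_mat n k" "B \<in> carrier_mat n l" "X = hblock A B"
proof
  show "mat n k (\<lambda>(i, j). X $$ (i, j)) \<in> carrier_mat n k" "mat n l (\<lambda>(i, j). X $$ (i, j + k)) \<in> carrier_mat n l" by auto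
  show "X = hblock (mat n k (\<lambda>(i, j). X $$ (i, j))) (mat n l (\<lambda>(i, j). X $$ (i, j + k)))"
    using assms by (intro eq_matI) (auto simp: hblock_def)
qed

lemma hblock_mult:
  fixes A B :: "'a :: comm_ring_1 mat"
  assumes c: "A \<in> carrier_mat n k" "B \<in> carrier_mat n l" 
    "A1 \<in> carrier_mat k p" "B1 \<in> carrier_mat k q" "A2 \<in> carrier_mat l p" "B2 \<in> carrier_mat l q"
  shows "hblock A B * four_block_mat A1 B1 A2 B2 = hblock (A * A1 + B * A2) (A * B1 + B * B2)"
proof -
  have "hblock A B = four_block_mat A B (0\<^sub>m 0 k) (0\<^sub>m 0 l)" using c by (simp add: hblock_def)
  also have "\<dots> * four_block_mat A1 B1 A2 B2 = four_block_mat (A * A1 + B * A2) (A * B1 + B * B2)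
     (0\<^sub>m 0 k * A1 + 0\<^sub>m 0 l * A2) (0\<^sub>m 0 k * B1 + 0\<^sub>m 0 l * B2)"
    by (rule mult_four_block_mat) (use c in auto)
  also have "\<dots> = hblock (A * A1 + B * A2) (A * B1 + B * B2)"
    using c by (intro eq_matI) (auto simp: hblock_def)
  finally show ?thesis .
qed

lemma mult_hblock:
  fixes C :: "'a :: comm_ring_1 mat"
  assumes c: "C \<in> carrier_mat n n" "A \<in> carrier_mat n k" "B \<in> carrier_mat n l"
  shows "C * hblock A B = hblock (C * A) (C * B)"
proof (rule eq_matI)
  fix i j assume "i < dim_row (hblock (C * A) (C * B))" "j < dim_col (hblock (C * A) (C * B))"
  hence ij: "i < n" "j < k + l" using c by (auto simp: hblock_def)
  have "(C * hblock A B) $$ (i, j) = (\<Sum>r = 0..<n. C $$ (i, r) * hblock A B $$ (r, j))"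
    using ij c carrier_matD[OF hblock_carrier[OF c(2,3)]] by (simp add: scalar_prod_def)
  also have "\<dots> = (\<Sum>r = 0..<n. C $$ (i, r) * (if j < k then A $$ (r, j) else B $$ (r, j - k)))"
    using ij by (intro sum.cong refl) (simp add: hblock_index[OF c(2,3)])
  also have "\<dots> = hblock (C * A) (C * B) $$ (i, j)"
    using ij c by (auto simp: hblock_index[of _ n k _ l] scalar_prod_def)
  finally show "(C * hblock A B) $$ (i, j) = hblock (C * A) (C * B) $$ (i, j)" .
qed (use c in \<open>auto simp: hblock_def\<close>)

section \<open>Transfer of the deformation from the disc to \<open>C_plus\<close>\<close>

lemma hfun_common_denominator:
  assumes "finite S"
  shows "\<exists>a. (\<forall>s\<in>C_plus. ev (zof s) a \<noteq> 0) \<and> (\<forall>h\<in>S. \<exists>p. hpoly a * h = hpoly p)"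
  using assms
proof (induction S)
  case empty
  show ?case by (intro exI[of _ 1]) simp
next
  case (insert h S)
  then obtain a where a: "\<forall>s\<in>C_plus. ev (zof s) a \<noteq> 0" "\<forall>h\<in>S. \<exists>p. hpoly a * h = hpoly p" by auto
  obtain p b where b: "h * hpoly b = hpoly p" "\<And>s. s \<in> C_plus \<Longrightarrow> ev (zof s) b \<noteq> 0" using hfun_rep[of h] by metis
  have "hpoly (a * b) * h = hpoly (a * p)" using b(1) by (simp add: hpoly.hom_mult mult_ac flip: b(1))
  hence "\<exists>p. hpoly (a * b) * h = hpoly p" by blast
  moreover have "\<exists>p. hpoly (a * b) * g = hpoly p" if "g \<in> S" for g
  proof -
    from a(2) that obtain r where "hpoly a * g = hpoly r" by auto
    hence "hpoly (a * b) * g = hpoly (b * r)" by (simp add: hpoly.hom_mult mult_ac flip: \<open>hpoly a * g = hpoly r\<close>)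
    thus ?thesis by blast
  qed
  moreover have "\<forall>s\<in>C_plus. ev (zof s) (a * b) \<noteq> 0" using a(1) b(2) by (simp add: ev.hom_mult)
  ultimately show ?case by blast
qed

lemma hfun_mat_rep:
  assumes w: "w \<in> carrier_mat n n"
  obtains A a where "A \<in> carrier_mat n n" "\<And>s. s \<in> C_plus \<Longrightarrow> ev (zof s) a \<noteq> 0"
    "\<And>s. s \<in> C_plus \<Longrightarrow> ev_mat (zof s) A = ev (zof s) a \<cdot>\<^sub>m val_mat s w"
proof -
  let ?S = "(\<lambda>(i, j). w $$ (i, j)) ` ({..<n} \<times> {..<n})"
  obtain a where a: "\<forall>s\<in>C_plus. ev (zof s) a \<noteq> 0" "\<forall>h\<in>?S. \<exists>p. hpoly a * h = hpoly p"
    using hfun_common_denominator[of ?S] by auto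
  have "\<exists>p. i < n \<and> j < n \<longrightarrow> hpoly a * w $$ (i, j) = hpoly p" for i j using a(2) by force
  then obtain f where f: "\<And>i j. i < n \<Longrightarrow> j < n \<Longrightarrow> hpoly a * w $$ (i, j) = hpoly (f i j)" by metis
  show ?thesis
  proof
    show "mat n n (\<lambda>(i, j). f i j) \<in> carrier_mat n n" by simp
    show "ev (zof s) a \<noteq> 0" if "s \<in> C_plus" for s using a(1) that by blast
    fix s assume s: "s \<in> C_plus"
    interpret v: comm_ring_hom "val s" by (rule val_hom[OF s])
    show "ev_mat (zof s) (mat n n (\<lambda>(i, j). f i j)) = ev (zof s) a \<cdot>\<^sub>m val_mat s w"
      using w by (intro eq_matI) (auto simp: val_hpoly[OF s, symmetric] f[symmetric] v.hom_mult)
  qed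
qed

text \<open>The deformation in terms of the variable s. It is used with d = det M and with B, D the
  right-hand blocks of M^-1 at infinity, so that the last conclusion says that \<open>Dc\<close> is
  invertible at infinity.\<close>

lemma perturbed_quotient:
  fixes w :: "hfun mat" and B D P Q :: "complex mat"
  assumes m: "m > 0" and w: "w \<in> carrier_mat m m" 
    and BD: "B \<in> carrier_mat m m" "D \<in> carrier_mat m m" "P \<in> carrier_mat m m" "Q \<in> carrier_mat m m"
    and eq: "P * B + Q * D = 1\<^sub>m m"
    and d: "val Infty d \<noteq> 0"
    and diag: "\<And>s. s \<in> C_plus \<Longrightarrow> diagonalizable (val_mat s w)"
    and nz: "\<And>s l. s \<in> C_plus \<Longrightarrow> l \<in> {0..1} \<Longrightarrow>
      det (complex_of_real (1 - l) \<cdot>\<^sub>m 1\<^sub>m m + complex_of_real l \<cdot>\<^sub>m val_mat s w) \<noteq> 0"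
  obtains w' where "w' \<in> carrier_mat m m"
    "\<And>s. s \<in> C_plus \<Longrightarrow> diagonalizable (val_mat s w')"
    "\<And>s l. s \<in> C_plus \<Longrightarrow> l \<in> {0..1} \<Longrightarrow>
      det (complex_of_real (1 - l) \<cdot>\<^sub>m 1\<^sub>m m + complex_of_real l \<cdot>\<^sub>m val_mat s w') \<noteq> 0"
    "\<And>s. s \<in> C_plus \<Longrightarrow> val s d = 0 \<Longrightarrow> val_mat s w' = val_mat s w"
    "det (B + val_mat Infty w' * D) \<noteq> 0"
proof -
  let ?r = complex_of_real
  have pencil: "(?r (1 - l) * a) \<cdot>\<^sub>m 1\<^sub>m m + ?r l \<cdot>\<^sub>m (a \<cdot>\<^sub>m W) = a \<cdot>\<^sub>m (?r (1 - l) \<cdot>\<^sub>m 1\<^sub>m m + ?r l \<cdot>\<^sub>m W)" 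
    if "W \<in> carrier_mat m m" for l a W
    using that by (intro eq_matI) (auto simp: algebra_simps)
  have vw: "val_mat s w \<in> carrier_mat m m" for s using w by simp
  obtain A a where A: "A \<in> carrier_mat m m" and a: "\<And>s. s \<in> C_plus \<Longrightarrow> ev (zof s) a \<noteq> 0"
    and Aw: "\<And>s. s \<in> C_plus \<Longrightarrow> ev_mat (zof s) A = ev (zof s) a \<cdot>\<^sub>m val_mat s w" using hfun_mat_rep[OF w] by metis
  \<comment> \<open>In the coordinate z, b is the numerator of d. It vanishes at the zeros of d in
    \<open>C_plus\<close>, because it is d times e there, and not at z = 0, because d does not
    vanish at infinity.\<close>
  obtain b e where be: "d * hpoly e = hpoly b" and e: "\<And>s. s \<in> C_plus \<Longrightarrow> ev (zof s) e \<noteq> 0" 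
    using hfun_rep[of d] by metis
  have evb: "ev (zof s) b = val s d * ev (zof s) e" if s: "s \<in> C_plus" for s
  proof -
    interpret v: comm_ring_hom "val s" by (rule val_hom[OF s])
    show ?thesis using arg_cong[OF be, of "val s"] by (simp add: v.hom_mult val_hpoly[OF s])
  qed
  have "ev 0 b \<noteq> 0" using evb[of Infty] d e[of Infty] by simp
  hence b0: "poly b 0 \<noteq> 0" using ev_of_real[of 0 b] by auto
  have K: "compact (zof ` C_plus)" unfolding zof_image by simp
  have K01: "?r x \<in> zof ` C_plus" if "0 \<le> x" "x \<le> 1" for x
  proof -
    have "dist (1/2) (?r x) = \<bar>1/2 - x\<bar>" by (simp add: dist_norm flip: norm_of_real[where 'a = complex])
    also have "\<dots> \<le> 1/2" unfolding abs_le_iff using that by auto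
    finally show ?thesis unfolding zof_image mem_cball .
  qed
  have diagA: "diagonalizable (ev_mat z A)" if "z \<in> zof ` C_plus" for z
    using that Aw diagonalizable_smult[OF vw] diag by auto
  have nzA: "det ((?r (1 - l) * ev z a) \<cdot>\<^sub>m 1\<^sub>m m + ?r l \<cdot>\<^sub>m ev_mat z A) \<noteq> 0"
    if z: "z \<in> zof ` C_plus" and l: "0 \<le> l" "l \<le> 1" for z l
  proof -
    obtain s where s: "s \<in> C_plus" "z = zof s" using z by auto
    show ?thesis unfolding s(2) Aw[OF s(1)] pencil[OF vw]
      using a[OF s(1)] nz[OF s(1), of l] l vw by (simp add: det_smult)
  qed
  obtain A' a' where A': "A' \<in> carrier_mat m m"
    and diagA': "\<And>z. z \<in> zof ` C_plus \<Longrightarrow> diagonalizable (ev_mat z A')"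
    and nzA': "\<And>z l. z \<in> zof ` C_plus \<Longrightarrow> 0 \<le> l \<Longrightarrow> l \<le> 1 \<Longrightarrow>
      det ((?r (1 - l) * ev z a') \<cdot>\<^sub>m 1\<^sub>m m + ?r l \<cdot>\<^sub>m ev_mat z A') \<noteq> 0"
    and int: "\<And>z. ev z b = 0 \<Longrightarrow> ev_mat z A' = ev_mat z A \<and> ev z a' = ev z a"
    and det: "det (ev 0 a' \<cdot>\<^sub>m B + ev_mat 0 A' * D) \<noteq> 0"
    using pencil_deformation[OF m A BD eq K K01 diagA nzA b0] by blast
  have a': "ev (zof s) a' \<noteq> 0" if s: "s \<in> C_plus" for s
    using nzA'[of "zof s" 0] s m A' by (auto simp: add_zero_smult_mat[of _ m m] det_smult)
  \<comment> \<open>The pencil at l = 0 is a' times the identity, so a' has no zero on the disc and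
    the quotient A' / a' lies in the ring.\<close>
  have "hpoly a' dvd 1" using a' by (simp add: hfun_unit_iff val_hpoly)
  then obtain u where u: "hpoly a' * u = 1" by (auto elim: dvdE)
  define w' where "w' = u \<cdot>\<^sub>m map_mat hpoly A'"
  have w': "w' \<in> carrier_mat m m" using A' by (simp add: w'_def)
  have vw': "val_mat s w' \<in> carrier_mat m m" for s using w' by simp
  have ev_A': "ev_mat (zof s) A' = ev (zof s) a' \<cdot>\<^sub>m val_mat s w'" and valw': "val_mat s w' = (1 / ev (zof s) a') \<cdot>\<^sub>m ev_mat (zof s) A'"
    if s: "s \<in> C_plus" for s
  proof -
    interpret v: comm_ring_hom "val s" by (rule val_hom[OF s])
    have vu: "ev (zof s) a' * val s u = 1" using arg_cong[OF u, of "val s"] by (simp add: v.hom_mult val_hpoly[OF s])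
    show "ev_mat (zof s) A' = ev (zof s) a' \<cdot>\<^sub>m val_mat s w'"
      unfolding w'_def using vu by (intro eq_matI) (auto simp: v.hom_mult val_hpoly[OF s] simp flip: mult.assoc)
    thus "val_mat s w' = (1 / ev (zof s) a') \<cdot>\<^sub>m ev_mat (zof s) A'"
      using a'[OF s] A' w' by (intro eq_matI) auto
  qed
  show ?thesis
  proof (rule that[OF w'])
    fix s assume s: "s \<in> C_plus"
    show "diagonalizable (val_mat s w')" unfolding valw'[OF s]
      using diagA'[of "zof s"] s A' by (intro diagonalizable_smult[of _ m]) auto
    show "det (?r (1 - l) \<cdot>\<^sub>m 1\<^sub>m m + ?r l \<cdot>\<^sub>m val_mat s w') \<noteq> 0" if "l \<in> {0..1}" for l
      using nzA'[of "zof s" l] s that vw' a'[OF s] unfolding ev_A'[OF s] pencil[OF vw'] 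
      by (auto simp: det_smult)
    show "val_mat s w' = val_mat s w" if "val s d = 0"
    proof -
      have "ev (zof s) b = 0" using evb[OF s] that by simp
      from int[OF this] show ?thesis unfolding valw'[OF s] using Aw[OF s] a[OF s] w by (intro eq_matI) auto
    qed
  next
    have 1: "ev_mat 0 A' = ev 0 a' \<cdot>\<^sub>m val_mat Infty w'" using ev_A'[of Infty] by simp
    have "ev 0 a' \<cdot>\<^sub>m B + ev_mat 0 A' * D = ev 0 a' \<cdot>\<^sub>m (B + val_mat Infty w' * D)"
      unfolding 1 using vw' BD by (simp add: mult_smult_assoc_mat[of _ m m _ m] add_smult_distrib_left_mat[of _ m m] mult_carrier_mat[of _ m m _ m])
    thus "det (B + val_mat Infty w' * D) \<noteq> 0" using det by (auto simp: det_smult)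
  qed
qed

lemma mat_dvd_cancel:
  fixes X :: "'a :: idom mat"
  assumes "X \<in> carrier_mat n k" "\<And>i j. i < n \<Longrightarrow> j < k \<Longrightarrow> d dvd X $$ (i, j)"
  obtains Z where "Z \<in> carrier_mat n k" "X = d \<cdot>\<^sub>m Z"
proof -
  have "\<exists>z. i < n \<and> j < k \<longrightarrow> X $$ (i, j) = d * z" for i j using assms(2)[of i j] by (auto elim: dvdE)
  then obtain f where f: "\<And>i j. i < n \<Longrightarrow> j < k \<Longrightarrow> X $$ (i, j) = d * f i j" by metis
  show ?thesis by (rule that[of "mat n k (\<lambda>(i, j). f i j)"]) (use assms(1) f in auto)
qed

lemma smult_mat_cancel:
  fixes X :: "'a :: idom mat"
  assumes "d \<noteq> 0" "X \<in> carrier_mat n k" "Y \<in> carrier_mat n k" "d \<cdot>\<^sub>m X = d \<cdot>\<^sub>m Y"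
  shows "X = Y"
proof (rule eq_matI)
  fix i j assume "i < dim_row Y" "j < dim_col Y"
  thus "X $$ (i, j) = Y $$ (i, j)"
    using arg_cong[OF assms(4), of "\<lambda>M. M $$ (i, j)"] assms(1-3) by auto
qed (use assms in auto)

lemma zero_at_Rep: "s \<in> C_plus \<Longrightarrow> zero_at (Rep_hfun h) s \<longleftrightarrow> val s h = 0"
  using Rep_regular by (auto simp: zero_at_def val_def)

theorem proposition5:
  fixes m :: nat and N0 N1 D0 D1 P0 P1 M :: "ratfun mat"
  assumes "0 < m"
    and "right_fraction m P0 N0 D0"
    and "right_fraction m P1 N1 D1"
    and "P0 \<noteq> P1"
    and "M = four_block_mat N0 N1 D0 D1"
    and "value_at (rdet M) Infty \<noteq> 0"
    and "\<forall>s \<in> C_plus. zero_at (rdet M) s \<longrightarrow> zero_order (rdet M) s = 1"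
  shows "(\<exists>K Nc Dc. left_fraction m K Nc Dc \<and> proper_mat K \<and>
            diagonalizable_on_C_plus (mat_inv (Nc * N0 + Dc * D0) * (Nc * N1 + Dc * D1)) \<and>
            (\<forall>lam \<in> {0..1}. stabilizes m Nc Dc (interp lam N0 N1) (interp lam D0 D1)))
     \<longleftrightarrow>
         (\<exists>\<Delta>0 \<in> H_mat m. \<exists>\<Delta>1 \<in> H_mat m.
            rdet \<Delta>0 \<in> J_units \<and> rdet \<Delta>1 \<in> J_units \<and>
            diagonalizable_on_C_plus (mat_inv \<Delta>0 * \<Delta>1) \<and>
            (\<forall>s \<in> C_plus. zero_at (rdet M) s \<longrightarrow>
               hblock (value_mat \<Delta>0 s) (value_mat \<Delta>1 s) * adj_mat (value_mat M s)
                 = 0\<^sub>m m (2 * m)) \<and>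
            (\<forall>s \<in> C_plus. ext_eigenvalues (mat_inv \<Delta>0 * \<Delta>1) s \<inter> ext_nonpos = {}))"
    (is "?lhs \<longleftrightarrow> ?rhs")
proof -
  have "N0 \<in> H_mat m" "N1 \<in> H_mat m" "D0 \<in> H_mat m" "D1 \<in> H_mat m"
    using assms(2,3) by (auto simp: right_fraction_def)
  then obtain n0 n1 d0 d1 where nd [simp]: "n0 \<in> carrier_mat m m" "n1 \<in> carrier_mat m m" "d0 \<in> carrier_mat m m" "d1 \<in> carrier_mat m m"
    and ND: "N0 = ratfun_mat n0" "N1 = ratfun_mat n1" "D0 = ratfun_mat d0" "D1 = ratfun_mat d1"
    by (auto simp: H_mat_iff)
  note [simp] = mult_carrier_mat[of _ m m _ m]
  define Mh where "Mh = four_block_mat n0 n1 d0 d1"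
  have Mh: "Mh \<in> carrier_mat (m + m) (m + m)" by (simp add: Mh_def)
  have M: "M = ratfun_mat Mh" unfolding assms(5) ND Mh_def by (rule map_four_block_mat[symmetric, of _ m m _ m _ m]) auto
  define d where "d = det Mh"
  have detM: "rdet M = Rep_hfun d" by (simp add: M d_def)
  have dinf: "val Infty d \<noteq> 0" using assms(6) by (simp add: detM val_def)
  interpret vi: comm_ring_hom "val Infty" by (rule val_hom) simp
  have d_nz: "d \<noteq> 0" using dinf by auto
  have adj: "adj_mat Mh \<in> carrier_mat (m + m) (m + m)" "Mh * adj_mat Mh = d \<cdot>\<^sub>m 1\<^sub>m (m + m)" "adj_mat Mh * Mh = d \<cdot>\<^sub>m 1\<^sub>m (m + m)"
    unfolding d_def by (rule adj_mat[OF Mh])+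
  have RepM: "ratfun_mat a * ratfun_mat b = ratfun_mat (a * b)" "ratfun_mat a + ratfun_mat b = ratfun_mat (a + b)"
    if "a \<in> carrier_mat m m" "b \<in> carrier_mat m m" for a b
    using that map_mat_add_hom[OF comm_ring_hom_Rep that] by (simp_all add: Rep.mat_hom_mult[of _ m m _ m])
  have comp: "ratfun_mat nc * interp l N0 N1 + ratfun_mat dc * interp l D0 D1 = 
      ratfun_mat (hinterp l (nc * n0 + dc * d0) (nc * n1 + dc * d1))"
    if "nc \<in> carrier_mat m m" "dc \<in> carrier_mat m m" for l nc dc
    using that unfolding ND by (simp add: interp_Rep[of _ m m] RepM mult_hinterp[of _ m])
  have stab: "stabilizes m (ratfun_mat nc) (ratfun_mat dc) (interp l N0 N1) (interp l D0 D1) \<longleftrightarrow> 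
      det (hinterp l (nc * n0 + dc * d0) (nc * n1 + dc * d1)) dvd 1"
    if "nc \<in> carrier_mat m m" "dc \<in> carrier_mat m m" for l nc dc
    unfolding stabilizes_def comp[OF that] using that by (auto simp: rdet_Rep J_units_iff)
  have quotient: "mat_inv (ratfun_mat a) * ratfun_mat (a * w) = ratfun_mat w"
    if "a \<in> carrier_mat m m" "w \<in> carrier_mat m m" "det a dvd 1" for a w
  proof (rule mat_inv_eq[of _ m])
    show "det (ratfun_mat a) \<noteq> 0" using that(3) by auto
    show "ratfun_mat a * ratfun_mat w = ratfun_mat (a * w)" using that by (simp add: RepM)
  qed (use that in auto)
  have hinterp01: "hinterp 0 a b = a" "hinterp 1 a b = b" if "a \<in> carrier_mat m m" "b \<in> carrier_mat m m" for a b
  proof -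
    have "hconst 1 = 1" by transfer (simp add: to_fract_1_poly)
    thus "hinterp 0 a b = a" "hinterp 1 a b = b" using that by (auto simp: hinterp_def intro!: eq_matI)
  qed
  have block: "hblock (val_mat s a) (val_mat s b) * adj_mat (val_mat s Mh) = val_mat s (hblock a b * adj_mat Mh)"
    if s: "s \<in> C_plus" and ab: "a \<in> carrier_mat m m" "b \<in> carrier_mat m m" for s a b
  proof -
    interpret v: comm_ring_hom "val s" by (rule val_hom[OF s])
    show ?thesis unfolding hblock_map[OF ab, symmetric] adj_mat_hom[OF val_hom[OF s] Mh, symmetric]
      by (rule v.mat_hom_mult[symmetric, OF hblock_carrier[OF ab] adj(1)])
  qed
  show ?thesis
  proof
    assume ?lhs
    then obtain K Nc Dc where lf: "left_fraction m K Nc Dc"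
      and diag: "diagonalizable_on_C_plus (mat_inv (Nc * N0 + Dc * D0) * (Nc * N1 + Dc * D1))"
      and st: "\<forall>l\<in>{0..1}. stabilizes m Nc Dc (interp l N0 N1) (interp l D0 D1)" by blast
    from lf have "Nc \<in> H_mat m" "Dc \<in> H_mat m" by (auto simp: left_fraction_def)
    then obtain nc dc where c[simp]: "nc \<in> carrier_mat m m" "dc \<in> carrier_mat m m" 
      and C: "Nc = ratfun_mat nc" "Dc = ratfun_mat dc" by (auto simp: H_mat_iff)
    define a b where "a = nc * n0 + dc * d0" and "b = nc * n1 + dc * d1"
    have ab[simp]: "a \<in> carrier_mat m m" "b \<in> carrier_mat m m" by (simp_all add: a_def b_def)
    have unit: "det (hinterp l a b) dvd 1" if "l \<in> {0..1}" for l
      using st that unfolding C stab[OF c] a_def b_def by blast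
    have ua: "det a dvd 1" and ub: "det b dvd 1" using unit[of 0] unit[of 1] by (simp_all add: hinterp01)
    \<comment> \<open>The quotient of the pair is itself stable and proper, since the determinant of
      \<open>a\<close> is a unit.\<close>
    obtain w where w: "w \<in> carrier_mat m m" "a * w = b" by (rule unit_det_solve[OF ab ua])
    have NaD: "Nc * N0 + Dc * D0 = ratfun_mat a" "Nc * N1 + Dc * D1 = ratfun_mat b"
      unfolding C ND a_def b_def by (simp_all add: RepM)
    have q: "mat_inv (ratfun_mat a) * ratfun_mat b = ratfun_mat w" using quotient[OF ab(1) w(1) ua] w(2) by simp
    show ?rhs
    proof (rule bexI[of _ "ratfun_mat a"], rule bexI[of _ "ratfun_mat b"], intro conjI ballI impI)
      show "rdet (ratfun_mat a) \<in> J_units" "rdet (ratfun_mat b) \<in> J_units" 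
        using ua ub by (simp_all only: rdet_Rep J_units_iff)
      show "diagonalizable_on_C_plus (mat_inv (ratfun_mat a) * ratfun_mat b)" using diag unfolding NaD .
      fix s assume s: "s \<in> C_plus"
      interpret v: comm_ring_hom "val s" by (rule val_hom[OF s])
      show "ext_eigenvalues (mat_inv (ratfun_mat a) * ratfun_mat b) s \<inter> ext_nonpos = {}"
        unfolding q ext_eigenvalues_avoid_iff[OF w(1) s]
      proof
        fix l :: real assume "l \<in> {0..1}"
        hence "val s (det (hinterp l a (a * w))) \<noteq> 0" using unit s by (simp add: w(2) hfun_unit_iff)
        thus "det (complex_of_real (1 - l) \<cdot>\<^sub>m 1\<^sub>m m + complex_of_real l \<cdot>\<^sub>m val_mat s w) \<noteq> 0"
          unfolding val_det_hinterp[OF s ab(1) w(1)] by simp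
      qed
      assume "zero_at (rdet M) s"
      hence z: "val s d = 0" by (simp add: detM zero_at_Rep[OF s])
      \<comment> \<open>Condition (a): [a b] = [nc dc] M, so multiplication by the adjugate gives d
        [nc dc], which vanishes wherever d does.\<close>
      have "hblock a b * adj_mat Mh = hblock nc dc * (Mh * adj_mat Mh)"
      proof -
        have "hblock a b = hblock nc dc * Mh" unfolding Mh_def a_def b_def
          by (rule hblock_mult[symmetric, of _ m m _ m _ m _ m]) auto
        thus ?thesis using Mh adj(1) hblock_carrier[OF c] by (simp add: assoc_mult_mat[of _ m "m + m" _ "m + m" _ "m + m"])
      qed
      also have "\<dots> = d \<cdot>\<^sub>m hblock nc dc" unfolding adj(2)
        using hblock_carrier[OF c] by (simp add: mult_smult_distrib[of _ m "m + m" _ "m + m"] right_mult_one_mat[of _ m "m + m"])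
      finally show "hblock (value_mat (ratfun_mat a) s) (value_mat (ratfun_mat b) s) * adj_mat (value_mat M s) = 0\<^sub>m m (2 * m)"
        unfolding M value_mat_Rep block[OF s ab] using z carrier_matD[OF hblock_carrier[OF c]]
        by (intro eq_matI) (auto simp: v.hom_mult mult_2)
    qed auto
  next
    assume ?rhs
    then obtain \<Delta>0 \<Delta>1 where \<Delta>: "\<Delta>0 \<in> H_mat m" "\<Delta>1 \<in> H_mat m" "rdet \<Delta>0 \<in> J_units"
      and diag: "diagonalizable_on_C_plus (mat_inv \<Delta>0 * \<Delta>1)"
      and int: "\<And>s. s \<in> C_plus \<Longrightarrow> zero_at (rdet M) s \<Longrightarrow> 
         hblock (value_mat \<Delta>0 s) (value_mat \<Delta>1 s) * adj_mat (value_mat M s) = 0\<^sub>m m (2 * m)"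
      and eig: "\<And>s. s \<in> C_plus \<Longrightarrow> ext_eigenvalues (mat_inv \<Delta>0 * \<Delta>1) s \<inter> ext_nonpos = {}" by blast
    from \<Delta>(1,2) obtain a b where ab[simp]: "a \<in> carrier_mat m m" "b \<in> carrier_mat m m" and \<Delta>ab: "\<Delta>0 = ratfun_mat a" "\<Delta>1 = ratfun_mat b"
      by (auto simp: H_mat_iff)
    have ua: "det a dvd 1" using \<Delta>(3) by (simp only: \<Delta>ab rdet_Rep J_units_iff)
    obtain w where w: "w \<in> carrier_mat m m" "a * w = b" by (rule unit_det_solve[OF ab ua])
    have q: "mat_inv \<Delta>0 * \<Delta>1 = ratfun_mat w" unfolding \<Delta>ab using quotient[OF ab(1) w(1) ua] w(2) by simp
    have diagw: "diagonalizable (val_mat s w)" if "s \<in> C_plus" for s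
      using diag that by (simp add: q diagonalizable_on_C_plus_def)
    have nzw: "det (complex_of_real (1 - l) \<cdot>\<^sub>m 1\<^sub>m m + complex_of_real l \<cdot>\<^sub>m val_mat s w) \<noteq> 0"
      if "s \<in> C_plus" "l \<in> {0..1}" for s l
      using eig[OF that(1)] that(2) by (simp add: q ext_eigenvalues_avoid_iff[OF w(1) that(1)])
    \<comment> \<open>Condition (a) passes from the pair (\<open>a\<close>, \<open>b\<close>) to (1,
      \<open>w\<close>), because \<open>a\<close> is invertible at every point of
      \<open>C_plus\<close>.\<close>
    have intw: "val_mat s (hblock (1\<^sub>m m) w * adj_mat Mh) = 0\<^sub>m m (m + m)" if s: "s \<in> C_plus" and z: "val s d = 0" for s
    proof -
      interpret v: comm_ring_hom "val s" by (rule val_hom[OF s])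
      let ?X = "hblock (1\<^sub>m m) w * adj_mat Mh"
      have h1: "hblock (1\<^sub>m m) w \<in> carrier_mat m (m + m)" using w by simp
      have X: "?X \<in> carrier_mat m (m + m)" by (rule mult_carrier_mat[OF h1 adj(1)])
      have "hblock a b = a * hblock (1\<^sub>m m) w"
        using w by (simp add: mult_hblock[of _ m _ m _ m] right_mult_one_mat[of _ m m])
      hence aX: "hblock a b * adj_mat Mh = a * ?X" using h1 adj(1) ab(1)
        by (simp add: assoc_mult_mat[of _ m m _ "m + m" _ "m + m"])
      have "zero_at (rdet M) s" unfolding detM zero_at_Rep[OF s] by (rule z)
      from int[OF s this] have "val_mat s (hblock a b * adj_mat Mh) = 0\<^sub>m m (2 * m)"
        unfolding \<Delta>ab M value_mat_Rep block[OF s ab] .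
      hence 0: "val_mat s a * val_mat s ?X = 0\<^sub>m m (m + m)"
        unfolding aX v.mat_hom_mult[OF ab(1) X] by (simp add: mult_2)
      have "det (val_mat s a) \<noteq> 0" using ua s by (simp add: hfun_unit_iff)
      then obtain R where R: "R \<in> carrier_mat m m" "R * val_mat s a = 1\<^sub>m m" 
        using mat_inverse_exists[of "val_mat s a" m] by auto
      have "val_mat s ?X = (R * val_mat s a) * val_mat s ?X" unfolding R(2) using X by (simp add: left_mult_one_mat[of _ m "m + m"])
      also have "\<dots> = R * (val_mat s a * val_mat s ?X)" using R(1) X by (intro assoc_mult_mat[of _ m m _ m _ "m + m"]) auto
      also have "\<dots> = 0\<^sub>m m (m + m)" unfolding 0 using R(1) by simp
      finally show ?thesis .
    qed
    have vMh: "val_mat Infty Mh \<in> carrier_mat (m + m) (m + m)" using Mh by simp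
    have "det (val_mat Infty Mh) \<noteq> 0" using dinf by (simp add: d_def)
    then obtain R where R: "R \<in> carrier_mat (m + m) (m + m)" "val_mat Infty Mh * R = 1\<^sub>m (m + m)"
      using mat_inverse_exists[OF vMh] by auto
    \<comment> \<open>R is the inverse of M at infinity. Only its right-hand blocks B and D enter
      the right-hand block of [1 W] R, which is B + W D.\<close>
    obtain R1 B R3 D where spl: "split_block R m m = (R1, B, R3, D)" by (cases "split_block R m m") auto
    from split_block[OF spl, of m m] R(1) have 
      RB[simp]: "R1 \<in> carrier_mat m m" "B \<in> carrier_mat m m" "R3 \<in> carrier_mat m m" "D \<in> carrier_mat m m" 
      and Rb: "R = four_block_mat R1 B R3 D" by auto
    have vMb: "val_mat Infty Mh = four_block_mat (val_mat Infty n0) (val_mat Infty n1) (val_mat Infty d0) (val_mat Infty d1)"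
      unfolding Mh_def by (rule map_four_block_mat[of _ m m _ m _ m]) auto
    \<comment> \<open>The lower right block of M R = 1: the Bezout identity that makes a nonsingular
      B + Z D possible.\<close>
    have PQ: "val_mat Infty d0 * B + val_mat Infty d1 * D = 1\<^sub>m m"
    proof -
      let ?X = "val_mat Infty d0 * B + val_mat Infty d1 * D"
      have X: "?X \<in> carrier_mat m m" by simp
      have f: "four_block_mat (val_mat Infty n0 * R1 + val_mat Infty n1 * R3) (val_mat Infty n0 * B + val_mat Infty n1 * D)
        (val_mat Infty d0 * R1 + val_mat Infty d1 * R3) ?X = 1\<^sub>m (m + m)"
        unfolding R(2)[symmetric] unfolding vMb Rb by (rule mult_four_block_mat[symmetric, of _ m m _ m _ m _ _ m _ m]) auto
      show ?thesis
      proof (rule eq_matI)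
        fix i j assume "i < dim_row (1\<^sub>m m)" "j < dim_col (1\<^sub>m m)"
        hence ij: "i < m" "j < m" by auto
        have "?X $$ (i, j) = four_block_mat (val_mat Infty n0 * R1 + val_mat Infty n1 * R3) (val_mat Infty n0 * B + val_mat Infty n1 * D)
        (val_mat Infty d0 * R1 + val_mat Infty d1 * R3) ?X $$ (i + m, j + m)"
          using ij carrier_matD[OF X] carrier_matD[OF nd(1)] carrier_matD[OF RB(1)] carrier_matD[OF RB(3)] carrier_matD[OF nd(2)]
          by (subst index_mat_four_block) auto
        also have "\<dots> = 1\<^sub>m m $$ (i, j)" unfolding f using ij by simp
        finally show "?X $$ (i, j) = 1\<^sub>m m $$ (i, j)" .
      qed (use carrier_matD[OF X] in auto)
    qed
    \<comment> \<open>From here on the pair (1, w') takes the place of the given one.\<close>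
    obtain w' where w'[simp]: "w' \<in> carrier_mat m m"
      and diagw': "\<And>s. s \<in> C_plus \<Longrightarrow> diagonalizable (val_mat s w')"
      and nzw': "\<And>s l. s \<in> C_plus \<Longrightarrow> l \<in> {0..1} \<Longrightarrow>
        det (complex_of_real (1 - l) \<cdot>\<^sub>m 1\<^sub>m m + complex_of_real l \<cdot>\<^sub>m val_mat s w') \<noteq> 0"
      and intw': "\<And>s. s \<in> C_plus \<Longrightarrow> val s d = 0 \<Longrightarrow> val_mat s w' = val_mat s w"
      and detw': "det (B + val_mat Infty w' * D) \<noteq> 0"
      using perturbed_quotient[OF assms(1) w(1) RB(2,4) _ _ PQ dinf diagw nzw] by auto
    have h1: "hblock (1\<^sub>m m) w' \<in> carrier_mat m (m + m)" by simp
    let ?X = "hblock (1\<^sub>m m) w' * adj_mat Mh"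
    have X: "?X \<in> carrier_mat m (m + m)" by (rule mult_carrier_mat[OF h1 adj(1)])
    \<comment> \<open>Agreement of w' with w at the zeros of d keeps condition (a) valid for the new
      pair.\<close>
    have "d dvd ?X $$ (i, j)" if ij: "i < m" "j < m + m" for i j
    proof (rule hfun_dvd[OF dinf])
      fix s assume s: "s \<in> C_plus" and z: "val s d = 0"
      have "val_mat s ?X = val_mat s (hblock (1\<^sub>m m) w * adj_mat Mh)"
        unfolding block[OF s one_carrier_mat w', symmetric] block[OF s one_carrier_mat w(1), symmetric] intw'[OF s z] ..
      also have "\<dots> = 0\<^sub>m m (m + m)" by (rule intw[OF s z])
      finally have "val_mat s ?X $$ (i, j) = 0" using ij by simp
      hence "val s (?X $$ (i, j)) = 0" using ij carrier_matD[OF X] by simp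
      moreover have "zero_order (Rep_hfun d) s = 1" using assms(7) s z by (simp add: detM zero_at_Rep)
      ultimately show "val s (?X $$ (i, j)) = 0 \<and> zero_order (Rep_hfun d) s = 1" ..
    qed
    from mat_dvd_cancel[OF X this] obtain Z where Z: "Z \<in> carrier_mat m (m + m)" and XZ: "?X = d \<cdot>\<^sub>m Z" by metis
    obtain nc dc where c[simp]: "nc \<in> carrier_mat m m" "dc \<in> carrier_mat m m" and Zc: "Z = hblock nc dc"
      by (rule hblock_split[OF Z])
    have ZM: "Z * Mh = hblock (1\<^sub>m m) w'"
    proof (rule smult_mat_cancel[OF d_nz])
      have "d \<cdot>\<^sub>m (Z * Mh) = ?X * Mh" unfolding XZ using Z Mh by (simp add: mult_smult_assoc_mat[of _ m "m + m" _ "m + m"])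
      also have "\<dots> = hblock (1\<^sub>m m) w' * (adj_mat Mh * Mh)" using h1 adj(1) Mh by (simp add: assoc_mult_mat[of _ m "m + m" _ "m + m" _ "m + m"])
      also have "\<dots> = d \<cdot>\<^sub>m hblock (1\<^sub>m m) w'" unfolding adj(3) using h1 
        by (simp add: mult_smult_distrib[of _ m "m + m" _ "m + m"] right_mult_one_mat[of _ m "m + m"])
      finally show "d \<cdot>\<^sub>m (Z * Mh) = d \<cdot>\<^sub>m hblock (1\<^sub>m m) w'" .
    qed (use Z Mh h1 in auto)
    have "hblock (nc * n0 + dc * d0) (nc * n1 + dc * d1) = hblock (1\<^sub>m m) w'"
      unfolding ZM[symmetric] Zc Mh_def by (rule hblock_mult[symmetric, of _ m m _ m _ m _ m]) auto
    from hblock_inject[of _ m m _ m, OF _ _ _ _ this] have e: "nc * n0 + dc * d0 = 1\<^sub>m m" "nc * n1 + dc * d1 = w'" by auto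
    \<comment> \<open>At infinity [nc dc] = [nc dc] M R = [1 w'] R; compare the right-hand
      blocks.\<close>
    have vdc: "val_mat Infty dc = B + val_mat Infty w' * D"
    proof -
      have "hblock (val_mat Infty nc) (val_mat Infty dc) = val_mat Infty Z"
        unfolding Zc by (rule hblock_map[symmetric, of _ m m _ m]) auto
      also have "\<dots> = val_mat Infty Z * (val_mat Infty Mh * R)" unfolding R(2) using Z by (simp add: right_mult_one_mat[of _ m "m + m"])
      also have "\<dots> = val_mat Infty (Z * Mh) * R" using Z Mh R(1) 
        by (simp add: vi.mat_hom_mult[of _ m "m + m" _ "m + m"] assoc_mult_mat[of _ m "m + m" _ "m + m" _ "m + m"])
      also have "\<dots> = hblock (1\<^sub>m m) (val_mat Infty w') * R" unfolding ZM 
        by (simp add: hblock_map[of _ m m _ m] vi.mat_hom_one)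
      also have "\<dots> = hblock (1\<^sub>m m * R1 + val_mat Infty w' * R3) (1\<^sub>m m * B + val_mat Infty w' * D)"
        unfolding Rb by (rule hblock_mult[of _ m m _ m _ m _ m]) auto
      finally have "val_mat Infty dc = 1\<^sub>m m * B + val_mat Infty w' * D" 
        by (rule hblock_inject(2)[of _ m m _ m, rotated 4]) auto
      thus ?thesis by (simp add: left_mult_one_mat[of _ m m])
    qed
    have vddc: "val Infty (det dc) \<noteq> 0" using detw' by (simp flip: vdc)
    hence "det dc \<noteq> 0" by auto
    hence rdc: "rdet (ratfun_mat dc) \<noteq> 0" by (simp add: rdet_Rep)
    define K where "K = mat_inv (ratfun_mat dc) * ratfun_mat nc"
    \<comment> \<open>By Cramer's rule the entries of K have the denominator det dc, which does not
      vanish at infinity; so K is proper.\<close>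
    have K: "K = (1 / Rep_hfun (det dc)) \<cdot>\<^sub>m ratfun_mat (adj_mat dc * nc)"
    proof -
      note adc = adj_mat[OF c(2)]
      let ?Y = "(1 / Rep_hfun (det dc)) \<cdot>\<^sub>m ratfun_mat (adj_mat dc * nc)"
      have "ratfun_mat dc * ?Y = (1 / Rep_hfun (det dc)) \<cdot>\<^sub>m ratfun_mat (dc * adj_mat dc * nc)"
        using adc(1) by (simp add: mult_smult_distrib[of _ m m _ m] RepM assoc_mult_mat[of _ m m _ m _ m])
      also have "dc * adj_mat dc * nc = det dc \<cdot>\<^sub>m nc" unfolding adc(2) 
        by (simp add: mult_smult_assoc_mat[of _ m m _ m] left_mult_one_mat[of _ m m])
      also have "(1 / Rep_hfun (det dc)) \<cdot>\<^sub>m ratfun_mat (det dc \<cdot>\<^sub>m nc) = ratfun_mat nc"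
        using \<open>det dc \<noteq> 0\<close> by (intro eq_matI) (auto simp: Rep.hom_mult)
      finally show ?thesis unfolding K_def using adc(1) rdc by (intro mat_inv_eq[of _ m _ m]) auto
    qed
    show ?lhs
    proof (rule exI[of _ K], rule exI[of _ "ratfun_mat nc"], rule exI[of _ "ratfun_mat dc"], intro conjI ballI)
      \<comment> \<open>The first matrix of the new pair is 1, so \<open>n0\<close> and
        \<open>d0\<close> themselves are Bezout cofactors.\<close>
      have "left_coprime m (ratfun_mat nc) (ratfun_mat dc)" unfolding left_coprime_def
      proof (rule bexI[of _ "ratfun_mat n0"], rule bexI[of _ "ratfun_mat d0"])
        show "ratfun_mat nc * ratfun_mat n0 + ratfun_mat dc * ratfun_mat d0 = 1\<^sub>m m"
          by (simp add: RepM e Rep.mat_hom_one)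
      qed auto
      thus "left_fraction m K (ratfun_mat nc) (ratfun_mat dc)" using rdc by (simp add: left_fraction_def K_def)
      show "proper_mat K" unfolding proper_mat_def K using proper_divide[OF vddc] by auto
      have "mat_inv (ratfun_mat nc * N0 + ratfun_mat dc * D0) * (ratfun_mat nc * N1 + ratfun_mat dc * D1) = ratfun_mat w'"
      proof -
        have "mat_inv (ratfun_mat (1\<^sub>m m)) * ratfun_mat (1\<^sub>m m * w') = ratfun_mat w'" by (rule quotient) auto
        thus ?thesis unfolding ND by (simp add: RepM e left_mult_one_mat[of _ m m])
      qed
      thus "diagonalizable_on_C_plus (mat_inv (ratfun_mat nc * N0 + ratfun_mat dc * D0) * (ratfun_mat nc * N1 + ratfun_mat dc * D1))"
        using diagw' by (simp add: diagonalizable_on_C_plus_def)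
      fix l :: real assume l: "l \<in> {0..1}"
      have "val s (det (hinterp l (1\<^sub>m m) (1\<^sub>m m * w'))) \<noteq> 0" if s: "s \<in> C_plus" for s
      proof -
        interpret v: comm_ring_hom "val s" by (rule val_hom[OF s])
        show ?thesis unfolding val_det_hinterp[OF s one_carrier_mat w'] using nzw'[OF s l] by simp
      qed
      hence "det (hinterp l (1\<^sub>m m) w') dvd 1" by (simp add: hfun_unit_iff left_mult_one_mat[of _ m m])
      thus "stabilizes m (ratfun_mat nc) (ratfun_mat dc) (interp l N0 N1) (interp l D0 D1)"
        unfolding stab[OF c] e .
    qed
  qed
qed

end
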